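(* For the MIMO Gaussian channel $\mathbf y_i=\Lambda\mathbf x_i+\mathbf z_i$ with state-space noise and any $n$, the $n$-letter capacity $$C_n(P)=\max_{P(\mathbf x^n\|\mathbf y^n):\ \frac1n\sum_{i=1}^n\mathbb E[\mathbf x_i^T\mathbf x_i]\le P}\ \frac1n\big(h(\mathbf y^n)-h(\mathbf z^n)\big)$$ is upper bounded by the convex optimization problem $$C_n(P)\le\max_{\{\Gamma_i,\Pi_i,\hat\Sigma_{i+1}\}_{i=1}^n}\ \frac1{2n}\sum_{i=1}^n\big[\log\det(\Psi_{Y,i})-\log\det(\Psi_i)\big]$$ subject to, for $t=1,\dots,n$, $$\begin{pmatrix}\Pi_t&\Gamma_t\\ \Gamma_t^T&\hat\Sigma_t\end{pmatrix}\succeq0,\qquad \frac1n\sum_{i=1}^n\mathrm{Tr}(\Pi_i)\le P,$$ $$\Psi_{Y,t}=\Lambda\Pi_t\Lambda^T+H\hat\Sigma_tH^T+\Lambda\Gamma_tH^T+H\Gamma_t^T\Lambda^T+\Psi_t,$$ $$K_{Y,t}=(F\Gamma_t^T\Lambda^T+F\hat\Sigma_tH^T+K_{p,t}\Psi_t)\Psi_{Y,t}^{-1},$$ $$\begin{pmatrix}F\hat\Sigma_tF^T+K_{p,t}\Psi_tK_{p,t}^T-\hat\Sigma_{t+1}&K_{Y,t}\Psi_{Y,t}\\ \Psi_{Y,t}K_{Y,t}^T&\Psi_{Y,t}\end{pmatrix}\succeq0,$$ together with $\hat\Sigma_{n+1}\succeq0$ and $\hat\Sigma_1=0$.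
   Context: Channel: $\mathbf y_i=\Lambda\mathbf x_i+\mathbf z_i$, $i=1,2,\dots$, $\mathbf x_i\in\mathbb R^m$, $\mathbf y_i\in\mathbb R^p$, $\Lambda\in\mathbb R^{p\times m}$. Noise: $\mathbf s_{i+1}=F\mathbf s_i+G\mathbf w_i$, $\mathbf z_i=H\mathbf s_i+\mathbf v_i$, with $\mathbf s_i\in\mathbb R^d$, $(\mathbf w_i,\mathbf v_i)$ i.i.d. jointly Gaussian zero-mean with $\mathrm{cov}(\mathbf w_i)=W$, $\mathrm{cov}(\mathbf v_i)=V$, $\mathbb E[\mathbf w_i\mathbf v_i^T]=L$, independent of $\mathbf s_1\sim N(0,\Sigma_1)$. $P(\mathbf x^n\|\mathbf y^n)=\prod_{i=1}^nP(\mathbf x_i|\mathbf x^{i-1},\mathbf y^{i-1})$ denotes a causally conditioned input distribution (strictly causal feedback): given $(\mathbf x^{i-1},\mathbf y^{i-1})$ the input $\mathbf x_i$ is drawn independently of the current and future noise innovations. $h$ is differential entropy. Constants (not optimized): $\Sigma_{i+1}=F\Sigma_iF^T+GWG^T-K_{p,i}\Psi_iK_{p,i}^T$, $K_{p,i}=(F\Sigma_iH^T+GL)\Psi_i^{-1}$, $\Psi_i=H\Sigma_iH^T+V$, started at $\Sigma_1$; it is assumed $\Psi_i\succ0$ for all $i$. Decision variables: $\Pi_i\in\mathbb R^{m\times m}$, $\Gamma_i\in\mathbb R^{m\times d}$, $\hat\Sigma_i\in\mathbb R^{d\times d}$ ($\Pi_i,\hat\Sigma_i$ symmetric). *)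

theory Defs
  imports "HOL-Probability.Probability"
begin

section \<open>Matrices\<close>

definition pos_semidef :: "real^'n^'n \<Rightarrow> bool" where
  "pos_semidef A \<longleftrightarrow> transpose A = A \<and> (\<forall>x. 0 \<le> x \<bullet> (A *v x))"

definition pos_def :: "real^'n^'n \<Rightarrow> bool" where
  "pos_def A \<longleftrightarrow> transpose A = A \<and> (\<forall>x. x \<noteq> 0 \<longrightarrow> 0 < x \<bullet> (A *v x))"

definition block_matrix ::
  "real^'a^'a \<Rightarrow> real^'b^'a \<Rightarrow> real^'a^'b \<Rightarrow> real^'b^'b \<Rightarrow> real^('a + 'b)^('a + 'b)" where
  "block_matrix A B C D = (\<chi> i j.
     case i of
       Inl k \<Rightarrow> (case j of Inl l \<Rightarrow> A $ k $ l | Inr l \<Rightarrow> B $ k $ l)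
     | Inr k \<Rightarrow> (case j of Inl l \<Rightarrow> C $ k $ l | Inr l \<Rightarrow> D $ k $ l))"


section \<open>Gaussian vectors\<close>

text \<open>Degenerate Gaussians are admitted: covariance matrices may be singular.\<close>

definition normal_law :: "real \<Rightarrow> real \<Rightarrow> real measure" where
  "normal_law \<mu> \<sigma> =
     (if \<sigma> = 0 then return borel \<mu> else density lborel (\<lambda>x. ennreal (normal_density \<mu> \<sigma> x)))"

definition gaussian_vector :: "'w measure \<Rightarrow> ('w \<Rightarrow> 'a::euclidean_space) \<Rightarrow> bool" where
  "gaussian_vector M X \<longleftrightarrow> X \<in> borel_measurable M \<and>
     (\<forall>a. \<exists>\<mu> \<sigma>. 0 \<le> \<sigma> \<and> distr M borel (\<lambda>\<omega>. a \<bullet> X \<omega>) = normal_law \<mu> \<sigma>)"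

definition cross_moment :: "'w measure \<Rightarrow> ('w \<Rightarrow> real^'a) \<Rightarrow> ('w \<Rightarrow> real^'b) \<Rightarrow> real^'b^'a" where
  "cross_moment M X Y = (\<chi> i j. LINT \<omega>|M. X \<omega> $ i * Y \<omega> $ j)"

definition cov_matrix :: "'w measure \<Rightarrow> ('w \<Rightarrow> real^'a) \<Rightarrow> real^'a^'a" where
  "cov_matrix M X =
     cross_moment M (\<lambda>\<omega>. X \<omega> - (LINT \<omega>|M. X \<omega>)) (\<lambda>\<omega>. X \<omega> - (LINT \<omega>|M. X \<omega>))"


section \<open>Independence\<close>

text \<open>The library's \<open>indep_var\<close> requires both variables to take values in the same type.\<close>

definition indep_pair ::
  "'w measure \<Rightarrow> 'a measure \<Rightarrow> ('w \<Rightarrow> 'a) \<Rightarrow> 'b measure \<Rightarrow> ('w \<Rightarrow> 'b) \<Rightarrow> bool" where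
  "indep_pair M A X B Y \<longleftrightarrow> X \<in> M \<rightarrow>\<^sub>M A \<and> Y \<in> M \<rightarrow>\<^sub>M B \<and>
     prob_space.indep_set M (sets (vimage_algebra (space M) X A))
       (sets (vimage_algebra (space M) Y B))"


section \<open>Differential entropy of a block\<close>

text \<open>In nats. The reference measure is Lebesgue measure on the \<open>n\<close>-fold power of the
  Euclidean space.\<close>

definition block_entropy :: "'w measure \<Rightarrow> nat \<Rightarrow> (nat \<Rightarrow> 'w \<Rightarrow> 'a::euclidean_space) \<Rightarrow> real" where
  "block_entropy M n Y =
     prob_space.entropy M (exp 1) (\<Pi>\<^sub>M i\<in>{..<n}. lborel) (\<lambda>\<omega>. \<lambda>i\<in>{..<n}. Y i \<omega>)"


section \<open>Causally conditioned inputs\<close>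

text \<open>Time starts at \<open>0\<close> throughout. A history of length \<open>i\<close> consists of the pairs
  (input, output) at times \<open>0, \<dots>, i - 1\<close>.\<close>

abbreviation history_space :: "nat \<Rightarrow> (nat \<Rightarrow> (real^'m) \<times> (real^'p)) measure" where
  "history_space i \<equiv> (\<Pi>\<^sub>M j\<in>{..<i}. borel \<Otimes>\<^sub>M borel)"

text \<open>A causally conditioned input distribution is given by its factors: \<open>\<kappa> i\<close> is the
  conditional law of the input at time \<open>i\<close> given the history of length \<open>i\<close>.\<close>

type_synonym ('m, 'p) policy = "nat \<Rightarrow> (nat \<Rightarrow> (real^'m) \<times> (real^'p)) \<Rightarrow> (real^'m) measure"

definition policy :: "nat \<Rightarrow> ('m::finite, 'p::finite) policy \<Rightarrow> bool" where
  "policy n \<kappa> \<longleftrightarrow> (\<forall>i<n. \<kappa> i \<in> history_space i \<rightarrow>\<^sub>M prob_algebra borel)"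

text \<open>The law of the history of length \<open>i\<close> when the noise sequence is frozen to \<open>z\<close>. Each input
  is sampled from the past inputs and outputs only, so no further dependence on the noise
  can enter.\<close>

primrec history_law ::
  "real^'m^'p \<Rightarrow> ('m::finite, 'p::finite) policy \<Rightarrow> (nat \<Rightarrow> real^'p) \<Rightarrow> nat
     \<Rightarrow> (nat \<Rightarrow> (real^'m) \<times> (real^'p)) measure" where
  "history_law \<Lambda> \<kappa> z 0 = return (history_space 0) (\<lambda>_. undefined)"
| "history_law \<Lambda> \<kappa> z (Suc i) =
     history_law \<Lambda> \<kappa> z i \<bind> (\<lambda>h. \<kappa> i h \<bind>
       (\<lambda>x. return (history_space (Suc i)) (h(i := (x, \<Lambda> *v x + z i)))))"

definition joint_law ::
  "'w measure \<Rightarrow> (nat \<Rightarrow> 'w \<Rightarrow> real^'p) \<Rightarrow> real^'m^'p \<Rightarrow> nat \<Rightarrow> ('m::finite, 'p::finite) policy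
     \<Rightarrow> (nat \<Rightarrow> (real^'m) \<times> (real^'p)) measure" where
  "joint_law M z \<Lambda> n \<kappa> = M \<bind> (\<lambda>\<omega>. history_law \<Lambda> \<kappa> (\<lambda>i. z i \<omega>) n)"

text \<open>Integrability is stated separately because the Lebesgue integral of a non-integrable
  function is \<open>0\<close>.\<close>

definition power_constraint ::
  "(nat \<Rightarrow> (real^'m) \<times> (real^'p)) measure \<Rightarrow> nat \<Rightarrow> real \<Rightarrow> bool" where
  "power_constraint J n P \<longleftrightarrow>
     (\<forall>i<n. integrable J (\<lambda>h. fst (h i) \<bullet> fst (h i))) \<and>
     1 / real n * (\<Sum>i<n. LINT h|J. fst (h i) \<bullet> fst (h i)) \<le> P"

definition n_letter_capacity ::
  "'w measure \<Rightarrow> (nat \<Rightarrow> 'w \<Rightarrow> real^'p) \<Rightarrow> real^'m^'p \<Rightarrow> nat \<Rightarrow> real \<Rightarrow> ereal" where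
  "n_letter_capacity M z \<Lambda> n P =
     (SUP \<kappa>\<in>{\<kappa>. policy n \<kappa> \<and> power_constraint (joint_law M z \<Lambda> n \<kappa>) n P}.
        ereal (1 / real n *
          (block_entropy (joint_law M z \<Lambda> n \<kappa>) n (\<lambda>i h. snd (h i)) - block_entropy M n z)))"


section \<open>The optimization problem\<close>

text \<open>A decision consists of the sequences \<open>Q\<close> and \<open>\<Gamma>\<close>, relevant at times \<open>0, \<dots>, n - 1\<close>,
  and \<open>S\<close>, relevant at times \<open>0, \<dots>, n\<close>. In the usual notation, \<open>Q\<close> is a capital pi
  (reserved syntax here) and \<open>S\<close> is a capital sigma with a hat.\<close>

type_synonym ('m, 'd) decision =
  "(nat \<Rightarrow> real^'m^'m) \<times> (nat \<Rightarrow> real^'d^'m) \<times> (nat \<Rightarrow> real^'d^'d)"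

definition output_cov ::
  "real^'m^'p \<Rightarrow> real^'d^'p \<Rightarrow> (nat \<Rightarrow> real^'p^'p) \<Rightarrow> ('m, 'd) decision \<Rightarrow> nat \<Rightarrow> real^'p^'p" where
  "output_cov \<Lambda> H \<Psi> = (\<lambda>(Q, \<Gamma>, S) t.
     \<Lambda> ** Q t ** transpose \<Lambda> + H ** S t ** transpose H
     + \<Lambda> ** \<Gamma> t ** transpose H + H ** transpose (\<Gamma> t) ** transpose \<Lambda> + \<Psi> t)"

definition output_gain ::
  "real^'m^'p \<Rightarrow> real^'d^'d \<Rightarrow> real^'d^'p \<Rightarrow> (nat \<Rightarrow> real^'p^'d) \<Rightarrow> (nat \<Rightarrow> real^'p^'p)
     \<Rightarrow> ('m, 'd) decision \<Rightarrow> nat \<Rightarrow> real^'p^'d" where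
  "output_gain \<Lambda> F H Kp \<Psi> = (\<lambda>(Q, \<Gamma>, S) t.
     (F ** transpose (\<Gamma> t) ** transpose \<Lambda> + F ** S t ** transpose H + Kp t ** \<Psi> t)
     ** matrix_inv (output_cov \<Lambda> H \<Psi> (Q, \<Gamma>, S) t))"

definition feasible ::
  "real^'m^'p \<Rightarrow> real^'d^'d \<Rightarrow> real^'d^'p \<Rightarrow> (nat \<Rightarrow> real^'p^'d) \<Rightarrow> (nat \<Rightarrow> real^'p^'p)
     \<Rightarrow> nat \<Rightarrow> real \<Rightarrow> ('m, 'd) decision \<Rightarrow> bool" where
  "feasible \<Lambda> F H Kp \<Psi> n P = (\<lambda>(Q, \<Gamma>, S).
     (\<forall>t<n. pos_semidef (block_matrix (Q t) (\<Gamma> t) (transpose (\<Gamma> t)) (S t))) \<and>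
     1 / real n * (\<Sum>t<n. trace (Q t)) \<le> P \<and>
     (\<forall>t<n. let \<Psi>Y = output_cov \<Lambda> H \<Psi> (Q, \<Gamma>, S) t; KY = output_gain \<Lambda> F H Kp \<Psi> (Q, \<Gamma>, S) t in
        pos_semidef (block_matrix
          (F ** S t ** transpose F + Kp t ** \<Psi> t ** transpose (Kp t) - S (Suc t)) (KY ** \<Psi>Y)
          (\<Psi>Y ** transpose KY) \<Psi>Y)) \<and>
     pos_semidef (S n) \<and> S 0 = 0)"

definition objective ::
  "real^'m^'p \<Rightarrow> real^'d^'p \<Rightarrow> (nat \<Rightarrow> real^'p^'p) \<Rightarrow> nat \<Rightarrow> ('m, 'd) decision \<Rightarrow> real" where
  "objective \<Lambda> H \<Psi> n u =
     1 / (2 * real n) * (\<Sum>t<n. ln (det (output_cov \<Lambda> H \<Psi> u t)) - ln (det (\<Psi> t)))"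

definition mix :: "real \<Rightarrow> ('m::finite, 'd::finite) decision \<Rightarrow> ('m, 'd) decision \<Rightarrow> ('m, 'd) decision" where
  "mix \<theta> = (\<lambda>(Q, \<Gamma>, S) (Q', \<Gamma>', S').
     (\<lambda>t. (1 - \<theta>) *\<^sub>R Q t + \<theta> *\<^sub>R Q' t,
      \<lambda>t. (1 - \<theta>) *\<^sub>R \<Gamma> t + \<theta> *\<^sub>R \<Gamma>' t,
      \<lambda>t. (1 - \<theta>) *\<^sub>R S t + \<theta> *\<^sub>R S' t))"

text \<open>Maximization of a concave function over a convex set. The library's \<open>convex\<close> and
  \<open>concave_on\<close> do not apply because function types are not instances of \<open>real_vector\<close>.\<close>

definition convex_maximization ::
  "(('m::finite, 'd::finite) decision \<Rightarrow> real) \<Rightarrow> (('m, 'd) decision \<Rightarrow> bool) \<Rightarrow> bool" where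
  "convex_maximization f C \<longleftrightarrow>
     (\<forall>u v \<theta>. C u \<and> C v \<and> 0 \<le> \<theta> \<and> \<theta> \<le> 1 \<longrightarrow>
        C (mix \<theta> u v) \<and> (1 - \<theta>) * f u + \<theta> * f v \<le> f (mix \<theta> u v))"

end

(* A linear filter driven by the outputs turns any feedback policy into a feasible decision. Let
   shat_t be the Kalman prediction of the noise state from the past noise and psi_t the innovation.
   For a policy with inputs x_t, run the linear recursion e_{t+1} = F e_t + Kp psi_t - KY_t eta_t for
   the error e_t of an output-driven estimate of shat_t, where eta_t = Lambda x_t + H e_t + psi_t is
   the output innovation. Since psi_t is fresh, it is uncorrelated with x_t and e_t, so
   Q = E x x^T, Gamma = E x e^T, S = E e e^T (second moments, without centring) give
   E eta eta^T = Psi_Y, and with KY_t chosen to make e_{t+1} orthogonal to eta_t the last linear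
   matrix inequality holds. Gibbs' inequality against the sequential Gaussian density of the eta_t
   bounds h(y^n) by the sum of (1/2) log det (2 pi e Psi_Y), while h(z^n) equals the same expression
   with Psi because the psi_t are independent Gaussians. Concavity of the objective is the tangent
   bound for log det, and a maximizer exists because the relevant entries of a feasible decision
   are bounded. *)

theory Submission
  imports Defs
begin

section \<open>Symmetric and positive definite matrices\<close>

text \<open>A policy is an arbitrary family of kernels, so neither densities nor Gaussianity of the
  inputs may be assumed, and the upper bound must get by with second moments. The one regularity at
  hand is that every innovation has a bounded density, whatever the policy does with the past. The
  primitive noises may have singular covariances. Independence of the innovations is therefore read
  off a joint characteristic function, which calls for a uniqueness theorem for finite sequences of
  vectors. Feedback makes the inputs depend on past noise. That past noise is almost surely
  recoverable from the history, as output minus \<Lambda> times input, so the noise predictor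
  becomes a function of the history and the next innovation stays independent of history and current
  input together. The gain contains the inverse of a matrix that depends on the decision, which
  hides the convexity. The inverse cancels in the product of gain and output covariance; tested on
  vectors, both matrix inequalities become families of scalar inequalities affine in the decision.
  Convexity, closedness and feasibility of the policy's decision are all checked in this
  form.\<close>

lemma inner_matrix_vector_adjoint:
  fixes A :: "real^'n^'m"
  shows "x \<bullet> (A *v y) = (transpose A *v x) \<bullet> y"
  by (metis dot_lmul_matrix transpose_matrix_vector)

lemma matrix_inv_left_right:
  fixes A :: "real^'n^'n"
  assumes "invertible A"
  shows "A ** matrix_inv A = mat 1" "matrix_inv A ** A = mat 1"
  using someI_ex[OF assms[unfolded invertible_def]] by (simp_all add: matrix_inv_def)

text \<open>A maximizer of the quadratic form on the unit sphere of \<open>T\<close> is an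
  eigenvector: its residual \<open>u\<close> lies in \<open>T\<close> by invariance, and a small
  move along a nonzero \<open>u\<close> would increase the Rayleigh quotient. The statement is
  relative to a subspace so that it can be applied to orthogonal complements.\<close>

lemma symmetric_eigenvector:
  fixes A :: "real^'n^'n"
  assumes sym: "transpose A = A" and sub: "subspace T" and inv: "\<And>y. y \<in> T \<Longrightarrow> A *v y \<in> T"
    and nz: "T \<noteq> {0}"
  obtains x c where "x \<in> T" "norm x = 1" "A *v x = c *\<^sub>R x"
proof -
  have adj: "x \<bullet> (A *v y) = (A *v x) \<bullet> y" for x y
    using inner_matrix_vector_adjoint[of x A y] sym by simp
  obtain y where y: "y \<in> T" "y \<noteq> 0" using sub nz subspace_0 by fastforce
  have "compact (T \<inter> sphere 0 1)"
    by (simp add: closed_Int_compact closed_subspace sub)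
  moreover have "(1 / norm y) *\<^sub>R y \<in> T \<inter> sphere 0 1"
    using y sub by (simp add: subspace_scale)
  moreover have "continuous_on (T \<inter> sphere 0 1) (\<lambda>x. x \<bullet> (A *v x))"
    by (intro continuous_intros)
  ultimately obtain x where x: "x \<in> T" "norm x = 1"
    and max: "\<And>z. z \<in> T \<inter> sphere 0 1 \<Longrightarrow> z \<bullet> (A *v z) \<le> x \<bullet> (A *v x)"
    using continuous_attains_sup[of "T \<inter> sphere 0 1" "\<lambda>x. x \<bullet> (A *v x)"]
    by (metis IntE empty_iff mem_sphere_0)
  define c where "c = x \<bullet> (A *v x)"
  have le: "z \<bullet> (A *v z) \<le> c * (z \<bullet> z)" if "z \<in> T" for z
  proof (cases "z = 0")
    case False
    have "(1 / norm z) *\<^sub>R z \<in> T \<inter> sphere 0 1"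
      using that sub False by (simp add: subspace_scale)
    from max[OF this] have "(z \<bullet> (A *v z)) / (norm z * norm z) \<le> c"
      by (simp add: c_def matrix_vector_mult_scaleR field_simps)
    then show ?thesis using False
      by (simp add: divide_le_eq flip: power2_norm_eq_inner power2_eq_square)
  qed simp
  define u where "u = A *v x - c *\<^sub>R x"
  have u: "u \<in> T" unfolding u_def using inv x sub by (simp add: subspace_diff subspace_scale)
  define K where "K = c * (u \<bullet> u) - u \<bullet> (A *v u)"
  have K: "0 \<le> K" using le[OF u] by (simp add: K_def)
  \<comment> \<open>The Rayleigh bound at \<open>x + t *\<^sub>R u\<close>: the gain is linear in
    \<open>t\<close>, the loss only quadratic.\<close>
  have key: "2 * t * (u \<bullet> u) \<le> t\<^sup>2 * K" for t
  proof -
    have "x + t *\<^sub>R u \<in> T" using x u sub by (simp add: subspace_add subspace_scale)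
    from le[OF this] have "c + 2 * t * (u \<bullet> (A *v x)) + t\<^sup>2 * (u \<bullet> (A *v u))
        \<le> c * (1 + 2 * t * (u \<bullet> x) + t\<^sup>2 * (u \<bullet> u))"
      using x(2) adj[of x u]
      by (simp add: c_def inner_left_distrib inner_right_distrib matrix_vector_mult_scaleR
          matrix_vector_right_distrib norm_eq_1 inner_commute power2_eq_square algebra_simps)
    moreover have "u \<bullet> u = u \<bullet> (A *v x) - c * (u \<bullet> x)"
      by (subst (2) u_def) (simp add: inner_diff_right)
    then have "2 * t * (u \<bullet> u) = 2 * t * (u \<bullet> (A *v x)) - 2 * t * (c * (u \<bullet> x))"
      by (simp only: right_diff_distrib)
    ultimately show ?thesis by (simp add: K_def algebra_simps)
  qed
  have "u \<bullet> u = 0"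
  proof (rule ccontr)
    assume "u \<bullet> u \<noteq> 0"
    define a where "a = u \<bullet> u"
    have a: "a > 0" using \<open>u \<bullet> u \<noteq> 0\<close> by (simp add: a_def)
    \<comment> \<open>With this choice \<open>t * K < a\<close>, while \<open>key\<close> demands
      \<open>2 * a \<le> t * K\<close>. Adding one keeps the denominator positive when
      \<open>K = 0\<close>.\<close>
    define t where "t = a / (K + 1)"
    have t: "t > 0" "t * (K + 1) = a" using a K by (simp_all add: t_def)
    have "t * (2 * a) \<le> t * (t * K)" using key[of t] by (simp add: a_def power2_eq_square mult.commute mult.left_commute)
    then have "2 * a \<le> t * K" using t by simp
    also have "t * K < a" using t by (simp add: distrib_left flip: t(2))
    finally show False using a by simp
  qed
  then have "A *v x = c *\<^sub>R x" by (simp add: u_def)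
  with x show ?thesis using that by blast
qed

text \<open>Symmetry makes the orthogonal complement of eigenvectors invariant, and it is nonzero as
  long as fewer vectors than the dimension have been found; it supplies the next
  eigenvector.\<close>

lemma symmetric_orthonormal_eigenvectors:
  fixes A :: "real^'n^'n"
  assumes sym: "transpose A = A" and "k \<le> CARD('n)"
  shows "\<exists>S. finite S \<and> card S = k \<and> pairwise orthogonal S \<and> (\<forall>x\<in>S. norm x = 1 \<and> (\<exists>c. A *v x = c *\<^sub>R x))"
  using assms(2)
proof (induction k)
  case 0
  then show ?case by (intro exI[of _ "{}"]) auto
next
  case (Suc k)
  then obtain S where S: "finite S" "card S = k" "pairwise orthogonal S"
    "\<forall>x\<in>S. norm x = 1 \<and> (\<exists>c. A *v x = c *\<^sub>R x)" by auto
  define T where "T = {y. \<forall>x\<in>S. x \<bullet> y = 0}"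
  have T: "subspace T" by (auto simp: T_def subspace_def inner_right_distrib)
  have inv: "A *v y \<in> T" if y: "y \<in> T" for y
    unfolding T_def
  proof clarify
    fix x assume x: "x \<in> S"
    then obtain c where c: "A *v x = c *\<^sub>R x" using S by auto
    have "x \<bullet> (A *v y) = (A *v x) \<bullet> y" using inner_matrix_vector_adjoint[of x A y] sym by simp
    then show "x \<bullet> (A *v y) = 0" using c y x by (simp add: T_def)
  qed
  have "dim (span S) \<le> k" using S(1,2) by (metis dim_le_card dim_span order_refl)
  then have "dim (span S) < DIM(real^'n)" using Suc.prems by simp
  then obtain y where y: "y \<noteq> 0" "\<And>x. x \<in> span S \<Longrightarrow> orthogonal y x"
    using orthogonal_to_subspace_exists by (metis dim_span span_span)
  have "y \<in> T" using y(2) by (auto simp: T_def span_base orthogonal_def inner_commute)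
  with y(1) have "T \<noteq> {0}" by auto
  from symmetric_eigenvector[OF sym T inv this]
  obtain x c where x: "x \<in> T" "norm x = 1" "A *v x = c *\<^sub>R x" by metis
  have "x \<notin> S" using x by (auto simp: T_def)
  then show ?case using S x
    by (intro exI[of _ "insert x S"])
       (auto simp: pairwise_insert T_def orthogonal_def[of x] orthogonal_def[of _ x] inner_commute)
qed

definition diag_mat :: "('n \<Rightarrow> real) \<Rightarrow> real^'n^'n" where
  "diag_mat d = (\<chi> i j. if i = j then d i else 0)"

lemma diag_mat_mult_vec: "diag_mat d *v x = (\<chi> i. d i * x $ i)"
proof -
  have "(\<Sum>j\<in>UNIV. (if i = j then d i else 0) * x $ j) = d i * x $ i" for i
    by (subst sum.cong[OF refl, of _ _ "\<lambda>j. if j = i then d i * x $ i else 0"]) auto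
  then show ?thesis by (simp add: diag_mat_def matrix_vector_mult_def vec_eq_iff)
qed

lemma diag_mat_mult: "diag_mat d ** diag_mat e = diag_mat (\<lambda>i. d i * e i)"
  by (subst matrix_eq) (simp add: diag_mat_mult_vec mult.assoc flip: matrix_vector_mul_assoc)

lemma transpose_diag_mat [simp]: "transpose (diag_mat d) = diag_mat d"
  by (auto simp: transpose_def diag_mat_def vec_eq_iff)

lemma det_diag_mat [simp]: "det (diag_mat d) = prod d UNIV"
  by (simp add: diag_mat_def det_diagonal)

lemma trace_diag_mat [simp]: "trace (diag_mat d) = sum d UNIV"
  by (simp add: diag_mat_def trace_def)

theorem symmetric_diagonalization:
  fixes A :: "real^'n^'n"
  assumes sym: "transpose A = A"
  obtains Q d where "orthogonal_matrix Q" "A = Q ** diag_mat d ** transpose Q"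
proof -
  obtain S where S: "finite S" "card S = CARD('n)" "pairwise orthogonal S"
    "\<forall>x\<in>S. norm x = 1 \<and> (\<exists>c. A *v x = c *\<^sub>R x)"
    using symmetric_orthonormal_eigenvectors[OF sym order_refl] by blast
  obtain f :: "'n \<Rightarrow> real^'n" where f: "bij_betw f UNIV S"
    using S(1,2) finite_same_card_bij[of "UNIV :: 'n set" S] by auto
  have fS: "f j \<in> S" for j using f by (auto simp: bij_betw_def)
  have ev: "\<forall>j. \<exists>c. A *v f j = c *\<^sub>R f j" using S(4) fS by blast
  then obtain d where d: "\<And>j. A *v f j = d j *\<^sub>R f j" by metis
  define Q where "Q = (\<chi> i j. f j $ i)"
  have orth: "f i \<bullet> f j = (if i = j then 1 else 0)" for i j
  proof (cases "i = j")
    case True then show ?thesis using S(4) fS by (simp add: norm_eq_1)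
  next
    case False
    then have "f i \<noteq> f j" using f by (auto simp: bij_betw_def inj_on_def)
    then show ?thesis using S(3) fS False by (auto simp: pairwise_def orthogonal_def)
  qed
  have QQ: "transpose Q ** Q = mat 1"
    using orth by (simp add: Q_def matrix_matrix_mult_def transpose_def mat_def vec_eq_iff inner_vec_def)
  then have oQ: "orthogonal_matrix Q" by (simp add: orthogonal_matrix)
  have "A ** Q = Q ** diag_mat d"
  proof -
    have "(\<Sum>k\<in>UNIV. f k $ i * (if k = j then d k else 0)) = d j * f j $ i" for i j
      by (subst sum.cong[OF refl, of _ _ "\<lambda>k. if k = j then d j * f j $ i else 0"]) auto
    moreover have "(\<Sum>k\<in>UNIV. A $ i $ k * f j $ k) = d j * f j $ i" for i j
      using arg_cong[OF d[of j], of "\<lambda>v. v $ i"] by (simp add: matrix_vector_mult_def)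
    ultimately show ?thesis by (simp add: Q_def matrix_matrix_mult_def diag_mat_def vec_eq_iff)
  qed
  then have "A = Q ** diag_mat d ** transpose Q"
    using oQ by (metis matrix_mul_assoc matrix_mul_rid orthogonal_matrix_def)
  with oQ show ?thesis using that by blast
qed

section \<open>Factorization of positive definite matrices\<close>

lemma inner_congruence:
  fixes A :: "real^'n^'n" and B :: "real^'m^'n" and x :: "real^'m"
  shows "x \<bullet> ((transpose B ** A ** B) *v x) = (B *v x) \<bullet> (A *v (B *v x))"
  using inner_matrix_vector_adjoint[of x "transpose B" "A *v (B *v x)"]
  by (simp add: matrix_vector_mul_assoc matrix_mul_assoc)

lemma transpose_matrix_inv:
  fixes A :: "real^'n^'n"
  assumes "invertible A"
  shows "transpose (matrix_inv A) = matrix_inv (transpose A)"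
proof -
  have "transpose A ** transpose (matrix_inv A) = mat 1" "transpose (matrix_inv A) ** transpose A = mat 1"
    using matrix_inv_left_right[OF assms] by (simp_all flip: matrix_transpose_mul)
  then show ?thesis
    by (metis invertible_def matrix_inv_left_right(1) matrix_mul_assoc matrix_mul_lid matrix_mul_rid)
qed

lemma pos_def_invertible:
  fixes A :: "real^'n^'n"
  assumes "pos_def A" shows "invertible A"
proof -
  have "x = 0" if "A *v x = 0" for x
    using assms that unfolding pos_def_def by (metis inner_zero_right less_irrefl)
  then show ?thesis
    using invertible_left_inverse matrix_left_invertible_ker by blast
qed

lemma pos_def_factor:
  fixes A :: "real^'n^'n"
  assumes "pos_def A"
  obtains Q d where "orthogonal_matrix Q" "A = Q ** diag_mat d ** transpose Q" "\<And>i. d i > 0"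
proof -
  obtain Q d where Q: "orthogonal_matrix Q" "A = Q ** diag_mat d ** transpose Q"
    using symmetric_diagonalization assms unfolding pos_def_def by metis
  \<comment> \<open>The eigenvalue \<open>d i\<close> is the value of the form at the i-th column of
    \<open>Q\<close>, which is nonzero because \<open>transpose Q\<close> maps it back to the axis
    vector.\<close>
  have "d i > 0" for i
  proof -
    have QQ: "transpose Q ** Q = mat 1" using Q(1) orthogonal_matrix by blast
    have "transpose Q *v (Q *v axis i 1) = axis i 1"
      by (simp add: matrix_vector_mul_assoc QQ)
    then have *: "(Q *v axis i 1) \<bullet> (A *v (Q *v axis i 1)) = axis i 1 \<bullet> (diag_mat d *v axis i (1::real))"
      using inner_congruence[of "Q *v axis i 1" "transpose Q" "diag_mat d"]
      by (simp add: Q(2))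
    have "Q *v axis i 1 \<noteq> 0"
      using \<open>transpose Q *v (Q *v axis i 1) = axis i 1\<close> by (metis axis_eq_0_iff matrix_vector_mult_0_right zero_neq_one)
    then have "0 < axis i 1 \<bullet> (diag_mat d *v axis i (1::real))"
      using assms * unfolding pos_def_def by metis
    then show ?thesis by (simp add: diag_mat_mult_vec inner_axis' )
  qed
  with Q show ?thesis using that by blast
qed

lemma pos_def_det_pos: 
  fixes A :: "real^'n^'n"
  assumes "pos_def A" shows "det A > 0"
proof -
  obtain Q d where Q: "orthogonal_matrix Q" "A = Q ** diag_mat d ** transpose Q" "\<And>i. d i > 0"
    using pos_def_factor[OF assms] by metis
  have "det Q * det Q = 1" using det_orthogonal_matrix[OF Q(1)] by auto
  then have "det A = prod d UNIV" by (simp add: Q det_mul mult.commute mult.left_commute)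
  then show ?thesis by (simp add: Q(3) prod_pos)
qed

lemma pos_def_sqrt:
  fixes A :: "real^'n^'n"
  assumes "pos_def A"
  obtains B where "A = B ** transpose B" "invertible B" "\<bar>det B\<bar> = sqrt (det A)"
proof -
  obtain Q d where Q: "orthogonal_matrix Q" "A = Q ** diag_mat d ** transpose Q" "\<And>i. d i > 0"
    using pos_def_factor[OF assms] by metis
  define B where "B = Q ** diag_mat (\<lambda>i. sqrt (d i))"
  have A: "A = B ** transpose B"
    using Q(3)[THEN less_imp_le]
    by (simp add: B_def Q(2) matrix_transpose_mul matrix_mul_assoc)
       (simp add: diag_mat_mult flip: matrix_mul_assoc[of Q])
  have "det A = (det B)\<^sup>2" by (simp add: A det_mul power2_eq_square)
  then have "\<bar>det B\<bar> = sqrt (det A)" by simp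
  moreover have "invertible B"
    using pos_def_det_pos[OF assms] \<open>det A = (det B)\<^sup>2\<close> by (simp add: invertible_det_nz)
  ultimately show ?thesis using that A by blast
qed

text \<open>This is \<open>ln x \<le> x - 1\<close> summed over the eigenvalues, the tangent bound
  for log det at the identity.\<close>

lemma ln_det_le_trace:
  fixes A :: "real^'n^'n"
  assumes "pos_def A" shows "ln (det A) \<le> trace A - real CARD('n)"
proof -
  obtain Q d where Q: "orthogonal_matrix Q" "A = Q ** diag_mat d ** transpose Q" "\<And>i. d i > 0"
    using pos_def_factor[OF assms] by metis
  have "det Q * det Q = 1" using det_orthogonal_matrix[OF Q(1)] by auto
  then have "det A = prod d UNIV" by (simp add: Q det_mul mult.commute mult.left_commute)
  moreover have "trace A = sum d UNIV"
    using Q(1) by (simp add: Q(2) trace_mul_sym[of _ "transpose Q"] matrix_mul_assoc orthogonal_matrix)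
  moreover have "ln (prod d UNIV) = (\<Sum>i\<in>UNIV. ln (d i))"
    using Q(3) by (intro ln_prod) (auto simp: less_imp_neq[THEN not_sym])
  moreover have "(\<Sum>i\<in>UNIV. ln (d i)) \<le> (\<Sum>i\<in>UNIV. d i - 1)"
    using Q(3) by (intro sum_mono ln_le_minus_one)
  ultimately show ?thesis by (simp add: sum_subtractf)
qed

lemma pos_def_congruence:
  fixes A B :: "real^'n^'n"
  assumes "pos_def A" "invertible B"
  shows "pos_def (transpose B ** A ** B)"
  unfolding pos_def_def
proof safe
  show "transpose (transpose B ** A ** B) = transpose B ** A ** B"
    using assms(1) by (simp add: pos_def_def matrix_transpose_mul matrix_mul_assoc)
  fix x :: "real^'n" assume "x \<noteq> 0"
  then have "B *v x \<noteq> 0"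
    using assms(2) by (metis matrix_inv_left_right(2) matrix_vector_mul_assoc matrix_vector_mul_lid matrix_vector_mult_0_right)
  then show "0 < x \<bullet> ((transpose B ** A ** B) *v x)"
    using assms(1) by (simp add: inner_congruence pos_def_def)
qed

text \<open>Whitening by a factor \<open>B\<close> of \<open>C\<close> moves the point of tangency
  to the identity; the trace survives by cyclicity and the determinant by multiplicativity.\<close>

lemma ln_det_tangent:
  fixes A C :: "real^'n^'n"
  assumes A: "pos_def A" and C: "pos_def C"
  shows "ln (det A) \<le> ln (det C) + trace (matrix_inv C ** A) - real CARD('n)"
proof -
  obtain B :: "real^'n^'n" where B: "C = B ** transpose B" "invertible B"
    using pos_def_sqrt[OF C] by metis
  let ?D = "matrix_inv B"
  have D: "?D ** B = mat 1" "B ** ?D = mat 1" using matrix_inv_left_right[OF B(2)] by auto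
  have tD: "transpose ?D ** transpose B = mat 1" "transpose B ** transpose ?D = mat 1"
    using D by (simp_all flip: matrix_transpose_mul)
  have invt: "invertible (transpose ?D)" using tD invertible_def by blast
  define X where "X = ?D ** A ** transpose ?D"
  have X: "pos_def X" using pos_def_congruence[OF A invt] by (simp add: X_def)
  have Cinv: "matrix_inv C = transpose ?D ** ?D"
  proof -
    have "C ** (transpose ?D ** ?D) = B ** (transpose B ** transpose ?D) ** ?D"
      by (simp add: B(1) matrix_mul_assoc)
    then have "C ** (transpose ?D ** ?D) = mat 1" by (simp add: tD D)
    then have "matrix_inv C ** C ** (transpose ?D ** ?D) = matrix_inv C"
      by (metis matrix_mul_assoc matrix_mul_rid)
    then show ?thesis using matrix_inv_left_right(2)[OF pos_def_invertible[OF C]] by simp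
  qed
  have "trace X = trace (matrix_inv C ** A)"
    unfolding X_def Cinv by (subst trace_mul_sym) (simp add: matrix_mul_assoc)
  moreover have "ln (det X) = ln (det A) - ln (det C)"
  proof -
    have "det ?D * det B = 1" using D(1) by (metis det_I det_mul)
    then have "det X * det C = det A" by (simp add: X_def B(1) det_mul field_simps)
    then have "det A = det X * det C" by simp
    then show ?thesis using pos_def_det_pos[OF X] pos_def_det_pos[OF C] by (simp add: ln_mult_pos)
  qed
  ultimately show ?thesis using ln_det_le_trace[OF X] by simp
qed

lemma trace_scaleR: "trace (c *\<^sub>R A) = c * trace (A :: real^'n^'n)"
  by (simp add: trace_def sum_distrib_left)

text \<open>Both tangent bounds are taken at the mixture itself. Their trace terms then average to
  the dimension and cancel against the subtracted constant.\<close>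

lemma ln_det_concave:
  fixes A B :: "real^'n^'n"
  assumes A: "pos_def A" and B: "pos_def B" and C: "pos_def ((1 - \<theta>) *\<^sub>R A + \<theta> *\<^sub>R B)"
    and \<theta>: "0 \<le> \<theta>" "\<theta> \<le> 1"
  shows "(1 - \<theta>) * ln (det A) + \<theta> * ln (det B) \<le> ln (det ((1 - \<theta>) *\<^sub>R A + \<theta> *\<^sub>R B))"
proof -
  let ?C = "(1 - \<theta>) *\<^sub>R A + \<theta> *\<^sub>R B"
  let ?k = "real CARD('n)"
  have "?k = trace (matrix_inv ?C ** ?C)"
    using matrix_inv_left_right(2)[OF pos_def_invertible[OF C]] by (simp add: trace_I)
  also have "\<dots> = (1 - \<theta>) * trace (matrix_inv ?C ** A) + \<theta> * trace (matrix_inv ?C ** B)"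
    by (simp add: matrix_add_ldistrib matrix_scalar_ac trace_add trace_scaleR
        flip: scalar_matrix_assoc)
  finally have tr: "(1 - \<theta>) * trace (matrix_inv ?C ** A) + \<theta> * trace (matrix_inv ?C ** B) = ?k" ..
  have "(1 - \<theta>) * ln (det A) + \<theta> * ln (det B)
      \<le> (1 - \<theta>) * (ln (det ?C) + trace (matrix_inv ?C ** A) - ?k)
       + \<theta> * (ln (det ?C) + trace (matrix_inv ?C ** B) - ?k)"
    using \<theta> ln_det_tangent[OF A C] ln_det_tangent[OF B C]
    by (intro add_mono mult_left_mono) auto
  also have "\<dots> = ln (det ?C)"
    using tr by (simp add: algebra_simps)
  finally show ?thesis .
qed

section \<open>The optimization problem\<close>

definition vec_append :: "real^'a \<Rightarrow> real^'b \<Rightarrow> real^('a + 'b)" where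
  "vec_append x y = (\<chi> i. case i of Inl k \<Rightarrow> x $ k | Inr k \<Rightarrow> y $ k)"

lemma sum_UNIV_Plus:
  fixes f :: "'a::finite + 'b::finite \<Rightarrow> real"
  shows "(\<Sum>i\<in>UNIV. f i) = (\<Sum>k\<in>UNIV. f (Inl k)) + (\<Sum>k\<in>UNIV. f (Inr k))"
  by (subst UNIV_Plus_UNIV[symmetric], subst sum.Plus) simp_all

lemma inner_vec_append: "vec_append x y \<bullet> vec_append x' y' = x \<bullet> x' + y \<bullet> y'"
  by (simp add: vec_append_def inner_vec_def sum_UNIV_Plus)

lemma block_matrix_mult_vec_append:
  "block_matrix A B C D *v vec_append x y = vec_append (A *v x + B *v y) (C *v x + D *v y)"
  by (simp add: vec_append_def block_matrix_def matrix_vector_mult_def vec_eq_iff sum_UNIV_Plus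
      split: sum.split)

lemma vec_append_surj:
  obtains x y where "z = vec_append x y"
proof
  show "z = vec_append (\<chi> k. z $ Inl k) (\<chi> k. z $ Inr k)"
    by (simp add: vec_append_def vec_eq_iff split: sum.split)
qed

lemma transpose_block_matrix:
  "transpose (block_matrix A B C D) = block_matrix (transpose A) (transpose C) (transpose B) (transpose D)"
  by (simp add: block_matrix_def transpose_def vec_eq_iff split: sum.split)

lemma block_matrix_eq_iff:
  "block_matrix A B C D = block_matrix A' B' C' D' \<longleftrightarrow> A = A' \<and> B = B' \<and> C = C' \<and> D = D'"
proof
  assume eq: "block_matrix A B C D = block_matrix A' B' C' D'"
  show "A = A' \<and> B = B' \<and> C = C' \<and> D = D'"
  proof (intro conjI)
    show "A = A'" using arg_cong[OF eq, of "\<lambda>M. M $ Inl _ $ Inl _"] by (simp add: block_matrix_def vec_eq_iff)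
    show "B = B'" using arg_cong[OF eq, of "\<lambda>M. M $ Inl _ $ Inr _"] by (simp add: block_matrix_def vec_eq_iff)
    show "C = C'" using arg_cong[OF eq, of "\<lambda>M. M $ Inr _ $ Inl _"] by (simp add: block_matrix_def vec_eq_iff)
    show "D = D'" using arg_cong[OF eq, of "\<lambda>M. M $ Inr _ $ Inr _"] by (simp add: block_matrix_def vec_eq_iff)
  qed
qed simp

text \<open>Splitting the test vector turns a matrix inequality into a scalar one for all
  \<open>x\<close> and \<open>y\<close>. Working with this form avoids Schur complements
  throughout.\<close>

lemma pos_semidef_block_iff:
  "pos_semidef (block_matrix A B C D) \<longleftrightarrow>
     transpose A = A \<and> transpose D = D \<and> C = transpose B \<and>
     (\<forall>x y. 0 \<le> x \<bullet> (A *v x) + 2 * (x \<bullet> (B *v y)) + y \<bullet> (D *v y))"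
proof -
  have quad: "vec_append x y \<bullet> (block_matrix A B C D *v vec_append x y)
      = x \<bullet> (A *v x) + 2 * (x \<bullet> (B *v y)) + y \<bullet> (D *v y)" if "C = transpose B" for x y
    using inner_matrix_vector_adjoint[of x B y] that
    by (simp add: block_matrix_mult_vec_append inner_vec_append inner_right_distrib inner_commute)
  have *: "(\<forall>z. 0 \<le> z \<bullet> (block_matrix A B C D *v z)) \<longleftrightarrow>
     (\<forall>x y. 0 \<le> vec_append x y \<bullet> (block_matrix A B C D *v vec_append x y))"
    by (metis vec_append_surj)
  show ?thesis
    unfolding pos_semidef_def * transpose_block_matrix block_matrix_eq_iff
    using quad by (metis transpose_transpose)
qed

lemma transpose_add: "transpose (A + B) = transpose A + transpose (B :: real^'n^'m)"
  by (simp add: transpose_def vec_eq_iff)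

lemma transpose_diff: "transpose (A - B) = transpose A - transpose (B :: real^'n^'m)"
  by (simp add: transpose_def vec_eq_iff)

lemma matrix_mult_add_rdistrib: "(A + B) ** C = A ** C + B ** C"
  for A B :: "real^'n^'m" and C :: "real^'k^'n"
  by (simp add: matrix_matrix_mult_def vec_eq_iff distrib_right sum.distrib)

lemma inner_sandwich:
  "x \<bullet> ((A ** B ** C) *v y) = (transpose A *v x) \<bullet> (B *v (C *v y))" for x :: "real^'n" and B :: "real^'k^'m"
  by (metis inner_matrix_vector_adjoint matrix_vector_mul_assoc)

text \<open>The quadratic form of the first block matrix. For a decision made of second moments it
  is the mean square of \<open>a \<bullet> x + g \<bullet> e\<close>, with input \<open>x\<close>
  and estimation error \<open>e\<close>.\<close>

definition joint_form :: "('m::finite, 'd::finite) decision \<Rightarrow> nat \<Rightarrow> real^'m \<Rightarrow> real^'d \<Rightarrow> real" where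
  "joint_form = (\<lambda>(Q, \<Gamma>, S) t a g. a \<bullet> (Q t *v a) + 2 * (a \<bullet> (\<Gamma> t *v g)) + g \<bullet> (S t *v g))"

lemma output_cov_form:
  "y \<bullet> (output_cov \<Lambda> H \<Psi> u t *v y) =
     joint_form u t (transpose \<Lambda> *v y) (transpose H *v y) + y \<bullet> (\<Psi> t *v y)"
proof -
  obtain Q \<Gamma> S where u: "u = (Q, \<Gamma>, S)" by (cases u)
  have "(transpose H *v y) \<bullet> (transpose (\<Gamma> t) *v (transpose \<Lambda> *v y))
      = (transpose \<Lambda> *v y) \<bullet> (\<Gamma> t *v (transpose H *v y))"
    by (metis inner_commute inner_matrix_vector_adjoint)
  then show ?thesis
    by (simp add: u output_cov_def joint_form_def matrix_vector_mult_add_rdistrib inner_right_distrib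
        inner_sandwich)
qed

lemma pos_def_output_cov:
  assumes "transpose (Q t) = Q t" "transpose (S t) = S t" "pos_def (\<Psi> t)"
    and "\<And>a g. 0 \<le> joint_form (Q, \<Gamma>, S) t a g"
  shows "pos_def (output_cov \<Lambda> H \<Psi> (Q, \<Gamma>, S) t)"
  unfolding pos_def_def output_cov_form
proof (intro conjI allI impI)
  show "transpose (output_cov \<Lambda> H \<Psi> (Q, \<Gamma>, S) t) = output_cov \<Lambda> H \<Psi> (Q, \<Gamma>, S) t"
    using assms by (simp add: output_cov_def transpose_add matrix_transpose_mul matrix_mul_assoc pos_def_def)
  show "0 < joint_form (Q, \<Gamma>, S) t (transpose \<Lambda> *v y) (transpose H *v y) + y \<bullet> (\<Psi> t *v y)" if "y \<noteq> 0" for y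
    using assms(3,4) that by (simp add: pos_def_def add_nonneg_pos)
qed

text \<open>The inverse inside the gain cancels, leaving an expression affine in the decision. This
  is the reason why the second matrix inequality is a convex constraint.\<close>

lemma output_gain_mult:
  assumes "pos_def (output_cov \<Lambda> H \<Psi> (Q, \<Gamma>, S) t)"
  shows "output_gain \<Lambda> F H Kp \<Psi> (Q, \<Gamma>, S) t ** output_cov \<Lambda> H \<Psi> (Q, \<Gamma>, S) t
    = F ** transpose (\<Gamma> t) ** transpose \<Lambda> + F ** S t ** transpose H + Kp t ** \<Psi> t"
  using matrix_inv_left_right(2)[OF pos_def_invertible[OF assms]]
  by (simp add: output_gain_def flip: matrix_mul_assoc[of _ "matrix_inv _"])

lemma symmetric_form_add:
  fixes A :: "real^'n^'n"
  assumes "transpose A = A"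
  shows "(x + y) \<bullet> (A *v (x + y)) = x \<bullet> (A *v x) + 2 * (x \<bullet> (A *v y)) + y \<bullet> (A *v y)"
  using inner_matrix_vector_adjoint[of y A x] assms
  by (simp add: matrix_vector_right_distrib inner_left_distrib inner_right_distrib inner_commute)

text \<open>Expanded this way the second block inequality is visibly affine in the decision. It bounds the
  next error form by the mean square of a single combination \<open>a \<bullet> x + g \<bullet> e + k \<bullet> \<psi>\<close>.\<close>

lemma lmi_form:
  assumes "transpose (S t) = S t" "transpose (\<Psi> t) = \<Psi> t"
  shows "x \<bullet> ((F ** S t ** transpose F + Kp t ** \<Psi> t ** transpose (Kp t) - S (Suc t)) *v x)
     + 2 * (x \<bullet> ((F ** transpose (\<Gamma> t) ** transpose \<Lambda> + F ** S t ** transpose H + Kp t ** \<Psi> t) *v y))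
     + y \<bullet> (output_cov \<Lambda> H \<Psi> (Q, \<Gamma>, S) t *v y)
   = joint_form (Q, \<Gamma>, S) t (transpose \<Lambda> *v y) (transpose F *v x + transpose H *v y)
     + (transpose (Kp t) *v x + y) \<bullet> (\<Psi> t *v (transpose (Kp t) *v x + y)) - x \<bullet> (S (Suc t) *v x)"
proof -
  have "(transpose F *v x) \<bullet> (transpose (\<Gamma> t) *v (transpose \<Lambda> *v y))
      = (transpose \<Lambda> *v y) \<bullet> (\<Gamma> t *v (transpose F *v x))"
    by (metis inner_commute inner_matrix_vector_adjoint)
  moreover have "x \<bullet> ((Kp t ** \<Psi> t) *v y) = (transpose (Kp t) *v x) \<bullet> (\<Psi> t *v y)"
    by (metis inner_matrix_vector_adjoint matrix_vector_mul_assoc)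
  ultimately show ?thesis
    unfolding output_cov_form symmetric_form_add[OF assms(2)] joint_form_def
      prod.case symmetric_form_add[OF assms(1)]
    by (simp add: matrix_vector_mult_add_rdistrib matrix_vector_mult_diff_rdistrib
        matrix_vector_right_distrib inner_right_distrib inner_diff_right inner_sandwich)
qed

text \<open>The second matrix inequality is translated only under the first one and the terminal
  condition: cancelling the inverse needs a positive definite output covariance, and symmetry of the
  upper left block needs a symmetric \<open>S (Suc t)\<close>.\<close>

lemma feasible_iff:
  assumes \<Psi>: "\<And>t. pos_def (\<Psi> t)"
  shows "feasible \<Lambda> F H Kp \<Psi> n P (Q, \<Gamma>, S) \<longleftrightarrow>
    (\<forall>t<n. transpose (Q t) = Q t \<and> transpose (S t) = S t \<and> (\<forall>a g. 0 \<le> joint_form (Q, \<Gamma>, S) t a g)) \<and>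
    1 / real n * (\<Sum>t<n. trace (Q t)) \<le> P \<and>
    (\<forall>t<n. \<forall>x y. x \<bullet> (S (Suc t) *v x) \<le> joint_form (Q, \<Gamma>, S) t (transpose \<Lambda> *v y) (transpose F *v x + transpose H *v y)
        + (transpose (Kp t) *v x + y) \<bullet> (\<Psi> t *v (transpose (Kp t) *v x + y))) \<and>
    pos_semidef (S n) \<and> S 0 = 0"
proof -
  let ?u = "(Q, \<Gamma>, S)"
  have \<Psi>sym: "transpose (\<Psi> t) = \<Psi> t" for t using \<Psi> by (simp add: pos_def_def)
  let ?first = "\<forall>t<n. transpose (Q t) = Q t \<and> transpose (S t) = S t \<and> (\<forall>a g. 0 \<le> joint_form ?u t a g)"
  have first: "(\<forall>t<n. pos_semidef (block_matrix (Q t) (\<Gamma> t) (transpose (\<Gamma> t)) (S t))) \<longleftrightarrow> ?first"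
    by (auto simp: pos_semidef_block_iff joint_form_def)
  have second: "(let \<Psi>Y = output_cov \<Lambda> H \<Psi> ?u t; KY = output_gain \<Lambda> F H Kp \<Psi> ?u t in
        pos_semidef (block_matrix
          (F ** S t ** transpose F + Kp t ** \<Psi> t ** transpose (Kp t) - S (Suc t)) (KY ** \<Psi>Y)
          (\<Psi>Y ** transpose KY) \<Psi>Y)) \<longleftrightarrow>
     (\<forall>x y. x \<bullet> (S (Suc t) *v x) \<le> joint_form ?u t (transpose \<Lambda> *v y) (transpose F *v x + transpose H *v y)
        + (transpose (Kp t) *v x + y) \<bullet> (\<Psi> t *v (transpose (Kp t) *v x + y)))"
    if f: ?first and Sn: "pos_semidef (S n)" and t: "t < n" for t
  proof -
    have pd: "pos_def (output_cov \<Lambda> H \<Psi> ?u t)" using f t \<Psi> by (intro pos_def_output_cov) auto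
    \<comment> \<open>For \<open>Suc t < n\<close> the first block inequality at the next time gives
      this; for \<open>Suc t = n\<close> only the terminal condition is available.\<close>
    have "transpose (S (Suc t)) = S (Suc t)"
      using f Sn t by (metis Suc_lessI pos_semidef_def)
    then have sym: "transpose (F ** S t ** transpose F + Kp t ** \<Psi> t ** transpose (Kp t) - S (Suc t))
       = F ** S t ** transpose F + Kp t ** \<Psi> t ** transpose (Kp t) - S (Suc t)"
      using f t \<Psi>sym by (simp add: transpose_add transpose_diff matrix_transpose_mul matrix_mul_assoc)
    have St: "transpose (S t) = S t" using f t by auto
    let ?Y = "output_cov \<Lambda> H \<Psi> ?u t" and ?K = "output_gain \<Lambda> F H Kp \<Psi> ?u t"
    have tC: "?Y ** transpose ?K = transpose (?K ** ?Y)"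
      using pd by (simp add: matrix_transpose_mul pos_def_def)
    have "transpose ?Y = ?Y" using pd by (simp add: pos_def_def)
    moreover have "0 \<le> x \<bullet> ((F ** S t ** transpose F + Kp t ** \<Psi> t ** transpose (Kp t) - S (Suc t)) *v x)
       + 2 * (x \<bullet> ((F ** transpose (\<Gamma> t) ** transpose \<Lambda> + F ** S t ** transpose H + Kp t ** \<Psi> t) *v y))
       + y \<bullet> (?Y *v y) \<longleftrightarrow>
      x \<bullet> (S (Suc t) *v x) \<le> joint_form ?u t (transpose \<Lambda> *v y) (transpose F *v x + transpose H *v y)
        + (transpose (Kp t) *v x + y) \<bullet> (\<Psi> t *v (transpose (Kp t) *v x + y))" for x y
      by (subst lmi_form[of S t \<Psi>, OF St \<Psi>sym]) (simp only: diff_ge_0_iff_ge)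
    ultimately show ?thesis
      unfolding Let_def tC pos_semidef_block_iff output_gain_mult[OF pd]
      by (simp only: sym simp_thms)
  qed
  show ?thesis unfolding feasible_def prod.case first using second by blast
qed

section \<open>Convexity of the optimization problem\<close>

lemma joint_form_mix:
  "joint_form (mix \<theta> u v) t a g = (1 - \<theta>) * joint_form u t a g + \<theta> * joint_form v t a g"
  by (cases u; cases v)
     (simp add: mix_def joint_form_def matrix_vector_mult_add_rdistrib inner_right_distrib
        algebra_simps flip: scaleR_matrix_vector_assoc)

lemma output_cov_mix:
  "output_cov \<Lambda> H \<Psi> (mix \<theta> u v) t = (1 - \<theta>) *\<^sub>R output_cov \<Lambda> H \<Psi> u t + \<theta> *\<^sub>R output_cov \<Lambda> H \<Psi> v t"
proof -
  have tr: "transpose ((1 - \<theta>) *\<^sub>R A + \<theta> *\<^sub>R B) = (1 - \<theta>) *\<^sub>R transpose A + \<theta> *\<^sub>R transpose B"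
    for A B :: "real^'x^'y" by (simp add: transpose_def vec_eq_iff)
  have "\<Psi> t = (1 - \<theta>) *\<^sub>R \<Psi> t + \<theta> *\<^sub>R \<Psi> t" by (simp flip: scaleR_left_distrib)
  then show ?thesis
    by (cases u; cases v)
       (simp add: mix_def output_cov_def tr matrix_add_ldistrib matrix_mult_add_rdistrib matrix_scalar_ac
          scaleR_right_distrib flip: scalar_matrix_assoc)
qed

text \<open>Every condition in \<open>feasible_iff\<close> is affine in the decision once the test
  vectors are fixed; the terms in \<open>\<Psi>\<close> do not depend on the decision and are
  reproduced because the weights add to one.\<close>

lemma feasible_mix:
  assumes \<Psi>: "\<And>t. pos_def (\<Psi> t)"
    and u: "feasible \<Lambda> F H Kp \<Psi> n P u" and v: "feasible \<Lambda> F H Kp \<Psi> n P v"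
    and \<theta>: "0 \<le> \<theta>" "\<theta> \<le> 1"
  shows "feasible \<Lambda> F H Kp \<Psi> n P (mix \<theta> u v)"
proof -
  obtain Q \<Gamma> S where us: "u = (Q, \<Gamma>, S)" by (cases u)
  obtain Q' \<Gamma>' S' where vs: "v = (Q', \<Gamma>', S')" by (cases v)
  note U = u[unfolded us feasible_iff[where \<Psi>=\<Psi>, OF \<Psi>]] and V = v[unfolded vs feasible_iff[where \<Psi>=\<Psi>, OF \<Psi>]]
  have jm: "joint_form (\<lambda>t. (1 - \<theta>) *\<^sub>R Q t + \<theta> *\<^sub>R Q' t, \<lambda>t. (1 - \<theta>) *\<^sub>R \<Gamma> t + \<theta> *\<^sub>R \<Gamma>' t,
      \<lambda>t. (1 - \<theta>) *\<^sub>R S t + \<theta> *\<^sub>R S' t) t a g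
      = (1 - \<theta>) * joint_form (Q, \<Gamma>, S) t a g + \<theta> * joint_form (Q', \<Gamma>', S') t a g" for t a g
    using joint_form_mix[of \<theta> "(Q, \<Gamma>, S)" "(Q', \<Gamma>', S')"] by (simp add: mix_def)
  have comb: "(1 - \<theta>) * a + \<theta> * b \<le> (1 - \<theta>) * a' + \<theta> * b'" if "a \<le> a'" "b \<le> b'" for a b a' b'
    using that \<theta> by (intro add_mono mult_left_mono) auto
  have tr: "transpose ((1 - \<theta>) *\<^sub>R A + \<theta> *\<^sub>R B) = (1 - \<theta>) *\<^sub>R transpose A + \<theta> *\<^sub>R transpose B"
    for A B :: "real^'x^'y" by (simp add: transpose_def vec_eq_iff)
  have quad: "x \<bullet> (((1 - \<theta>) *\<^sub>R A + \<theta> *\<^sub>R B) *v x) = (1 - \<theta>) * (x \<bullet> (A *v x)) + \<theta> * (x \<bullet> (B *v x))"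
    for A B :: "real^'x^'x" and x
    by (simp add: matrix_vector_mult_add_rdistrib inner_right_distrib flip: scaleR_matrix_vector_assoc)
  show ?thesis
    unfolding us vs mix_def prod.case feasible_iff[where \<Psi>=\<Psi>, OF \<Psi>] jm quad
  proof (intro conjI allI impI)
    show "1 / real n * (\<Sum>t<n. trace ((1 - \<theta>) *\<^sub>R Q t + \<theta> *\<^sub>R Q' t)) \<le> P"
    proof -
      have "1 / real n * (\<Sum>t<n. trace ((1 - \<theta>) *\<^sub>R Q t + \<theta> *\<^sub>R Q' t))
        = (1 - \<theta>) * (1 / real n * (\<Sum>t<n. trace (Q t))) + \<theta> * (1 / real n * (\<Sum>t<n. trace (Q' t)))"
        by (simp only: trace_add trace_scaleR sum.distrib flip: sum_distrib_left)
             (simp add: algebra_simps add_divide_distrib diff_divide_distrib)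
      also have "\<dots> \<le> (1 - \<theta>) * P + \<theta> * P" using U V by (intro comb) blast+
      finally show ?thesis by (simp add: algebra_simps)
    qed
    show "(1 - \<theta>) * (x \<bullet> (S (Suc t) *v x)) + \<theta> * (x \<bullet> (S' (Suc t) *v x))
      \<le> (1 - \<theta>) * joint_form (Q, \<Gamma>, S) t (transpose \<Lambda> *v y) (transpose F *v x + transpose H *v y) +
          \<theta> * joint_form (Q', \<Gamma>', S') t (transpose \<Lambda> *v y) (transpose F *v x + transpose H *v y) +
          (transpose (Kp t) *v x + y) \<bullet> (\<Psi> t *v (transpose (Kp t) *v x + y))" if "t < n" for t x y
    proof -
      from U have 1: "x \<bullet> (S (Suc t) *v x) \<le> joint_form (Q, \<Gamma>, S) t (transpose \<Lambda> *v y) (transpose F *v x + transpose H *v y) +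
          (transpose (Kp t) *v x + y) \<bullet> (\<Psi> t *v (transpose (Kp t) *v x + y))" using that by blast
      from V have 2: "x \<bullet> (S' (Suc t) *v x) \<le> joint_form (Q', \<Gamma>', S') t (transpose \<Lambda> *v y) (transpose F *v x + transpose H *v y) +
          (transpose (Kp t) *v x + y) \<bullet> (\<Psi> t *v (transpose (Kp t) *v x + y))" using that by blast
      show ?thesis using comb[OF 1 2] by (simp add: algebra_simps)
    qed
    show "pos_semidef ((1 - \<theta>) *\<^sub>R S n + \<theta> *\<^sub>R S' n)"
      using U V \<theta> by (simp add: pos_semidef_def tr quad)
  qed (use U V \<theta> in \<open>simp_all add: tr\<close>)
qed

lemma feasible_output_cov:
  assumes "\<And>t. pos_def (\<Psi> t)" "feasible \<Lambda> F H Kp \<Psi> n P u" "t < n"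
  shows "pos_def (output_cov \<Lambda> H \<Psi> u t)"
  using assms by (cases u) (auto simp: feasible_iff intro!: pos_def_output_cov)

lemma convex_maximization_objective:
  fixes \<Lambda> :: "real^'m^'p" and H :: "real^'d^'p"
  assumes \<Psi>: "\<And>t. pos_def (\<Psi> t)"
  shows "convex_maximization (objective \<Lambda> H \<Psi> n) (feasible \<Lambda> F H Kp \<Psi> n P)"
  unfolding convex_maximization_def
proof (intro allI impI conjI)
  fix u v :: "('m, 'd) decision" and \<theta> :: real
  assume A: "feasible \<Lambda> F H Kp \<Psi> n P u \<and> feasible \<Lambda> F H Kp \<Psi> n P v \<and> 0 \<le> \<theta> \<and> \<theta> \<le> 1"
  then show C: "feasible \<Lambda> F H Kp \<Psi> n P (mix \<theta> u v)" using feasible_mix[where \<Psi>=\<Psi>, OF \<Psi>] by blast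
  let ?Y = "\<lambda>u t. output_cov \<Lambda> H \<Psi> u t"
  have "(1 - \<theta>) * ln (det (?Y u t)) + \<theta> * ln (det (?Y v t)) \<le> ln (det (?Y (mix \<theta> u v) t))" if "t < n" for t
  proof -
    have fu: "feasible \<Lambda> F H Kp \<Psi> n P u" and fv: "feasible \<Lambda> F H Kp \<Psi> n P v" using A by blast+
    note pd = feasible_output_cov[where \<Psi>=\<Psi>, OF \<Psi> _ that]
    show ?thesis using ln_det_concave[OF pd[OF fu] pd[OF fv], of \<theta>] pd[OF C] A
      by (simp add: output_cov_mix)
  qed
  then have "(\<Sum>t<n. (1 - \<theta>) * ln (det (?Y u t)) + \<theta> * ln (det (?Y v t)))
     \<le> (\<Sum>t<n. ln (det (?Y (mix \<theta> u v) t)))" by (intro sum_mono) auto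
  then have "1 / (2 * real n) * ((1 - \<theta>) * (\<Sum>t<n. ln (det (?Y u t))) + \<theta> * (\<Sum>t<n. ln (det (?Y v t))))
     \<le> 1 / (2 * real n) * (\<Sum>t<n. ln (det (?Y (mix \<theta> u v) t)))"
    by (intro mult_left_mono) (simp_all add: sum.distrib sum_distrib_left)
  then show "(1 - \<theta>) * objective \<Lambda> H \<Psi> n u + \<theta> * objective \<Lambda> H \<Psi> n v \<le> objective \<Lambda> H \<Psi> n (mix \<theta> u v)"
    by (simp add: objective_def sum_subtractf algebra_simps add_divide_distrib diff_divide_distrib)
qed

section \<open>Uniform bounds on feasible decisions\<close>

lemma inner_axis_matrix_axis: "axis i 1 \<bullet> (A *v axis j 1) = (A :: real^'n^'m) $ i $ j"
  by (simp add: matrix_vector_mult_basis column_def inner_axis')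

lemma norm_matrix_le:
  assumes "\<And>i j. \<bar>(A :: real^'n^'m) $ i $ j\<bar> \<le> B"
  shows "norm A \<le> norm (\<chi> i j. B :: real^'n^'m)"
proof (rule norm_le_componentwise_cart)
  fix i
  have "norm (A $ i) \<le> norm (\<chi> j. B :: real^'n)"
    using assms by (intro norm_le_componentwise_cart) (simp add: order_trans[OF _ abs_ge_self])
  then show "norm (A $ i) \<le> norm ((\<chi> i j. B :: real^'n^'m) $ i)" by simp
qed

text \<open>Testing on the sum and on the difference of two axis vectors bounds the off-diagonal
  entry from both sides.\<close>

lemma pos_semidef_entry_le:
  assumes "transpose A = (A :: real^'n^'n)" "\<And>x. 0 \<le> x \<bullet> (A *v x)"
  shows "\<bar>A $ i $ j\<bar> \<le> (A $ i $ i + A $ j $ j) / 2"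
  using assms(2)[of "axis i 1 + axis j 1"] assms(2)[of "axis i 1 + (- axis j 1)"]
  unfolding symmetric_form_add[OF assms(1)]
  by (simp add: inner_axis_matrix_axis linear_neg[OF matrix_vector_mul_linear])

lemma quadratic_form_le:
  assumes "\<And>i j. \<bar>(A :: real^'n^'n) $ i $ j\<bar> \<le> B"
  shows "x \<bullet> (A *v x) \<le> B * (\<Sum>i\<in>UNIV. \<bar>x $ i\<bar>)\<^sup>2"
proof -
  have "x \<bullet> (A *v x) = (\<Sum>i\<in>UNIV. \<Sum>j\<in>UNIV. x $ i * (A $ i $ j * x $ j))"
    by (simp add: inner_vec_def matrix_vector_mult_def sum_distrib_left)
  also have "\<dots> \<le> (\<Sum>i\<in>UNIV. \<Sum>j\<in>UNIV. \<bar>x $ i\<bar> * (B * \<bar>x $ j\<bar>))"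
  proof (intro sum_mono)
    fix i j
    have "x $ i * (A $ i $ j * x $ j) \<le> \<bar>x $ i\<bar> * (\<bar>A $ i $ j\<bar> * \<bar>x $ j\<bar>)"
      by (metis abs_ge_self abs_mult)
    also have "\<dots> \<le> \<bar>x $ i\<bar> * (B * \<bar>x $ j\<bar>)"
      using assms by (intro mult_left_mono mult_right_mono) auto
    finally show "x $ i * (A $ i $ j * x $ j) \<le> \<bar>x $ i\<bar> * (B * \<bar>x $ j\<bar>)" .
  qed
  also have "\<dots> = B * (\<Sum>i\<in>UNIV. \<bar>x $ i\<bar>)\<^sup>2"
    by (simp add: power2_eq_square sum_product sum_distrib_left mult_ac)
  finally show ?thesis .
qed

text \<open>The power constraint bounds the traces of \<open>Q\<close>, hence its entries. The
  second inequality with \<open>y = 0\<close> bounds the form of \<open>S (Suc t)\<close> by that of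
  \<open>F ** S t ** transpose F\<close> plus a constant matrix, and the recursion starts at zero.
  Finally \<open>\<Gamma>\<close> is controlled by the two diagonals, through the joint form at axis
  vectors of both signs.\<close>

lemma feasible_entries_bounded:
  fixes \<Lambda> :: "real^'m^'p" and H :: "real^'d^'p" and F :: "real^'d^'d"
  assumes \<Psi>: "\<And>t. pos_def (\<Psi> t)"
  obtains b where "\<And>Q \<Gamma> S t i j. feasible \<Lambda> F H Kp \<Psi> n P (Q, \<Gamma>, S) \<Longrightarrow> t \<le> n \<Longrightarrow> \<bar>S t $ i $ j\<bar> \<le> b t"
    "\<And>Q \<Gamma> S t i j. feasible \<Lambda> F H Kp \<Psi> n P (Q, \<Gamma>, S) \<Longrightarrow> t < n \<Longrightarrow> \<bar>Q t $ i $ j\<bar> \<le> real n * P"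
    "\<And>Q \<Gamma> S t i j. feasible \<Lambda> F H Kp \<Psi> n P (Q, \<Gamma>, S) \<Longrightarrow> t < n \<Longrightarrow> \<bar>\<Gamma> t $ i $ j\<bar> \<le> (real n * P + b t) / 2"
proof -
  define e :: "'d \<Rightarrow> real^'d" where "e = (\<lambda>i. axis i 1)"
  define cst where "cst t i = (transpose (Kp t) *v e i) \<bullet> (\<Psi> t *v (transpose (Kp t) *v e i))" for t i
  \<comment> \<open>\<open>transpose F *v e i\<close> is the i-th row of \<open>F\<close>; the
    square of the sum of its absolute entries is the factor in \<open>quadratic_form_le\<close>. The
    recursion for \<open>b\<close> sums over all rows, so that one number bounds every diagonal
    entry.\<close>
  define l where "l i = (\<Sum>k\<in>UNIV. \<bar>(transpose F *v e i) $ k\<bar>)\<^sup>2" for i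
  define b where "b = rec_nat 0 (\<lambda>t c. \<Sum>i\<in>UNIV. c * l i + \<bar>cst t i\<bar>)"
  have b0: "b 0 = 0" and bS: "b (Suc t) = (\<Sum>i\<in>UNIV. b t * l i + \<bar>cst t i\<bar>)" for t by (simp_all add: b_def)
  have l0: "0 \<le> l i" for i by (simp add: l_def)
  have bnn: "0 \<le> b t" for t by (induction t) (auto simp: b0 bS l0 intro!: sum_nonneg add_nonneg_nonneg)
  have main: "\<bar>S t $ i $ j\<bar> \<le> b t" if f: "feasible \<Lambda> F H Kp \<Psi> n P (Q, \<Gamma>, S)" and "t \<le> n" for Q \<Gamma> S t i j
    using that(2)
  proof (induction t arbitrary: i j)
    case 0 then show ?case using f by (simp add: feasible_iff[where \<Psi>=\<Psi>, OF \<Psi>] b0)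
  next
    case (Suc t)
    note f' = f[unfolded feasible_iff[where \<Psi>=\<Psi>, OF \<Psi>]]
    have sym: "transpose (S (Suc t)) = S (Suc t)" using f' Suc.prems by (metis Suc_lessI Suc_le_lessD le_eq_less_or_eq pos_semidef_def)
    \<comment> \<open>At times before \<open>n\<close> this is the first block inequality with zero
      input part; at time \<open>n\<close> it is the terminal condition.\<close>
    have psd: "0 \<le> x \<bullet> (S (Suc t) *v x)" for x
    proof (cases "Suc t = n")
      case True then show ?thesis using f' by (auto simp: pos_semidef_def)
    next
      case False
      then have "0 \<le> joint_form (Q, \<Gamma>, S) (Suc t) 0 x" using f' Suc.prems by simp
      then show ?thesis by (simp add: joint_form_def)
    qed
    have diag: "S (Suc t) $ i $ i \<le> b (Suc t)" for i
    proof -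
      \<comment> \<open>Choosing \<open>y = 0\<close> in the second inequality removes
        \<open>Q\<close> and \<open>\<Gamma>\<close> from the bound.\<close>
      have "t < n" using Suc.prems by simp
      then have "e i \<bullet> (S (Suc t) *v e i) \<le> joint_form (Q, \<Gamma>, S) t (transpose \<Lambda> *v 0) (transpose F *v e i + transpose H *v 0)
          + (transpose (Kp t) *v e i + 0) \<bullet> (\<Psi> t *v (transpose (Kp t) *v e i + 0))" using f' by blast
      then have "S (Suc t) $ i $ i \<le> (transpose F *v e i) \<bullet> (S t *v (transpose F *v e i)) + cst t i"
        unfolding cst_def joint_form_def matrix_vector_mult_0_right add_0_right
        by (simp add: e_def inner_axis_matrix_axis)
      also have "\<dots> \<le> b t * l i + \<bar>cst t i\<bar>"
        unfolding l_def using Suc by (intro add_mono quadratic_form_le) auto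
      also have "\<dots> \<le> b (Suc t)"
        unfolding bS using bnn l0 by (intro member_le_sum) (auto intro!: add_nonneg_nonneg)
      finally show ?thesis .
    qed
    have "(S (Suc t) $ i $ i + S (Suc t) $ j $ j) / 2 \<le> b (Suc t)"
      using add_mono[OF diag[of i] diag[of j]] by simp
    with pos_semidef_entry_le[OF sym psd, of i j] show ?case by (rule order_trans)
  qed
  have Qb: "\<bar>Q t $ i $ j\<bar> \<le> real n * P" if f: "feasible \<Lambda> F H Kp \<Psi> n P (Q, \<Gamma>, S)" and t: "t < n" for Q \<Gamma> S t i j
  proof -
    note f' = f[unfolded feasible_iff[where \<Psi>=\<Psi>, OF \<Psi>]]
    have psd: "0 \<le> x \<bullet> (Q t *v x)" if "t < n" for x t
    proof -
      have "0 \<le> joint_form (Q, \<Gamma>, S) t x 0" using f' that by simp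
      then show ?thesis by (simp add: joint_form_def)
    qed
    have dnn: "0 \<le> Q t $ i $ i" if "t < n" for t i
      using psd[OF that, of "axis i 1"] by (simp add: inner_axis_matrix_axis)
    have "Q t $ i $ i \<le> trace (Q t)" for i
      unfolding trace_def using dnn[OF t] by (intro member_le_sum) auto
    moreover have "trace (Q t) \<le> (\<Sum>t<n. trace (Q t))"
      using dnn t by (intro member_le_sum) (auto simp: trace_def intro!: sum_nonneg)
    moreover have "(\<Sum>t<n. trace (Q t)) \<le> real n * P"
      using f' t by (simp add: field_simps)
    ultimately have "Q t $ i $ i \<le> real n * P" for i by (meson order_trans)
    from this[of i] this[of j] show ?thesis
      using pos_semidef_entry_le[of "Q t" i j] f' t psd[OF t] by auto
  qed
  have "\<bar>\<Gamma> t $ i $ j\<bar> \<le> (real n * P + b t) / 2"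
    if f: "feasible \<Lambda> F H Kp \<Psi> n P (Q, \<Gamma>, S)" and t: "t < n" for Q \<Gamma> S t i j
  proof -
    note f' = f[unfolded feasible_iff[where \<Psi>=\<Psi>, OF \<Psi>]]
    have "0 \<le> joint_form (Q, \<Gamma>, S) t (axis i 1) (axis j 1)" "0 \<le> joint_form (Q, \<Gamma>, S) t (- axis i 1) (axis j 1)"
      using f' t by blast+
    then have "\<bar>\<Gamma> t $ i $ j\<bar> \<le> (Q t $ i $ i + S t $ j $ j) / 2"
      by (simp add: joint_form_def inner_axis_matrix_axis linear_neg[OF matrix_vector_mul_linear])
    then show ?thesis using main[OF f, of t j j] Qb[OF f t, of i i] t by auto
  qed
  with main Qb that show ?thesis by blast
qed

section \<open>Compactness and existence of a maximizer\<close>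

lemma continuous_on_det:
  "continuous_on A (\<lambda>u. det (f u :: real^'n^'n))" if "continuous_on A f"
  unfolding det_def using that by (intro continuous_intros)

lemma continuous_on_matrix_mult:
  fixes f :: "'x::topological_space \<Rightarrow> real^'n^'m" and g :: "'x \<Rightarrow> real^'k^'n"
  assumes "continuous_on A f" "continuous_on A g"
  shows "continuous_on A (\<lambda>u. f u ** g u)"
  unfolding matrix_matrix_mult_def using assms by (intro continuous_intros)

lemma continuous_on_transpose:
  fixes f :: "'x::topological_space \<Rightarrow> real^'n^'m"
  assumes "continuous_on A f"
  shows "continuous_on A (\<lambda>u. transpose (f u))"
  unfolding transpose_def using assms by (intro continuous_intros)

lemma continuous_on_matrix_vector_mult:
  fixes f :: "'x::topological_space \<Rightarrow> real^'n^'m"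
  assumes "continuous_on A f"
  shows "continuous_on A (\<lambda>u. f u *v x)"
  unfolding matrix_vector_mult_def using assms by (intro continuous_intros)

lemma continuous_on_decision_components:
  "continuous_on A (\<lambda>u :: ('m::finite, 'd::finite) decision. fst u t)"
  "continuous_on A (\<lambda>u :: ('m::finite, 'd::finite) decision. fst (snd u) t)"
  "continuous_on A (\<lambda>u :: ('m::finite, 'd::finite) decision. snd (snd u) t)"
proof -
  have *: "continuous_on A (\<lambda>u. f u t)" if "continuous_on A f"
    for f :: "('m, 'd) decision \<Rightarrow> nat \<Rightarrow> 'z::topological_space"
    by (rule continuous_on_compose2[OF continuous_on_product_coordinates[of t] that]) simp
  show "continuous_on A (\<lambda>u :: ('m, 'd) decision. fst u t)"
    by (rule *[OF continuous_on_fst[OF continuous_on_id]])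
  show "continuous_on A (\<lambda>u :: ('m, 'd) decision. fst (snd u) t)"
    by (rule *[OF continuous_on_fst[OF continuous_on_snd[OF continuous_on_id]]])
  show "continuous_on A (\<lambda>u :: ('m, 'd) decision. snd (snd u) t)"
    by (rule *[OF continuous_on_snd[OF continuous_on_snd[OF continuous_on_id]]])
qed

text \<open>Tychonoff's theorem: the set is a product of closed balls, and the function type carries
  the product topology.\<close>

lemma compact_sequences:
  fixes r :: "nat \<Rightarrow> real"
  shows "compact {f :: nat \<Rightarrow> 'a::euclidean_space. \<forall>t. norm (f t) \<le> r t}"
proof -
  have "{f :: nat \<Rightarrow> 'a. \<forall>t. norm (f t) \<le> r t} = (\<Pi>\<^sub>E t\<in>UNIV. cball 0 (r t))" by (auto simp: PiE_UNIV_domain)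
  moreover have "compactin (product_topology (\<lambda>_. euclidean) UNIV) (\<Pi>\<^sub>E t\<in>UNIV. cball (0::'a) (r t))"
    by (simp add: compactin_PiE)
  ultimately show ?thesis by (simp add: euclidean_product_topology)
qed

lemma continuous_on_output_cov: "continuous_on A (\<lambda>u. output_cov \<Lambda> H \<Psi> u t)"
  unfolding output_cov_def case_prod_unfold
  by (intro continuous_intros continuous_on_matrix_mult continuous_on_transpose continuous_on_decision_components)

lemma continuous_on_joint_form: "continuous_on A (\<lambda>u. joint_form u t a g)"
  unfolding joint_form_def case_prod_unfold
  by (intro continuous_intros continuous_on_matrix_vector_mult continuous_on_decision_components)

text \<open>By \<open>feasible_iff\<close> the feasible set is an intersection, over times and test
  vectors, of closed conditions on finitely many entries, each continuous in the product topology.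
  No inverse occurs any more.\<close>

lemma closed_feasible:
  fixes \<Lambda> :: "real^'m^'p" and H :: "real^'d^'p"
  assumes \<Psi>: "\<And>t. pos_def (\<Psi> t)"
  shows "closed {u. feasible \<Lambda> F H Kp \<Psi> n P u}"
proof -
  have ball: "closed {u. \<forall>t<n. R t u}" if "\<And>t. closed {u. R t u}" for R :: "nat \<Rightarrow> ('m, 'd) decision \<Rightarrow> bool"
  proof -
    have "{u. \<forall>t<n. R t u} = (\<Inter>t\<in>{..<n}. {u. R t u})" by auto
    then show ?thesis using that by auto
  qed
  have eq: "feasible \<Lambda> F H Kp \<Psi> n P u \<longleftrightarrow>
    (\<forall>t<n. transpose (fst u t) = fst u t \<and> transpose (snd (snd u) t) = snd (snd u) t \<and> (\<forall>a g. 0 \<le> joint_form u t a g)) \<and>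
    1 / real n * (\<Sum>t<n. trace (fst u t)) \<le> P \<and>
    (\<forall>t<n. \<forall>x y. x \<bullet> (snd (snd u) (Suc t) *v x) \<le> joint_form u t (transpose \<Lambda> *v y) (transpose F *v x + transpose H *v y)
        + (transpose (Kp t) *v x + y) \<bullet> (\<Psi> t *v (transpose (Kp t) *v x + y))) \<and>
    (transpose (snd (snd u) n) = snd (snd u) n \<and> (\<forall>x. 0 \<le> x \<bullet> (snd (snd u) n *v x))) \<and> snd (snd u) 0 = 0" for u
    using feasible_iff[where \<Psi>=\<Psi>, OF \<Psi>] by (cases u) (simp add: pos_semidef_def)
  show ?thesis
    unfolding eq trace_def
    by (intro closed_Collect_conj ball closed_Collect_all closed_Collect_eq closed_Collect_le continuous_intros
        continuous_on_transpose continuous_on_decision_components continuous_on_joint_form continuous_on_matrix_vector_mult)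
qed

lemma feasible_zero:
  assumes \<Psi>: "\<And>t. pos_def (\<Psi> t)" and "0 \<le> P"
  shows "feasible \<Lambda> F H Kp \<Psi> n P (\<lambda>_. 0, \<lambda>_. 0, \<lambda>_. 0)"
proof -
  have "0 \<le> x \<bullet> (\<Psi> t *v x)" for t x using \<Psi>[of t] by (cases "x = 0") (auto simp: pos_def_def less_imp_le)
  then show ?thesis unfolding feasible_iff[where \<Psi>=\<Psi>, OF \<Psi>]
    using assms(2) by (simp add: joint_form_def pos_semidef_def transpose_def vec_eq_iff trace_def)
qed

theorem objective_has_maximizer:
  fixes \<Lambda> :: "real^'m^'p" and H :: "real^'d^'p"
  assumes \<Psi>: "\<And>t. pos_def (\<Psi> t)" and P: "0 \<le> P"
  shows "\<exists>u. is_arg_max (objective \<Lambda> H \<Psi> n) (feasible \<Lambda> F H Kp \<Psi> n P) u"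
proof -
  let ?f = "objective \<Lambda> H \<Psi> n" and ?C = "feasible \<Lambda> F H Kp \<Psi> n P"
  obtain b where bS: "\<And>Q \<Gamma> S t i j. ?C (Q, \<Gamma>, S) \<Longrightarrow> t \<le> n \<Longrightarrow> \<bar>S t $ i $ j\<bar> \<le> b t"
    and bQ: "\<And>Q \<Gamma> S t i j. ?C (Q, \<Gamma>, S) \<Longrightarrow> t < n \<Longrightarrow> \<bar>Q t $ i $ j\<bar> \<le> real n * P"
    and bG: "\<And>Q \<Gamma> S t i j. ?C (Q, \<Gamma>, S) \<Longrightarrow> t < n \<Longrightarrow> \<bar>\<Gamma> t $ i $ j\<bar> \<le> (real n * P + b t) / 2"
    using feasible_entries_bounded[where \<Psi>=\<Psi>, OF \<Psi>] by metis
  \<comment> \<open>The radii are norms of constant matrices, so that the entrywise bounds yield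
    membership in \<open>box\<close> through \<open>norm_matrix_le\<close>.\<close>
  define rQ where "rQ t = norm (\<chi> i j. real n * P :: real^'m^'m)" for t :: nat
  define rG where "rG t = norm (\<chi> i j. (real n * P + b t) / 2 :: real^'d^'m)" for t
  define rS where "rS t = norm (\<chi> i j. b t :: real^'d^'d)" for t
  define box :: "('m, 'd) decision set" where
    "box = {f. \<forall>t. norm (f t) \<le> rQ t} \<times> {f. \<forall>t. norm (f t) \<le> rG t} \<times> {f. \<forall>t. norm (f t) \<le> rS t}"
  have cpt: "compact (box \<inter> {u. ?C u})"
    unfolding box_def
    by (intro compact_Int_closed compact_Times compact_sequences closed_feasible[where \<Psi>=\<Psi>, OF \<Psi>])
  have "(\<lambda>_. 0, \<lambda>_. 0, \<lambda>_. 0) \<in> box \<inter> {u. ?C u}"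
    using feasible_zero[where \<Psi>=\<Psi>, OF \<Psi> P] by (simp add: box_def rQ_def rG_def rS_def)
  then have ne: "box \<inter> {u. ?C u} \<noteq> {}" by blast
  \<comment> \<open>Needed for continuity of the logarithm; it holds on the feasible set only, which
    is why continuity is claimed there and not on all of \<open>box\<close>.\<close>
  have pos: "0 < det (output_cov \<Lambda> H \<Psi> u t)" if "?C u" "t < n" for u t
    by (rule pos_def_det_pos[OF feasible_output_cov[where \<Psi>=\<Psi>, OF \<Psi> that]])
  have "continuous_on (box \<inter> {u. ?C u}) ?f"
    unfolding objective_def
    by (intro continuous_intros continuous_on_det continuous_on_output_cov ballI) (use pos in force)
  then obtain u where u: "u \<in> box" "?C u" and max: "\<And>v. v \<in> box \<Longrightarrow> ?C v \<Longrightarrow> ?f v \<le> ?f u"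
    using continuous_attains_sup[OF cpt ne] by (metis (mono_tags, lifting) IntE IntI mem_Collect_eq)
  have "?f v \<le> ?f u" if v: "?C v" for v
  proof -
    obtain Q \<Gamma> S where vs: "v = (Q, \<Gamma>, S)" by (cases v)
    \<comment> \<open>entries at irrelevant times are unconstrained, so they are cut off before using compactness\<close>
    define v' where "v' = (\<lambda>t. if t < n then Q t else 0, \<lambda>t. if t < n then \<Gamma> t else 0, \<lambda>t. if t \<le> n then S t else 0)"
    have C': "?C v'"
      using v unfolding vs v'_def feasible_iff[where \<Psi>=\<Psi>, OF \<Psi>] by (simp add: joint_form_def Suc_le_eq)
    have "v' \<in> box"
      unfolding v'_def box_def
      using bS[OF v[unfolded vs]] bQ[OF v[unfolded vs]] bG[OF v[unfolded vs]]
      by (auto simp: rQ_def rG_def rS_def intro!: norm_matrix_le)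
    moreover have "?f v' = ?f v" unfolding vs v'_def objective_def by (simp add: output_cov_def)
    ultimately show ?thesis using max C' by metis
  qed
  then show ?thesis using u by (intro exI[of _ u]) (auto simp: is_arg_max_def not_less)
qed

section \<open>Uniqueness of characteristic functions\<close>

text \<open>Levy's theorem concerns probability measures. The hypothesis at frequency zero makes the
  total masses equal, so both measures are rescaled by this mass; mass zero is treated
  apart.\<close>

lemma finite_measure_eqI_iexp_real:
  fixes M N :: "real measure"
  assumes "finite_measure M" "finite_measure N" and sets[simp]: "sets M = sets borel" "sets N = sets borel"
    and eq: "\<And>t. (CLINT x|M. iexp (t * x)) = (CLINT x|N. iexp (t * x))"
  shows "M = N"
proof -
  interpret M: finite_measure M by fact
  interpret N: finite_measure N by fact
  have sp: "space M = UNIV" "space N = UNIV" using sets_eq_imp_space_eq[OF sets(1)] sets_eq_imp_space_eq[OF sets(2)] by auto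
  have mb: "f \<in> borel_measurable borel \<Longrightarrow> f \<in> borel_measurable M"
    "f \<in> borel_measurable borel \<Longrightarrow> f \<in> borel_measurable N" for f :: "real \<Rightarrow> 'z::topological_space"
    by (simp_all cong: measurable_cong_sets)
  define c where "c = measure M UNIV"
  have c: "measure N UNIV = c" using eq[of 0] by (simp add: c_def sp)
  show ?thesis
  proof (cases "c = 0")
    case True
    have "emeasure M A = 0" "emeasure N A = 0" for A
      using M.bounded_measure[of A] N.bounded_measure[of A] True c
      by (simp_all add: c_def sp M.emeasure_eq_measure N.emeasure_eq_measure measure_le_0_iff)
    then show ?thesis by (intro measure_eqI) simp_all
  next
    case False
    then have c0: "c > 0" by (simp add: c_def zero_less_measure_iff)
    define sc where "sc L = density L (\<lambda>_. ennreal (1 / c))" for L :: "real measure"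
    have rd: "real_distribution (sc L)" if "finite_measure L" "sets L = sets borel" "measure L UNIV = c" for L
    proof -
      have "space L = UNIV" using sets_eq_imp_space_eq[OF that(2)] by simp
      moreover have "emeasure L UNIV = ennreal c"
        using finite_measure.emeasure_eq_measure[OF that(1)] that(3) by simp
      ultimately have "emeasure (sc L) (space (sc L)) = 1"
        using c0 that(2) by (simp add: sc_def emeasure_density_const ennreal_mult[symmetric])
      then show ?thesis
        by (intro real_distribution.intro prob_spaceI real_distribution_axioms.intro) (auto simp: sc_def that)
    qed
    have chr: "char (sc L) t = (1 / c) *\<^sub>R (CLINT x|L. iexp (t * x))" if "sets L = sets borel" for L t
    proof -
      have "(\<lambda>x. iexp (t * x)) \<in> borel_measurable L" by (simp cong: measurable_cong_sets add: that)
      then show ?thesis using c0 unfolding char_def sc_def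
        by (subst integral_density) simp_all
    qed
    have "sc M = sc N"
    proof (rule Levy_uniqueness)
      show "real_distribution (sc M)" "real_distribution (sc N)"
        using rd assms c by (simp_all add: c_def)
      show "char (sc M) = char (sc N)"
        using chr[OF sets(1)] chr[OF sets(2)] eq by (simp add: fun_eq_iff)
    qed
    then have "density (sc M) (\<lambda>_. ennreal c) = density (sc N) (\<lambda>_. ennreal c)" by simp
    moreover have "density (sc L) (\<lambda>_. ennreal c) = L" for L
      using c0 by (simp add: sc_def density_density_eq ennreal_mult[symmetric] density_1)
    ultimately show ?thesis by simp
  qed
qed

lemma complex_integral_eq_cos_sin:
  assumes [measurable]: "w \<in> borel_measurable M" "S \<in> borel_measurable M"
    and "integrable M (\<lambda>x. w x :: real)"
  shows "(CLINT x|M. w x *\<^sub>R iexp (S x)) = complex_of_real (LINT x|M. w x * cos (S x)) + \<i> * complex_of_real (LINT x|M. w x * sin (S x))"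
proof -
  have 1: "integrable M (\<lambda>x. w x * cos (S x))" "integrable M (\<lambda>x. w x * sin (S x))"
    by (rule Bochner_Integration.integrable_bound[OF assms(3)]; simp add: abs_mult mult_left_le abs_cos_le_one abs_sin_le_one)+
  have "w x *\<^sub>R iexp (S x) = complex_of_real (w x * cos (S x)) + \<i> * complex_of_real (w x * sin (S x))" for x
    by (simp add: complex_eq_iff Re_exp Im_exp)
  then show ?thesis using 1 by (simp add: integral_add del: of_real_mult)
qed

text \<open>Coordinates are replaced one at a time: the exponential in the remaining coordinates is
  turned into the nonnegative weight \<open>1 + cos (\<dots> + \<theta>)\<close>, so that one-variable uniqueness
  applies to an honest finite measure.\<close>

lemma PiM_measure_eqI_iexp:
  fixes M N :: "('i \<Rightarrow> 'a::euclidean_space) measure"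
  assumes uniq: "\<And>K L :: 'a measure. finite_measure K \<Longrightarrow> finite_measure L \<Longrightarrow>
       sets K = sets borel \<Longrightarrow> sets L = sets borel \<Longrightarrow>
       (\<And>t. (CLINT x|K. iexp (t \<bullet> x)) = (CLINT x|L. iexp (t \<bullet> x))) \<Longrightarrow> K = L"
    and fin: "finite I" "finite_measure M" "finite_measure N"
    and sets: "sets M = sets (\<Pi>\<^sub>M i\<in>I. borel)" "sets N = sets (\<Pi>\<^sub>M i\<in>I. borel)"
    and eq: "\<And>t. (CLINT x|M. iexp (\<Sum>i\<in>I. t i \<bullet> x i)) = (CLINT x|N. iexp (\<Sum>i\<in>I. t i \<bullet> x i))"
  shows "M = N"
proof -
  define W where "W F A x = (\<Prod>i\<in>F. indicator (A i) (x i) :: real)" for F :: "'i set" and A and x :: "'i \<Rightarrow> 'a"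
  define S where "S t x = (\<Sum>i\<in>I. t i \<bullet> x i)" for t and x :: "'i \<Rightarrow> 'a"
  have comp: "(\<lambda>x. x i) \<in> borel_measurable P" if "i \<in> I" "sets P = sets (\<Pi>\<^sub>M i\<in>I. borel)" for i and P :: "('i \<Rightarrow> 'a) measure"
    using that by (simp cong: measurable_cong_sets add: measurable_component_singleton)
  have Wm: "W F A \<in> borel_measurable P" if "F \<subseteq> I" "\<forall>i\<in>F. A i \<in> sets borel" "sets P = sets (\<Pi>\<^sub>M i\<in>I. borel)" for F A P
    unfolding W_def using that
    by (intro borel_measurable_prod measurable_compose[OF comp borel_measurable_indicator]) auto
  have Sm: "S t \<in> borel_measurable P" if "sets P = sets (\<Pi>\<^sub>M i\<in>I. borel)" for t P
    unfolding S_def using that by (intro borel_measurable_sum borel_measurable_inner comp) auto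
  have W01: "0 \<le> W F A x" "W F A x \<le> 1" for F A x
    unfolding W_def by (auto intro!: prod_nonneg prod_le_1 simp: indicator_def)
  \<comment> \<open>Invariant of the replacement: the coordinates in \<open>F\<close> already carry
    indicators, the others still carry the exponential, and the frequencies on \<open>F\<close>
    vanish.\<close>
  have main: "(CLINT x|M. W F A x *\<^sub>R iexp (S t x)) = (CLINT x|N. W F A x *\<^sub>R iexp (S t x))"
    if "F \<subseteq> I" "\<forall>i\<in>F. A i \<in> sets borel" "\<forall>i\<in>F. t i = 0" for F A t
    using finite_subset[OF that(1) fin(1)] that
  proof (induction F arbitrary: A t rule: finite_induct)
    case empty
    then show ?case using eq[of t] by (simp add: W_def S_def)
  next
    case (insert j F)
    then have j: "j \<in> I" "A j \<in> sets borel" "t j = 0" and F: "F \<subseteq> I" "\<forall>i\<in>F. A i \<in> sets borel" "\<forall>i\<in>F. t i = 0"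
      by auto
    define h where "h \<theta> x = W F A x * (1 + cos (S t x + \<theta>))" for \<theta> x
    have h0: "0 \<le> h \<theta> x" "h \<theta> x \<le> 2" for \<theta> x
    proof -
      have "- 1 \<le> cos (S t x + \<theta>)" "cos (S t x + \<theta>) \<le> 1" by auto
      then show "0 \<le> h \<theta> x" unfolding h_def using W01(1)[of F A x]
        by (intro mult_nonneg_nonneg) linarith+
      have "W F A x * (1 + cos (S t x + \<theta>)) \<le> 1 * 2"
        using W01[of F A x] \<open>- 1 \<le> cos (S t x + \<theta>)\<close> \<open>cos (S t x + \<theta>) \<le> 1\<close> by (intro mult_mono) linarith+
      then show "h \<theta> x \<le> 2" by (simp add: h_def)
    qed
    define D where "D \<theta> P = distr (density P (\<lambda>x. ennreal (h \<theta> x))) borel (\<lambda>x. x j)" for \<theta> and P :: "('i \<Rightarrow> 'a) measure"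
    { fix P :: "('i \<Rightarrow> 'a) measure" assume P: "finite_measure P" "sets P = sets (\<Pi>\<^sub>M i\<in>I. borel)"
      interpret P: finite_measure P by fact
      note [measurable] = Wm[OF F(1,2) P(2)] Sm[OF P(2)] comp[OF j(1) P(2)]
      have hm[measurable]: "h \<theta> \<in> borel_measurable P" for \<theta> unfolding h_def by measurable
      have hint: "integrable P (h \<theta>)" for \<theta>
        by (rule P.integrable_const_bound[where B=2]) (use h0 in auto)
      have cm: "(\<lambda>x. x j) \<in> borel_measurable (density P f)" for f
        using comp[OF j(1), of "density P f"] P(2) by simp
      have Wint: "integrable P (W F A)"
        by (rule P.integrable_const_bound[where B=1]) (use W01 in auto)
      have fin: "finite_measure (D \<theta> P)" for \<theta>
      proof -
        have "emeasure (density P (\<lambda>x. ennreal (h \<theta> x))) (space P) < \<infinity>"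
          using hint[of \<theta>] h0 by (simp add: emeasure_density nn_integral_eq_integral less_top[symmetric] cong: nn_integral_cong)
        then have "finite_measure (density P (\<lambda>x. ennreal (h \<theta> x)))"
          by (intro finite_measureI) (simp add: less_top)
        then show ?thesis unfolding D_def by (rule finite_measure.finite_measure_distr) simp
      qed
      \<comment> \<open>Euler's formula splits the weight
        \<open>1 + cos (\<dots> + \<theta>)\<close> into three exponentials, with frequencies
        \<open>0\<close>, \<open>t\<close> and \<open>- t\<close> off coordinate \<open>j\<close>.
        All of them vanish on \<open>F\<close>, so the induction hypothesis covers each
        term.\<close>
      have chr: "(CLINT x|D \<theta> P. iexp (\<tau> \<bullet> x)) =
          (CLINT x|P. W F A x *\<^sub>R iexp (S ((\<lambda>_. 0)(j := \<tau>)) x))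
          + (iexp \<theta> / 2) * (CLINT x|P. W F A x *\<^sub>R iexp (S (t(j := \<tau>)) x))
          + (iexp (- \<theta>) / 2) * (CLINT x|P. W F A x *\<^sub>R iexp (S ((\<lambda>i. - t i)(j := \<tau>)) x))" for \<theta> \<tau>
      proof -
        have rem: "S (u(j := \<tau>)) x = \<tau> \<bullet> x j + (\<Sum>i\<in>I - {j}. u i \<bullet> x i)" for u x
          unfolding S_def sum.remove[OF assms(2) j(1)] by (auto intro!: sum.cong)
        have St: "S t x = (\<Sum>i\<in>I - {j}. t i \<bullet> x i)" for x
          unfolding S_def sum.remove[OF assms(2) j(1)] using j(3) by simp
        have 1: "S ((\<lambda>_. 0)(j := \<tau>)) x = \<tau> \<bullet> x j" for x
          by (simp add: rem)
        have 2: "S (t(j := \<tau>)) x = S t x + \<tau> \<bullet> x j" for x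
          by (simp add: rem St)
        have 3: "S ((\<lambda>i. - t i)(j := \<tau>)) x = - S t x + \<tau> \<bullet> x j" for x
          by (simp add: rem St sum_negf)
        have i: "integrable P (\<lambda>x. W F A x *\<^sub>R iexp (S t' x))" for t'
          using Sm[OF P(2), of t']
          by (intro Bochner_Integration.integrable_bound[OF Wint]) auto
        have e: "h \<theta> x *\<^sub>R iexp (\<tau> \<bullet> x j) = W F A x *\<^sub>R iexp (S ((\<lambda>_. 0)(j := \<tau>)) x)
          + (iexp \<theta> / 2) * (W F A x *\<^sub>R iexp (S (t(j := \<tau>)) x))
          + (iexp (- \<theta>) / 2) * (W F A x *\<^sub>R iexp (S ((\<lambda>i. - t i)(j := \<tau>)) x))" for x
        proof -
          have add: "iexp (a + b) = iexp a * iexp b" for a b by (simp add: distrib_left exp_add)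
          have "complex_of_real (cos (S t x + \<theta>)) = (iexp (S t x + \<theta>) + iexp (- S t x + - \<theta>)) / 2"
            by (simp add: cos_exp_eq algebra_simps flip: cos_of_real)
          then have cos: "complex_of_real (1 + cos (S t x + \<theta>))
              = 1 + (iexp (S t x) * iexp \<theta> + iexp (- S t x) * iexp (- \<theta>)) / 2"
            by (simp only: of_real_add[of 1] of_real_1 add)
          have aux: "w * (1 + (p * q + p' * q') / 2) * E = w * E + q / 2 * (w * (p * E)) + q' / 2 * (w * (p' * E))"
            for p q p' q' E w :: complex by (simp add: field_simps)
          show ?thesis
            unfolding 1 2 3 h_def scaleR_conv_of_real of_real_mult cos add[of "S t x"] add[of "- S t x"] by (rule aux)
        qed
        have "(CLINT x|D \<theta> P. iexp (\<tau> \<bullet> x)) = (CLINT x|P. h \<theta> x *\<^sub>R iexp (\<tau> \<bullet> x j))"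
          unfolding D_def using h0 by (subst integral_distr[OF cm], simp, subst integral_density) auto
        also have "\<dots> = (CLINT x|P. W F A x *\<^sub>R iexp (S ((\<lambda>_. 0)(j := \<tau>)) x))
          + (iexp \<theta> / 2) * (CLINT x|P. W F A x *\<^sub>R iexp (S (t(j := \<tau>)) x))
          + (iexp (- \<theta>) / 2) * (CLINT x|P. W F A x *\<^sub>R iexp (S ((\<lambda>i. - t i)(j := \<tau>)) x))"
        proof -
          have "(CLINT x|P. f x + a * g x + b * k x) = (CLINT x|P. f x) + a * (CLINT x|P. g x) + b * (CLINT x|P. k x)"
            if "integrable P f" "integrable P g" "integrable P k" for f g k and a b :: complex
            using that by simp
          from this[OF i i i] show ?thesis unfolding e .
        qed
        finally show ?thesis .
      qed
      have msr: "measure (D \<theta> P) (A j) = (LINT x|P. h \<theta> x * indicator (A j) (x j))" for \<theta>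
      proof -
        interpret D: finite_measure "D \<theta> P" by (rule fin)
        have "measure (D \<theta> P) (A j) = (LINT x|D \<theta> P. indicator (A j) x)" using j(2) by (simp add: D_def)
        also have "\<dots> = (LINT x|P. h \<theta> x *\<^sub>R indicator (A j) (x j))"
          unfolding D_def using h0 j(2) by (subst integral_distr[OF cm], simp, subst integral_density) auto
        finally show ?thesis by simp
      qed
      note fin chr msr
    } note D = this
    have Deq: "D \<theta> M = D \<theta> N" for \<theta>
    proof (rule uniq)
      show "finite_measure (D \<theta> M)" "finite_measure (D \<theta> N)" using D(1) assms by auto
      show "sets (D \<theta> M) = sets borel" "sets (D \<theta> N) = sets borel" by (simp_all add: D_def)
      fix \<tau>
      show "(CLINT x|D \<theta> M. iexp (\<tau> \<bullet> x)) = (CLINT x|D \<theta> N. iexp (\<tau> \<bullet> x))"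
      proof -
        have IH: "(CLINT x|M. W F A x *\<^sub>R iexp (S (u(j := \<tau>)) x)) = (CLINT x|N. W F A x *\<^sub>R iexp (S (u(j := \<tau>)) x))"
          if "\<forall>i\<in>F. u i = 0" for u
          using that insert.hyps by (intro insert.IH F) auto
        have "\<forall>i\<in>F. - t i = 0" using F(3) by simp
        note IHt = IH[OF F(3)] and IHm = IH[OF this]
        have IH0: "(CLINT x|M. W F A x *\<^sub>R iexp (S ((\<lambda>_. 0)(j := \<tau>)) x)) = (CLINT x|N. W F A x *\<^sub>R iexp (S ((\<lambda>_. 0)(j := \<tau>)) x))"
          by (rule IH) simp
        show ?thesis unfolding D(2)[OF assms(3) sets(1)] D(2)[OF assms(4) sets(2)] IHt IHm IH0 ..
      qed
    qed
    have heq: "(LINT x|M. h \<theta> x * indicator (A j) (x j)) = (LINT x|N. h \<theta> x * indicator (A j) (x j))" for \<theta>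
      using D(3)[OF assms(3) sets(1), of \<theta>] D(3)[OF assms(4) sets(2), of \<theta>] Deq[of \<theta>] by simp
    have Wins: "W (insert j F) A x = W F A x * indicator (A j) (x j)" for x
      using insert.hyps by (simp add: W_def)
    { fix P :: "('i \<Rightarrow> 'a) measure" assume P: "finite_measure P" "sets P = sets (\<Pi>\<^sub>M i\<in>I. borel)"
      interpret P: finite_measure P by fact
      have [measurable]: "W (insert j F) A \<in> borel_measurable P" using Wm[OF insert.prems(1,2) P(2)] .
      note [measurable] = Sm[OF P(2)]
      have Wint: "integrable P (W (insert j F) A)"
        by (rule P.integrable_const_bound[where B=1]) (use W01 in auto)
      have i: "integrable P (\<lambda>x. W (insert j F) A x * cos (S t x + \<theta>))" for \<theta>
        by (rule Bochner_Integration.integrable_bound[OF Wint]) (simp_all add: abs_mult mult_left_le)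
      \<comment> \<open>Shifting the phase by \<open>pi\<close> flips the sign of the cosine; the
        difference of the two weights drops the constant one and isolates the cosine.\<close>
      have c: "(LINT x|P. W (insert j F) A x * cos (S t x + \<theta>)) =
          ((LINT x|P. h \<theta> x * indicator (A j) (x j)) - (LINT x|P. h (\<theta> + pi) x * indicator (A j) (x j))) / 2" for \<theta>
      proof -
        have "h \<theta>' x * indicator (A j) (x j) = W (insert j F) A x + W (insert j F) A x * cos (S t x + \<theta>')" for \<theta>' x
          by (simp add: h_def Wins algebra_simps)
        moreover have "cos (S t x + (\<theta> + pi)) = - cos (S t x + \<theta>)" for x
          by (simp add: add.assoc[symmetric])
        ultimately show ?thesis using i[of \<theta>] i[of "\<theta> + pi"] Wint by (simp add: integral_add)
      qed
      \<comment> \<open>Phase \<open>0\<close> gives the real part, and phase \<open>pi / 2\<close>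
        gives minus the imaginary part.\<close>
      have "(CLINT x|P. W (insert j F) A x *\<^sub>R iexp (S t x)) =
         complex_of_real (LINT x|P. W (insert j F) A x * cos (S t x + 0))
         - \<i> * complex_of_real (LINT x|P. W (insert j F) A x * cos (S t x + pi/2))"
        by (subst complex_integral_eq_cos_sin[OF _ _ Wint]) (simp_all add: cos_add)
      note this[unfolded c]
    } note fin_form = this
    show ?case unfolding fin_form[OF assms(3) sets(1)] fin_form[OF assms(4) sets(2)] heq ..
  qed
  show ?thesis
  proof (rule measure_eqI_PiM_finite[OF fin(1) sets])
    fix A :: "'i \<Rightarrow> 'a set" assume A: "\<And>i. i \<in> I \<Longrightarrow> A i \<in> sets borel"
    have sp: "space M = (\<Pi>\<^sub>E i\<in>I. UNIV)" "space N = (\<Pi>\<^sub>E i\<in>I. UNIV)"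
      using sets_eq_imp_space_eq[OF sets(1)] sets_eq_imp_space_eq[OF sets(2)] by (auto simp: space_PiM)
    have rect: "Pi\<^sub>E I A \<in> sets (\<Pi>\<^sub>M i\<in>I. borel)" using A fin by (intro sets_PiM_I_finite) auto
    have W: "W I A x = indicator (Pi\<^sub>E I A) x" if "x \<in> (\<Pi>\<^sub>E i\<in>I. UNIV)" for x
      using that fin by (auto simp: W_def indicator_def PiE_iff prod_zero_iff)
    \<comment> \<open>With every coordinate replaced and all frequencies zero, the integrand of
      \<open>main\<close> is the indicator of a box.\<close>
    have "measure P (Pi\<^sub>E I A) = Re (CLINT x|P. W I A x *\<^sub>R iexp (S (\<lambda>_. 0) x))"
      if "finite_measure P" "sets P = sets (\<Pi>\<^sub>M i\<in>I. borel)" "space P = (\<Pi>\<^sub>E i\<in>I. UNIV)" for P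
    proof -
      interpret finite_measure P by fact
      have "(CLINT x|P. W I A x *\<^sub>R iexp (S (\<lambda>_. 0) x)) = (CLINT x|P. complex_of_real (indicator (Pi\<^sub>E I A) x))"
        using that(3) by (intro Bochner_Integration.integral_cong) (auto simp: W S_def scaleR_conv_of_real)
      also have "\<dots> = complex_of_real (measure P (Pi\<^sub>E I A))"
      proof -
        have "Pi\<^sub>E I A \<inter> (I \<rightarrow>\<^sub>E UNIV) = Pi\<^sub>E I A" by (auto simp: PiE_iff)
        then show ?thesis using rect that by (subst integral_complex_of_real) simp
      qed
      finally show ?thesis by simp
    qed
    from this[OF fin(2) sets(1) sp(1)] this[OF fin(3) sets(2) sp(2)]
    show "emeasure M (Pi\<^sub>E I A) = emeasure N (Pi\<^sub>E I A)"
      using main[of I A "\<lambda>_. 0"] A fin(2,3) by (simp add: finite_measure.emeasure_eq_measure)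
  next
    show "range (\<lambda>_::nat. \<Pi>\<^sub>E i\<in>I. UNIV) \<subseteq> prod_algebra I (\<lambda>_. borel :: 'a measure)"
      using fin(1) by (auto intro!: prod_algebraI_finite)
    show "(\<Union>i::nat. \<Pi>\<^sub>E i\<in>I. UNIV) = space (\<Pi>\<^sub>M i\<in>I. borel :: 'a measure)" by (simp add: space_PiM)
    show "emeasure M (\<Pi>\<^sub>E i\<in>I. UNIV) \<noteq> \<infinity>" using fin(2) by (simp add: finite_measure.emeasure_eq_measure)
  qed
qed

text \<open>Coordinates identify the space with a finite product of real lines, where the preceding
  lemma applies with the one-dimensional uniqueness as its hypothesis \<open>uniq\<close>. The
  result then serves as \<open>uniq\<close> itself, for sequences of vectors.\<close>

theorem finite_measure_eqI_iexp:
  fixes M N :: "'a::euclidean_space measure"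
  assumes fin: "finite_measure M" "finite_measure N" and sets: "sets M = sets borel" "sets N = sets borel"
    and eq: "\<And>t. (CLINT x|M. iexp (t \<bullet> x)) = (CLINT x|N. iexp (t \<bullet> x))"
  shows "M = N"
proof -
  define \<Phi> :: "'a \<Rightarrow> 'a \<Rightarrow> real" where "\<Phi> x = (\<lambda>b\<in>Basis. x \<bullet> b)" for x
  define \<Psi> :: "('a \<Rightarrow> real) \<Rightarrow> 'a" where "\<Psi> f = (\<Sum>b\<in>Basis. f b *\<^sub>R b)" for f
  let ?P = "(\<Pi>\<^sub>M b\<in>Basis. borel) :: ('a \<Rightarrow> real) measure"
  have \<Phi>[measurable]: "\<Phi> \<in> borel \<rightarrow>\<^sub>M ?P" unfolding \<Phi>_def by measurable
  have \<Psi>[measurable]: "\<Psi> \<in> ?P \<rightarrow>\<^sub>M borel" unfolding \<Psi>_def by measurable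
  have \<Psi>\<Phi>: "\<Psi> (\<Phi> x) = x" for x by (simp add: \<Psi>_def \<Phi>_def euclidean_representation)
  have \<Phi>m: "\<Phi> \<in> K \<rightarrow>\<^sub>M ?P" if "sets K = sets borel" for K using that by (simp cong: measurable_cong_sets)
  have inverse: "distr (distr K ?P \<Phi>) borel \<Psi> = K" if "sets K = sets borel" for K
    using that \<Phi>m[OF that] by (subst distr_distr) (auto simp: o_def \<Psi>\<Phi> intro: distr_id2)
  have chr: "(CLINT x|distr K ?P \<Phi>. iexp (\<Sum>b\<in>Basis. t b \<bullet> x b)) = (CLINT x|K. iexp (\<Psi> t \<bullet> x))"
    if "sets K = sets borel" for K t
  proof -
    have "(\<Sum>b\<in>Basis. t b \<bullet> \<Phi> x b) = \<Psi> t \<bullet> x" for x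
      by (simp add: \<Phi>_def \<Psi>_def inner_sum_left) (simp add: inner_commute)
    then show ?thesis using \<Phi>m[OF that] by (subst integral_distr) (auto simp del: of_real_sum)
  qed
  have "distr M ?P \<Phi> = distr N ?P \<Phi>"
  proof (rule PiM_measure_eqI_iexp)
    show "K = L" if "finite_measure K" "finite_measure L" "sets K = sets borel" "sets L = sets borel"
      "\<And>t. (CLINT x|K. iexp (t \<bullet> x)) = (CLINT x|L. iexp (t \<bullet> x))" for K L :: "real measure"
      using finite_measure_eqI_iexp_real[of K L] that by simp
    show "(CLINT f|distr M ?P \<Phi>. iexp (\<Sum>b\<in>Basis. t b \<bullet> f b)) = (CLINT f|distr N ?P \<Phi>. iexp (\<Sum>b\<in>Basis. t b \<bullet> f b))" for t
      by (simp only: chr[OF sets(1)] chr[OF sets(2)] eq)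
  qed (simp_all add: sets finite_measure.finite_measure_distr fin \<Phi>m)
  then show ?thesis using inverse[OF sets(1)] inverse[OF sets(2)] by metis
qed

theorem PiM_finite_measure_eqI_iexp:
  fixes M N :: "('i \<Rightarrow> 'a::euclidean_space) measure"
  assumes "finite I" "finite_measure M" "finite_measure N"
    "sets M = sets (\<Pi>\<^sub>M i\<in>I. borel)" "sets N = sets (\<Pi>\<^sub>M i\<in>I. borel)"
    "\<And>t. (CLINT x|M. iexp (\<Sum>i\<in>I. t i \<bullet> x i)) = (CLINT x|N. iexp (\<Sum>i\<in>I. t i \<bullet> x i))"
  shows "M = N"
  by (rule PiM_measure_eqI_iexp[OF finite_measure_eqI_iexp assms])

section \<open>Gaussian densities\<close>

lemma prob_space_normal_law: "0 \<le> \<sigma> \<Longrightarrow> prob_space (normal_law \<mu> \<sigma>)"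
  by (simp add: normal_law_def prob_space_return prob_space_normal_density)

lemma sets_normal_law [simp, measurable_cong]: "sets (normal_law \<mu> \<sigma>) = sets borel"
  by (simp add: normal_law_def)

lemma iexp_integral_normal_density:
  assumes "0 < \<sigma>"
  shows "(CLINT x|density lborel (normal_density 0 \<sigma>). iexp (t * x)) = exp (- (\<sigma>\<^sup>2 * t\<^sup>2) / 2)"
proof -
  let ?N = "density lborel (normal_density 0 \<sigma>)"
  interpret prob_space ?N using prob_space_normal_density[OF assms] .
  have "distributed ?N lborel (\<lambda>x. x) (normal_density 0 \<sigma>)"
    by (simp add: distributed_def distr_id2)
  then have "distributed ?N lborel (\<lambda>x. x / \<sigma>) std_normal_density"
    using normal_standard_normal_convert[OF assms, of "\<lambda>x. x" 0] by simp
  then have std: "distr ?N lborel (\<lambda>x. x / \<sigma>) = std_normal_distribution"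
    by (rule distributed_distr_eq_density)
  have "(CLINT x|?N. iexp (t * x)) = (CLINT x|distr ?N lborel (\<lambda>x. x / \<sigma>). iexp ((\<sigma> * t) * x))"
    using assms by (subst integral_distr) (auto simp: field_simps)
  also have "\<dots> = exp (- ((\<sigma> * t)\<^sup>2) / 2)"
    unfolding std using fun_cong[OF char_std_normal_distribution, of "\<sigma> * t"] by (simp only: char_def)
  finally show ?thesis by (simp add: power_mult_distrib)
qed

lemma iexp_integral_normal_law:
  assumes "0 \<le> \<sigma>"
  shows "(CLINT x|normal_law 0 \<sigma>. iexp (t * x)) = exp (- (\<sigma>\<^sup>2 * t\<^sup>2) / 2)"
proof (cases "\<sigma> = 0")
  case True then show ?thesis by (simp add: normal_law_def integral_return)
next
  case False then show ?thesis using assms iexp_integral_normal_density[of \<sigma> t] by (simp add: normal_law_def)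
qed

lemma normal_law_moments:
  assumes "0 \<le> \<sigma>"
  shows "integrable (normal_law \<mu> \<sigma>) (\<lambda>x. x)" "(LINT x|normal_law \<mu> \<sigma>. x) = \<mu>"
    "integrable (normal_law \<mu> \<sigma>) (\<lambda>x. x\<^sup>2)" "(LINT x|normal_law 0 \<sigma>. x\<^sup>2) = \<sigma>\<^sup>2"
proof -
  have pos: "integrable (normal_law \<mu> \<sigma>) (\<lambda>x. x)" "(LINT x|normal_law \<mu> \<sigma>. x) = \<mu>"
    "integrable (normal_law \<mu> \<sigma>) (\<lambda>x. x\<^sup>2)" "(LINT x|normal_law 0 \<sigma>. x\<^sup>2) = \<sigma>\<^sup>2" if "\<sigma> > 0"
  proof -
    have d: "normal_law \<mu> \<sigma> = density lborel (normal_density \<mu> \<sigma>)" for \<mu> using that by (simp add: normal_law_def)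
    have i1: "integrable lborel (\<lambda>x. normal_density \<mu> \<sigma> x * x)" using integrable_normal_moment_nz_1[OF that] .
    show "integrable (normal_law \<mu> \<sigma>) (\<lambda>x. x)" unfolding d using i1 by (subst integrable_density) auto
    show "(LINT x|normal_law \<mu> \<sigma>. x) = \<mu>" unfolding d using integral_normal_moment_nz_1[OF that, of \<mu>]
      by (subst integral_density) auto
    have i2: "integrable lborel (\<lambda>x. normal_density \<mu> \<sigma> x * (x - \<mu>)\<^sup>2)" for \<mu>
      using integrable_normal_moment[OF that] .
    have "integrable lborel (\<lambda>x. normal_density \<mu> \<sigma> x * (x - \<mu>)\<^sup>2 + 2 * \<mu> * (normal_density \<mu> \<sigma> x * x) - \<mu>\<^sup>2 * normal_density \<mu> \<sigma> x)"
      using i1 i2 integrable_normal_density[OF that, of \<mu>] by (intro Bochner_Integration.integrable_add Bochner_Integration.integrable_diff integrable_mult_right) auto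
    then have "integrable lborel (\<lambda>x. normal_density \<mu> \<sigma> x * x\<^sup>2)"
      by (rule Bochner_Integration.integrable_cong[THEN iffD1, rotated 2]) (auto simp: power2_eq_square algebra_simps)
    then show "integrable (normal_law \<mu> \<sigma>) (\<lambda>x. x\<^sup>2)" unfolding d by (subst integrable_density) auto
    show "(LINT x|normal_law 0 \<sigma>. x\<^sup>2) = \<sigma>\<^sup>2"
      unfolding d using has_bochner_integral_integral_eq[OF normal_moment_even[OF that, of 0 1]]
      by (subst integral_density) (auto simp: fact_numeral)
  qed
  have zero: "integrable (return borel \<mu>) f" if "f \<in> borel_measurable borel" for f :: "real \<Rightarrow> real"
    using that by (simp add: integrable_iff_bounded nn_integral_return)
  consider "\<sigma> > 0" | "\<sigma> = 0" using assms by linarith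
  note cases = this
  show "integrable (normal_law \<mu> \<sigma>) (\<lambda>x. x)" "integrable (normal_law \<mu> \<sigma>) (\<lambda>x. x\<^sup>2)"
    by (rule cases, use pos in blast, simp add: normal_law_def zero)+
  show "(LINT x|normal_law \<mu> \<sigma>. x) = \<mu>" "(LINT x|normal_law 0 \<sigma>. x\<^sup>2) = \<sigma>\<^sup>2"
    by (rule cases, use pos in blast, simp add: normal_law_def integral_return)+
qed

section \<open>Normal laws with independent coordinates\<close>

lemma integral_lborel_prod:
  fixes f :: "'a::euclidean_space \<Rightarrow> real \<Rightarrow> complex"
  assumes "\<And>b. b \<in> Basis \<Longrightarrow> integrable lborel (f b)"
  shows "(CLINT x|lborel. (\<Prod>b\<in>Basis. f b (x \<bullet> b))) = (\<Prod>b\<in>Basis. CLINT x|lborel. f b x)"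
proof -
  interpret product_sigma_finite "\<lambda>_::'a. lborel :: real measure" by standard
  have fm: "f b \<in> borel_measurable borel" if "b \<in> Basis" for b using borel_measurable_integrable[OF assms[OF that]] by simp
  have m1: "(\<lambda>x. \<Sum>b\<in>Basis. x b *\<^sub>R b) \<in> (\<Pi>\<^sub>M b\<in>Basis. lborel) \<rightarrow>\<^sub>M (borel :: 'a measure)"
    by measurable
  have m2: "(\<lambda>x::'a. \<Prod>b\<in>Basis. f b (x \<bullet> b)) \<in> borel_measurable borel"
    by (intro borel_measurable_prod measurable_compose[OF _ fm]) auto
  have "(CLINT x|lborel. (\<Prod>b\<in>Basis. f b (x \<bullet> b)))
      = (CLINT x|(\<Pi>\<^sub>M b\<in>Basis. lborel). (\<Prod>b\<in>Basis. f b ((\<Sum>c\<in>Basis. x c *\<^sub>R c) \<bullet> b)))"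
    by (subst lborel_eq, subst integral_distr[OF m1 m2]) (rule refl)
  also have "\<dots> = (CLINT x|(\<Pi>\<^sub>M b\<in>Basis. lborel). (\<Prod>b\<in>Basis. f b (x b)))" by simp
  also have "\<dots> = (\<Prod>b\<in>Basis. CLINT x|lborel. f b x)" using assms by (intro product_integral_prod) auto
  finally show ?thesis .
qed

definition diag_gauss :: "'a::euclidean_space \<Rightarrow> 'a \<Rightarrow> real" where
  "diag_gauss \<sigma> x = (\<Prod>b\<in>Basis. normal_density 0 (\<sigma> \<bullet> b) (x \<bullet> b))"

lemma diag_gauss_measurable [measurable]: "diag_gauss \<sigma> \<in> borel_measurable borel"
  unfolding diag_gauss_def by measurable

lemma diag_gauss_nonneg: "0 \<le> diag_gauss \<sigma> x"
  unfolding diag_gauss_def by (intro prod_nonneg) auto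

lemma prob_space_diag_gauss:
  assumes "\<And>b. b \<in> Basis \<Longrightarrow> 0 < \<sigma> \<bullet> b"
  shows "prob_space (density lborel (diag_gauss \<sigma>))"
proof
  have one: "(\<integral>\<^sup>+x. ennreal (normal_density 0 s x) \<partial>lborel) = 1" if "0 < s" for s
    using that by (simp add: nn_integral_eq_integral)
  have "(\<integral>\<^sup>+x. ennreal (diag_gauss \<sigma> x) \<partial>lborel) = (\<integral>\<^sup>+x. (\<Prod>b\<in>Basis. ennreal (normal_density 0 (\<sigma> \<bullet> b) (x \<bullet> b))) \<partial>lborel)"
    unfolding diag_gauss_def by (simp add: prod_ennreal)
  also have "\<dots> = (\<Prod>b\<in>Basis. \<integral>\<^sup>+x. ennreal (normal_density 0 (\<sigma> \<bullet> b) x) \<partial>lborel)"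
    by (intro nn_integral_lborel_prod) auto
  also have "\<dots> = 1" using assms one by simp
  finally show "emeasure (density lborel (diag_gauss \<sigma>)) (space (density lborel (diag_gauss \<sigma>))) = 1"
    by (simp add: emeasure_density)
qed

lemma iexp_integral_diag_gauss:
  fixes t :: "'a::euclidean_space"
  assumes "\<And>b. b \<in> Basis \<Longrightarrow> 0 < \<sigma> \<bullet> b"
  shows "(CLINT x|density lborel (diag_gauss \<sigma>). iexp (t \<bullet> x)) = exp (- (\<Sum>b\<in>Basis. (\<sigma> \<bullet> b)\<^sup>2 * (t \<bullet> b)\<^sup>2) / 2)"
proof -
  let ?f = "\<lambda>b x. normal_density 0 (\<sigma> \<bullet> b) x *\<^sub>R iexp ((t \<bullet> b) * x)"
  have int: "integrable lborel (?f b)" if "b \<in> Basis" for b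
    by (rule Bochner_Integration.integrable_bound[OF integrable_normal_density[OF assms[OF that], of 0]]) auto
  have "(CLINT x|density lborel (diag_gauss \<sigma>). iexp (t \<bullet> x)) = (CLINT x|lborel. diag_gauss \<sigma> x *\<^sub>R iexp (t \<bullet> x))"
    by (subst integral_density) (auto simp: diag_gauss_nonneg)
  also have "\<dots> = (CLINT x|lborel. (\<Prod>b\<in>Basis. ?f b (x \<bullet> b)))"
  proof (rule Bochner_Integration.integral_cong[OF refl])
    fix x :: 'a
    have "iexp (t \<bullet> x) = (\<Prod>b\<in>Basis. iexp ((t \<bullet> b) * (x \<bullet> b)))"
      by (subst euclidean_inner) (simp add: exp_sum sum_distrib_left)
    then show "diag_gauss \<sigma> x *\<^sub>R iexp (t \<bullet> x) = (\<Prod>b\<in>Basis. ?f b (x \<bullet> b))"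
      by (simp add: diag_gauss_def scaleR_conv_of_real prod.distrib del: of_real_mult)
  qed
  also have "\<dots> = (\<Prod>b\<in>Basis. CLINT x|lborel. ?f b x)" by (rule integral_lborel_prod[OF int])
  also have "\<dots> = (\<Prod>b\<in>Basis. complex_of_real (exp (- ((\<sigma> \<bullet> b)\<^sup>2 * (t \<bullet> b)\<^sup>2) / 2)))"
  proof (rule prod.cong[OF refl])
    fix b :: 'a assume b: "b \<in> Basis"
    show "(CLINT x|lborel. ?f b x) = complex_of_real (exp (- ((\<sigma> \<bullet> b)\<^sup>2 * (t \<bullet> b)\<^sup>2) / 2))"
      using iexp_integral_normal_density[OF assms[OF b], of "t \<bullet> b"] by (subst (asm) integral_density) auto
  qed
  also have "\<dots> = exp (- (\<Sum>b\<in>Basis. (\<sigma> \<bullet> b)\<^sup>2 * (t \<bullet> b)\<^sup>2) / 2)"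
    by (simp add: exp_sum[symmetric] sum_negf sum_divide_distrib flip: of_real_prod)
  finally show ?thesis .
qed

lemma Basis_cart_eq: "(Basis :: (real^'n) set) = range (\<lambda>i. axis i 1)"
  by (auto simp: Basis_vec_def)

lemma prod_Basis_cart: "(\<Prod>b\<in>Basis. f b) = (\<Prod>i\<in>UNIV. f (axis i (1::real) :: real^'n))"
  unfolding Basis_cart_eq by (subst prod.reindex) (auto simp: inj_on_def axis_eq_axis)

lemma sum_Basis_cart: "(\<Sum>b\<in>Basis. f b) = (\<Sum>i\<in>UNIV. f (axis i (1::real) :: real^'n))"
  unfolding Basis_cart_eq by (subst sum.reindex) (auto simp: inj_on_def axis_eq_axis)

lemma diag_gauss_cart:
  fixes \<sigma> x :: "real^'n"
  assumes "\<And>i. 0 < \<sigma> $ i"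
  shows "diag_gauss \<sigma> x = exp (- (\<Sum>i\<in>UNIV. (x $ i)\<^sup>2 / (\<sigma> $ i)\<^sup>2) / 2) / (sqrt (2 * pi) ^ CARD('n) * (\<Prod>i\<in>UNIV. \<sigma> $ i))"
proof -
  have "diag_gauss \<sigma> x = (\<Prod>i\<in>UNIV. exp (- ((x $ i)\<^sup>2 / (\<sigma> $ i)\<^sup>2) / 2) / (sqrt (2 * pi) * \<sigma> $ i))"
    unfolding diag_gauss_def prod_Basis_cart normal_density_def
    using assms[THEN less_imp_le] by (intro prod.cong) (simp_all add: inner_axis real_sqrt_mult)
  also have "\<dots> = (\<Prod>i\<in>UNIV. exp (- ((x $ i)\<^sup>2 / (\<sigma> $ i)\<^sup>2) / 2)) / (sqrt (2 * pi) ^ CARD('n) * (\<Prod>i\<in>UNIV. \<sigma> $ i))"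
    by (simp add: prod_dividef prod.distrib)
  also have "(\<Prod>i\<in>UNIV. exp (- ((x $ i)\<^sup>2 / (\<sigma> $ i)\<^sup>2) / 2)) = exp (- (\<Sum>i\<in>UNIV. (x $ i)\<^sup>2 / (\<sigma> $ i)\<^sup>2) / 2)"
    by (simp add: exp_sum[symmetric] sum_negf sum_divide_distrib)
  finally show ?thesis .
qed

text \<open>Rotation invariance of Lebesgue measure: the standard Gaussian is rotation invariant because
  its characteristic function is, and its density is a positive radial function.\<close>

lemma lborel_distr_orthogonal:
  fixes Q :: "real^'n^'n"
  assumes Q: "orthogonal_matrix Q"
  shows "distr lborel borel ((*v) Q) = lborel"
proof -
  have QQ: "transpose Q ** Q = mat 1" "Q ** transpose Q = mat 1" using Q by (auto simp: orthogonal_matrix_def)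
  have iso: "(Q *v x) \<bullet> (Q *v y) = x \<bullet> y" for x y
    using inner_matrix_vector_adjoint[of "Q *v x" Q y] by (simp add: matrix_vector_mul_assoc QQ)
  have isot: "(transpose Q *v x) \<bullet> (transpose Q *v y) = x \<bullet> y" for x y
    using inner_matrix_vector_adjoint[of "transpose Q *v x" "transpose Q" y] by (simp only: matrix_vector_mul_assoc QQ transpose_transpose matrix_vector_mul_lid)
  have [measurable]: "(*v) Q \<in> borel_measurable borel"
    by (intro borel_measurable_continuous_onI continuous_intros)
  define one where "one = (\<chi> i. 1 :: real^'n)"
  have one: "\<And>b. b \<in> Basis \<Longrightarrow> 0 < one \<bullet> b" "\<And>i. 0 < one $ i"
    by (auto simp: one_def Basis_cart_eq inner_axis)
  let ?g = "diag_gauss one"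
  have g: "?g x = exp (- (x \<bullet> x) / 2) / sqrt (2 * pi) ^ CARD('n)" for x
    unfolding diag_gauss_cart[OF one(2)] by (simp add: one_def inner_vec_def power2_eq_square)
  interpret prob_space "density lborel ?g" by (rule prob_space_diag_gauss[OF one(1)])
  have chr: "(CLINT x|density lborel ?g. iexp (t \<bullet> x)) = exp (- (t \<bullet> t) / 2)" for t
  proof -
    have "(\<Sum>b\<in>Basis. (one \<bullet> b)\<^sup>2 * (t \<bullet> b)\<^sup>2) = t \<bullet> t"
      by (simp add: sum_Basis_cart one_def inner_axis) (simp add: inner_vec_def power2_eq_square)
    with iexp_integral_diag_gauss[OF one(1), of t] show ?thesis by (simp only:)
  qed
  have inv: "distr (density lborel ?g) borel ((*v) Q) = density lborel ?g"
  proof (rule finite_measure_eqI_iexp)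
    show "finite_measure (distr (density lborel ?g) borel ((*v) Q))" by (intro finite_measure_distr) simp
    show "(CLINT x|distr (density lborel ?g) borel ((*v) Q). iexp (t \<bullet> x)) = (CLINT x|density lborel ?g. iexp (t \<bullet> x))" for t
    proof -
      have "(CLINT x|distr (density lborel ?g) borel ((*v) Q). iexp (t \<bullet> x)) = (CLINT x|density lborel ?g. iexp ((transpose Q *v t) \<bullet> x))"
        by (subst integral_distr) (simp_all only: inner_matrix_vector_adjoint, measurable)
      then show ?thesis unfolding chr isot .
    qed
  qed (simp_all add: finite_measure_axioms)
  have "density lborel ?g = distr (density lborel ?g) borel ((*v) Q)" by (rule inv[symmetric])
  also have "\<dots> = distr (density lborel (\<lambda>x. ?g (Q *v x))) borel ((*v) Q)"
    by (simp add: g iso)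
  also have "\<dots> = density (distr lborel borel ((*v) Q)) ?g"
    by (subst density_distr) auto
  \<comment> \<open>The Gaussian density is positive everywhere, so multiplying both sides by its
    reciprocal removes it and leaves Lebesgue measure and its image.\<close>
  finally have "density (density lborel ?g) (\<lambda>x. ennreal (1 / ?g x)) = density (density (distr lborel borel ((*v) Q)) ?g) (\<lambda>x. ennreal (1 / ?g x))"
    by simp
  then show ?thesis
    by (simp add: density_density_eq ennreal_mult[symmetric] g density_1)
qed

section \<open>Nondegenerate multivariate normal laws\<close>

definition gauss :: "real^'n^'n \<Rightarrow> real^'n \<Rightarrow> real" where
  "gauss A x = exp (- (x \<bullet> (matrix_inv A *v x)) / 2) / (sqrt (2 * pi) ^ CARD('n) * sqrt (det A))"

lemma borel_measurable_matrix_vector_mult [measurable (raw)]: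
  fixes A :: "real^'n^'m"
  assumes "f \<in> borel_measurable M" shows "(\<lambda>x. A *v f x) \<in> borel_measurable M"
proof -
  have "(*v) A \<in> borel_measurable borel"
    by (intro borel_measurable_continuous_onI continuous_intros)
  from measurable_compose[OF assms this] show ?thesis .
qed

lemma gauss_measurable [measurable]: "gauss A \<in> borel_measurable borel"
  unfolding gauss_def by measurable

lemma gauss_pos: "pos_def A \<Longrightarrow> 0 < gauss A x"
  by (simp add: gauss_def pos_def_det_pos)

lemma matrix_inv_unique_right:
  fixes A B :: "real^'n^'n"
  assumes "A ** B = mat 1" shows "matrix_inv A = B"
proof -
  have "invertible A" using assms invertible_right_inverse by blast
  then show ?thesis using assms matrix_inv_left_right(2)[of A] by (metis matrix_mul_assoc matrix_mul_lid matrix_mul_rid)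
qed

lemma pos_def_matrix_inv:
  fixes A :: "real^'n^'n"
  assumes "pos_def A" shows "pos_def (matrix_inv A)"
proof -
  note I = matrix_inv_left_right[OF pos_def_invertible[OF assms]]
  have sym: "transpose (matrix_inv A) = matrix_inv A"
    using transpose_matrix_inv[OF pos_def_invertible[OF assms]] assms by (simp add: pos_def_def)
  have inv: "invertible (matrix_inv A)" using I invertible_def by blast
  from pos_def_congruence[OF assms this] show ?thesis by (simp add: sym I)
qed

text \<open>The peak value at the origin is the constant that later bounds the density of the
  outputs.\<close>

lemma gauss_le:
  fixes A :: "real^'n^'n"
  assumes A: "pos_def A" shows "gauss A x \<le> gauss A 0"
proof -
  have "0 \<le> x \<bullet> (matrix_inv A *v x)" using pos_def_matrix_inv[OF A] by (cases "x = 0") (auto simp: pos_def_def less_imp_le)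
  then show ?thesis unfolding gauss_def
    by (intro divide_right_mono) (auto simp: pos_def_det_pos[OF A] less_imp_le)
qed

lemma ln_gauss:
  fixes A :: "real^'n^'n"
  assumes "pos_def A"
  shows "ln (gauss A x) = - (x \<bullet> (matrix_inv A *v x)) / 2 - real CARD('n) * ln (2 * pi) / 2 - ln (det A) / 2"
  using pos_def_det_pos[OF assms]
  by (simp add: gauss_def ln_div ln_mult ln_realpow ln_sqrt)

text \<open>In the eigenbasis of \<open>A\<close> the density becomes a product of one-dimensional
  ones, with standard deviations the roots of the eigenvalues; rotation invariance of Lebesgue
  measure carries both claims back.\<close>

theorem
  fixes A :: "real^'n^'n"
  assumes A: "pos_def A"
  shows prob_space_gauss: "prob_space (density lborel (gauss A))"
    and iexp_integral_gauss: "(CLINT x|density lborel (gauss A). iexp (t \<bullet> x)) = exp (- (t \<bullet> (A *v t)) / 2)"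
proof -
  obtain Q d where Q: "orthogonal_matrix Q" "A = Q ** diag_mat d ** transpose Q" and d: "\<And>i. d i > 0"
    using pos_def_factor[OF A] by metis
  have QQ: "transpose Q ** Q = mat 1" "Q ** transpose Q = mat 1" using Q by (auto simp: orthogonal_matrix_def)
  define \<sigma> where "\<sigma> = (\<chi> i. sqrt (d i))"
  have \<sigma>: "\<And>b. b \<in> Basis \<Longrightarrow> 0 < \<sigma> \<bullet> b" "\<And>i. 0 < \<sigma> $ i" "\<And>i. (\<sigma> $ i)\<^sup>2 = d i"
    using d by (auto simp: \<sigma>_def Basis_cart_eq inner_axis less_imp_le)
  have inv: "matrix_inv A = Q ** diag_mat (\<lambda>i. 1 / d i) ** transpose Q"
  proof (rule matrix_inv_unique_right)
    have "A ** (Q ** diag_mat (\<lambda>i. 1 / d i) ** transpose Q) = Q ** diag_mat d ** (transpose Q ** Q) ** diag_mat (\<lambda>i. 1 / d i) ** transpose Q"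
      by (simp add: Q(2) matrix_mul_assoc)
    also have "\<dots> = Q ** (diag_mat d ** diag_mat (\<lambda>i. 1 / d i)) ** transpose Q" by (simp add: QQ matrix_mul_assoc)
    also have "diag_mat d ** diag_mat (\<lambda>i. 1 / d i) = (mat 1 :: real^'n^'n)"
      unfolding diag_mat_mult using d by (simp add: diag_mat_def mat_def vec_eq_iff less_imp_neq[THEN not_sym])
    finally show "A ** (Q ** diag_mat (\<lambda>i. 1 / d i) ** transpose Q) = mat 1" by (simp add: QQ)
  qed
  have "det Q * det Q = 1" using det_orthogonal_matrix[OF Q(1)] by auto
  then have detA: "det A = prod d UNIV" by (simp add: Q(2) det_mul mult.commute mult.left_commute)
  have "det A = (\<Prod>i\<in>UNIV. \<sigma> $ i)\<^sup>2"
    by (simp add: detA \<sigma>(3) prod_power_distrib)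
  moreover have "0 < (\<Prod>i\<in>UNIV. \<sigma> $ i)" using \<sigma>(2) by (intro prod_pos) auto
  ultimately have sqrt_det: "sqrt (det A) = (\<Prod>i\<in>UNIV. \<sigma> $ i)"
    by simp
  have gQ: "gauss A (Q *v x) = diag_gauss \<sigma> x" for x
  proof -
    have t: "transpose Q *v (Q *v x) = x" by (simp add: matrix_vector_mul_assoc QQ)
    have "(Q *v x) \<bullet> (matrix_inv A *v (Q *v x)) = x \<bullet> (diag_mat (\<lambda>i. 1 / d i) *v x)"
      unfolding inv using inner_congruence[of "Q *v x" "transpose Q" "diag_mat (\<lambda>i. 1 / d i)"] t by simp
    also have "\<dots> = (\<Sum>i\<in>UNIV. (x $ i)\<^sup>2 / (\<sigma> $ i)\<^sup>2)"
      unfolding \<sigma>(3) by (simp add: diag_mat_mult_vec inner_vec_def power2_eq_square)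
    finally show ?thesis unfolding gauss_def diag_gauss_cart[OF \<sigma>(2)] sqrt_det by simp
  qed
  have rep: "density lborel (gauss A) = distr (density lborel (diag_gauss \<sigma>)) borel ((*v) Q)"
  proof -
    have "density lborel (gauss A) = density (distr lborel borel ((*v) Q)) (gauss A)"
      by (simp add: lborel_distr_orthogonal[OF Q(1)])
    also have "\<dots> = distr (density lborel (\<lambda>x. gauss A (Q *v x))) borel ((*v) Q)"
      by (subst density_distr) auto
    finally show ?thesis by (simp add: gQ)
  qed
  interpret D: prob_space "density lborel (diag_gauss \<sigma>)" by (rule prob_space_diag_gauss[OF \<sigma>(1)])
  show "prob_space (density lborel (gauss A))" unfolding rep by (rule D.prob_space_distr) measurable
  have "(CLINT x|density lborel (gauss A). iexp (t \<bullet> x)) = (CLINT x|density lborel (diag_gauss \<sigma>). iexp ((transpose Q *v t) \<bullet> x))"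
    unfolding rep by (subst integral_distr) (simp_all only: inner_matrix_vector_adjoint, measurable)
  also have "\<dots> = exp (- (\<Sum>b\<in>Basis. (\<sigma> \<bullet> b)\<^sup>2 * ((transpose Q *v t) \<bullet> b)\<^sup>2) / 2)"
    by (rule iexp_integral_diag_gauss[OF \<sigma>(1)])
  also have "(\<Sum>b\<in>Basis. (\<sigma> \<bullet> b)\<^sup>2 * ((transpose Q *v t) \<bullet> b)\<^sup>2) = (transpose Q *v t) \<bullet> (diag_mat d *v (transpose Q *v t))"
    unfolding sum_Basis_cart diag_mat_mult_vec by (simp add: inner_axis \<sigma>(3)) (simp add: inner_vec_def power2_eq_square mult_ac)
  also have "\<dots> = t \<bullet> (A *v t)" unfolding Q(2) using inner_congruence[of t "transpose Q" "diag_mat d"] by simp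
  finally show "(CLINT x|density lborel (gauss A). iexp (t \<bullet> x)) = exp (- (t \<bullet> (A *v t)) / 2)" .
qed

section \<open>Second moments\<close>

text \<open>Measurability is required separately, since integrability of the squared norm does not
  give measurability of the vector.\<close>

definition sq_integrable :: "'w measure \<Rightarrow> ('w \<Rightarrow> 'a::euclidean_space) \<Rightarrow> bool" where
  "sq_integrable M X \<longleftrightarrow> X \<in> borel_measurable M \<and> integrable M (\<lambda>\<omega>. (norm (X \<omega>))\<^sup>2)"

lemma sq_integrable_measurable [dest]: "sq_integrable M X \<Longrightarrow> X \<in> borel_measurable M"
  by (simp add: sq_integrable_def)

lemma sq_integrable_bound:
  assumes "X \<in> borel_measurable M" "integrable M f" "\<And>\<omega>. (norm (X \<omega>))\<^sup>2 \<le> f \<omega>"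
  shows "sq_integrable M X"
  unfolding sq_integrable_def
  using assms(1) by (auto intro!: Bochner_Integration.integrable_bound[OF assms(2)] order_trans[OF assms(3) abs_ge_self])

lemma sq_integrable_add:
  assumes "sq_integrable M X" "sq_integrable M Y"
  shows "sq_integrable M (\<lambda>\<omega>. X \<omega> + Y \<omega>)"
proof (rule sq_integrable_bound)
  show "(\<lambda>\<omega>. X \<omega> + Y \<omega>) \<in> borel_measurable M" using assms by (auto intro: borel_measurable_add)
  show "integrable M (\<lambda>\<omega>. 2 * (norm (X \<omega>))\<^sup>2 + 2 * (norm (Y \<omega>))\<^sup>2)"
    using assms by (auto simp: sq_integrable_def)
  show "(norm (X \<omega> + Y \<omega>))\<^sup>2 \<le> 2 * (norm (X \<omega>))\<^sup>2 + 2 * (norm (Y \<omega>))\<^sup>2" for \<omega>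
  proof -
    have "(norm (X \<omega> + Y \<omega>))\<^sup>2 \<le> (norm (X \<omega>) + norm (Y \<omega>))\<^sup>2" by (simp add: norm_triangle_ineq)
    also have "\<dots> \<le> 2 * (norm (X \<omega>))\<^sup>2 + 2 * (norm (Y \<omega>))\<^sup>2"
      using sum_squares_bound[of "norm (X \<omega>)" "norm (Y \<omega>)"] by (simp add: power2_sum)
    finally show ?thesis .
  qed
qed

lemma sq_integrable_linear:
  assumes "sq_integrable M X" "bounded_linear f"
  shows "sq_integrable M (\<lambda>\<omega>. f (X \<omega>))"
proof -
  obtain K where K: "\<And>x. norm (f x) \<le> norm x * K" using bounded_linear.bounded[OF assms(2)] by blast
  show ?thesis
  proof (rule sq_integrable_bound)
  have "continuous_on UNIV f" using assms(2) by (rule linear_continuous_on)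
  then show "(\<lambda>\<omega>. f (X \<omega>)) \<in> borel_measurable M"
    using assms(1) borel_measurable_continuous_onI measurable_compose by blast
  show "integrable M (\<lambda>\<omega>. K\<^sup>2 * (norm (X \<omega>))\<^sup>2)" using assms(1) by (simp add: sq_integrable_def)
  show "(norm (f (X \<omega>)))\<^sup>2 \<le> K\<^sup>2 * (norm (X \<omega>))\<^sup>2" for \<omega>
    using power_mono[OF K[of "X \<omega>"] norm_ge_zero, of 2] by (simp add: power_mult_distrib mult.commute)
  qed
qed

lemma sq_integrable_matrix:
  fixes A :: "real^'n^'m"
  shows "sq_integrable M X \<Longrightarrow> sq_integrable M (\<lambda>\<omega>. A *v X \<omega>)"
  by (rule sq_integrable_linear) simp_all

lemma sq_integrable_minus: "sq_integrable M X \<Longrightarrow> sq_integrable M (\<lambda>\<omega>. - X \<omega>)"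
  by (simp add: sq_integrable_def)

lemma sq_integrable_diff:
  "sq_integrable M X \<Longrightarrow> sq_integrable M Y \<Longrightarrow> sq_integrable M (\<lambda>\<omega>. X \<omega> - Y \<omega>)"
  using sq_integrable_add[of M X "\<lambda>\<omega>. - Y \<omega>"] sq_integrable_minus[of M Y] by simp

lemma sq_integrable_inner_left: "sq_integrable M X \<Longrightarrow> sq_integrable M (\<lambda>\<omega>. a \<bullet> X \<omega>)"
  by (rule sq_integrable_linear) (simp_all add: bounded_linear_inner_right)

lemma sq_integrable_nth: "sq_integrable M X \<Longrightarrow> sq_integrable M (\<lambda>\<omega>. X \<omega> $ i)"
  by (rule sq_integrable_linear) (simp_all add: bounded_linear_vec_nth)

lemma integrable_mult_sq_integrable:
  fixes X Y :: "'w \<Rightarrow> real"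
  assumes "sq_integrable M X" "sq_integrable M Y"
  shows "integrable M (\<lambda>\<omega>. X \<omega> * Y \<omega>)"
proof (rule Bochner_Integration.integrable_bound)
  show "integrable M (\<lambda>\<omega>. (X \<omega>)\<^sup>2 + (Y \<omega>)\<^sup>2)" using assms by (simp add: sq_integrable_def)
  show "(\<lambda>\<omega>. X \<omega> * Y \<omega>) \<in> borel_measurable M" using assms by (auto intro: borel_measurable_times)
  have "\<bar>x * y\<bar> \<le> x\<^sup>2 + y\<^sup>2" for x y :: real
  proof -
    have "2 * (\<bar>x\<bar> * \<bar>y\<bar>) \<le> x\<^sup>2 + y\<^sup>2" using sum_squares_bound[of "\<bar>x\<bar>" "\<bar>y\<bar>"] by (simp add: mult.assoc)
    moreover have "0 \<le> \<bar>x\<bar> * \<bar>y\<bar>" by simp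
    ultimately show ?thesis unfolding abs_mult by linarith
  qed
  then show "AE \<omega> in M. norm (X \<omega> * Y \<omega>) \<le> norm ((X \<omega>)\<^sup>2 + (Y \<omega>)\<^sup>2)" by auto
qed

lemma (in finite_measure) integrable_sq_integrable:
  fixes X :: "'a \<Rightarrow> 'b::euclidean_space"
  assumes "sq_integrable M X"
  shows "integrable M X"
proof (rule Bochner_Integration.integrable_bound)
  show "integrable M (\<lambda>\<omega>. 1 + (norm (X \<omega>))\<^sup>2)" using assms by (simp add: sq_integrable_def)
  show "X \<in> borel_measurable M" using assms by auto
  have "x \<le> 1 + x\<^sup>2" if "0 \<le> x" for x :: real using sum_squares_bound[of x 1] that by simp
  then show "AE \<omega> in M. norm (X \<omega>) \<le> norm (1 + (norm (X \<omega>))\<^sup>2)" by simp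
qed

lemma sq_integrable_iff_nth:
  fixes X :: "'w \<Rightarrow> real^'n"
  shows "sq_integrable M X \<longleftrightarrow> (\<forall>i. sq_integrable M (\<lambda>\<omega>. X \<omega> $ i))"
proof
  assume R: "\<forall>i. sq_integrable M (\<lambda>\<omega>. X \<omega> $ i)"
  show "sq_integrable M X"
    unfolding sq_integrable_def
  proof
    show "X \<in> borel_measurable M"
      using R by (subst borel_measurable_euclidean_space) (auto simp: Basis_cart_eq inner_axis)
    have "(norm (X \<omega>))\<^sup>2 = (\<Sum>i\<in>UNIV. (norm (X \<omega> $ i))\<^sup>2)" for \<omega>
      by (simp add: power2_norm_eq_inner inner_vec_def) (simp add: power2_eq_square)
    then show "integrable M (\<lambda>\<omega>. (norm (X \<omega>))\<^sup>2)"
      using R by (simp add: sq_integrable_def)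
  qed
qed (simp add: sq_integrable_nth)

text \<open>Through this bridge identities between moment matrices are checked as scalar integrals
  of projections.\<close>

lemma cross_moment_form:
  fixes X :: "'w \<Rightarrow> real^'a" and Y :: "'w \<Rightarrow> real^'b"
  assumes X: "sq_integrable M X" and Y: "sq_integrable M Y"
  shows "(LINT \<omega>|M. (a \<bullet> X \<omega>) * (b \<bullet> Y \<omega>)) = a \<bullet> (cross_moment M X Y *v b)"
proof -
  have i: "integrable M (\<lambda>\<omega>. X \<omega> $ i * Y \<omega> $ j)" for i j
    using X Y by (intro integrable_mult_sq_integrable sq_integrable_nth)
  have "(a \<bullet> X \<omega>) * (b \<bullet> Y \<omega>) = (\<Sum>i\<in>UNIV. \<Sum>j\<in>UNIV. a $ i * b $ j * (X \<omega> $ i * Y \<omega> $ j))" for \<omega>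
    by (simp add: inner_vec_def sum_product mult_ac)
  then have "(LINT \<omega>|M. (a \<bullet> X \<omega>) * (b \<bullet> Y \<omega>)) = (\<Sum>i\<in>UNIV. \<Sum>j\<in>UNIV. a $ i * b $ j * (LINT \<omega>|M. X \<omega> $ i * Y \<omega> $ j))"
    using i by simp
  also have "\<dots> = a \<bullet> (cross_moment M X Y *v b)"
    by (simp add: cross_moment_def inner_vec_def matrix_vector_mult_def sum_distrib_left mult_ac)
  finally show ?thesis .
qed

lemma cross_moment_transpose: "transpose (cross_moment M X Y) = cross_moment M Y X"
  by (simp add: cross_moment_def transpose_def vec_eq_iff mult.commute)

lemma cov_matrix_centred: "(LINT \<omega>|M. X \<omega>) = 0 \<Longrightarrow> cov_matrix M X = cross_moment M X X"
  by (simp add: cov_matrix_def)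

text \<open>\<open>gaussian_vector\<close> speaks only of one-dimensional projections, so second
  moments and characteristic function are read off the law of \<open>a \<bullet> X\<close>.
  Degenerate projections are included.\<close>

lemma (in prob_space) gaussian_vector_inner:
  assumes "gaussian_vector M X"
  shows "sq_integrable M (\<lambda>\<omega>. a \<bullet> X \<omega>)"
    and "(LINT \<omega>|M. a \<bullet> X \<omega>) = 0 \<Longrightarrow>
      (CLINT \<omega>|M. iexp (a \<bullet> X \<omega>)) = exp (- (LINT \<omega>|M. (a \<bullet> X \<omega>)\<^sup>2) / 2)"
proof -
  have [measurable]: "X \<in> borel_measurable M" using assms by (simp add: gaussian_vector_def)
  obtain \<mu> \<sigma> where \<sigma>: "0 \<le> \<sigma>" and law: "distr M borel (\<lambda>\<omega>. a \<bullet> X \<omega>) = normal_law \<mu> \<sigma>"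
    using assms unfolding gaussian_vector_def by blast
  note m = normal_law_moments[OF \<sigma>]
  have "integrable (distr M borel (\<lambda>\<omega>. a \<bullet> X \<omega>)) (\<lambda>x. x\<^sup>2)" unfolding law by (rule m(3))
  then have "integrable M (\<lambda>\<omega>. (a \<bullet> X \<omega>)\<^sup>2)" by (subst (asm) integrable_distr_eq) auto
  then show "sq_integrable M (\<lambda>\<omega>. a \<bullet> X \<omega>)" by (simp add: sq_integrable_def)
  assume z: "(LINT \<omega>|M. a \<bullet> X \<omega>) = 0"
  have "(LINT \<omega>|M. a \<bullet> X \<omega>) = (LINT x|distr M borel (\<lambda>\<omega>. a \<bullet> X \<omega>). x)"
    by (subst integral_distr) auto
  also have "\<dots> = \<mu>" unfolding law by (rule m(2))
  finally have \<mu>: "\<mu> = 0" using z by simp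
  have "(LINT \<omega>|M. (a \<bullet> X \<omega>)\<^sup>2) = (LINT x|distr M borel (\<lambda>\<omega>. a \<bullet> X \<omega>). x\<^sup>2)"
    by (subst integral_distr) auto
  also have "\<dots> = \<sigma>\<^sup>2" unfolding law \<mu> by (rule m(4))
  finally have s: "(LINT \<omega>|M. (a \<bullet> X \<omega>)\<^sup>2) = \<sigma>\<^sup>2" .
  have "(CLINT \<omega>|M. iexp (a \<bullet> X \<omega>)) = (CLINT x|distr M borel (\<lambda>\<omega>. a \<bullet> X \<omega>). iexp (1 * x))"
    by (subst integral_distr) auto
  also have "\<dots> = exp (- (\<sigma>\<^sup>2) / 2)" unfolding law \<mu> iexp_integral_normal_law[OF \<sigma>] by simp
  finally show "(CLINT \<omega>|M. iexp (a \<bullet> X \<omega>)) = exp (- (LINT \<omega>|M. (a \<bullet> X \<omega>)\<^sup>2) / 2)" by (simp add: s)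
qed

text \<open>The characteristic function identifies every projection as a one-dimensional normal law
  with variance \<open>a \<bullet> (A *v a)\<close>, whose moments are known.\<close>

lemma gauss_moments:
  fixes A :: "real^'n^'n"
  assumes A: "pos_def A"
  defines "N \<equiv> density lborel (gauss A)"
  shows "sq_integrable N (\<lambda>x. x)" "(LINT x|N. a \<bullet> x) = 0" "(LINT x|N. (a \<bullet> x) * (b \<bullet> x)) = a \<bullet> (A *v b)"
proof -
  interpret N: prob_space N unfolding N_def by (rule prob_space_gauss[OF A])
  have sets: "sets N = sets borel" by (simp add: N_def)
  have m: "f \<in> borel_measurable N" if "f \<in> borel_measurable borel" for f :: "real^'n \<Rightarrow> 'z::topological_space"
    using that by (simp cong: measurable_cong_sets add: sets)
  have im: "(\<lambda>x. a \<bullet> x) \<in> borel_measurable N" for a by (rule m) measurable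
  define q where "q a = a \<bullet> (A *v a)" for a
  have q0: "0 \<le> q a" for a using A by (cases "a = 0") (auto simp: q_def pos_def_def less_imp_le)
  have law: "distr N borel (\<lambda>x. a \<bullet> x) = normal_law 0 (sqrt (q a))" for a
  proof (rule finite_measure_eqI_iexp_real)
    show "finite_measure (distr N borel (\<lambda>x. a \<bullet> x))" by (rule N.finite_measure_distr[OF im])
    show "finite_measure (normal_law 0 (sqrt (q a)))" using prob_space_normal_law[of "sqrt (q a)" 0] q0
      by (simp add: prob_space.finite_measure)
    fix t
    have "(CLINT x|distr N borel (\<lambda>x. a \<bullet> x). iexp (t * x)) = (CLINT x|N. iexp ((t *\<^sub>R a) \<bullet> x))"
      by (subst integral_distr[OF im]) auto
    also have "\<dots> = exp (- ((t *\<^sub>R a) \<bullet> (A *v (t *\<^sub>R a))) / 2)"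
      unfolding N_def by (rule iexp_integral_gauss[OF A])
    also have "(t *\<^sub>R a) \<bullet> (A *v (t *\<^sub>R a)) = (sqrt (q a))\<^sup>2 * t\<^sup>2"
      using q0 by (simp add: q_def matrix_vector_mult_scaleR power2_eq_square mult_ac)
    also have "complex_of_real (exp (- ((sqrt (q a))\<^sup>2 * t\<^sup>2) / 2)) = (CLINT x|normal_law 0 (sqrt (q a)). iexp (t * x))"
      using q0 by (subst iexp_integral_normal_law) auto
    finally show "(CLINT x|distr N borel (\<lambda>x. a \<bullet> x). iexp (t * x)) = (CLINT x|normal_law 0 (sqrt (q a)). iexp (t * x))" .
  qed (simp_all add: sets)
  have s: "0 \<le> sqrt (q a)" for a using q0 by simp
  have gv: "gaussian_vector N (\<lambda>x. x)" unfolding gaussian_vector_def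
  proof (intro conjI allI)
    show "(\<lambda>x. x) \<in> borel_measurable N" by (rule m) simp
    show "\<exists>\<mu> \<sigma>. 0 \<le> \<sigma> \<and> distr N borel (\<lambda>x. a \<bullet> x) = normal_law \<mu> \<sigma>" for a using law s by blast
  qed
  have sqi: "sq_integrable N (\<lambda>x. a \<bullet> x)" for a by (rule N.gaussian_vector_inner(1)[OF gv])
  show "sq_integrable N (\<lambda>x. x)"
    unfolding sq_integrable_iff_nth using sqi[of "axis _ 1"] by (simp add: inner_axis')
  show "(LINT x|N. a \<bullet> x) = 0"
  proof -
    have "(LINT x|N. a \<bullet> x) = (LINT x|distr N borel (\<lambda>x. a \<bullet> x). x)" by (subst integral_distr[OF im]) auto
    then show ?thesis unfolding law using normal_law_moments(2)[OF s] by simp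
  qed
  have var: "(LINT x|N. (a \<bullet> x)\<^sup>2) = q a" for a
  proof -
    have "(LINT x|N. (a \<bullet> x)\<^sup>2) = (LINT x|distr N borel (\<lambda>x. a \<bullet> x). x\<^sup>2)" by (subst integral_distr[OF im]) auto
    then show ?thesis unfolding law using normal_law_moments(4)[OF s] q0 by simp
  qed
  \<comment> \<open>Polarization: the mixed moment follows from the variances of three
    projections.\<close>
  have "(LINT x|N. (a \<bullet> x) * (b \<bullet> x)) = (LINT x|N. (((a + b) \<bullet> x)\<^sup>2 - (a \<bullet> x)\<^sup>2 - (b \<bullet> x)\<^sup>2) / 2)"
    by (intro Bochner_Integration.integral_cong) (auto simp: inner_add_left power2_sum)
  also have "\<dots> = (q (a + b) - q a - q b) / 2"
    using sqi var by (simp add: sq_integrable_def)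
  also have "\<dots> = a \<bullet> (A *v b)"
    using A unfolding q_def pos_def_def by (subst symmetric_form_add) auto
  finally show "(LINT x|N. (a \<bullet> x) * (b \<bullet> x)) = a \<bullet> (A *v b)" .
qed

section \<open>Innovations of the noise\<close>

text \<open>One-step linear prediction; the value at \<open>t\<close> reads only entries of
  \<open>y\<close> before \<open>t\<close>. The gain is a parameter because the recursion is run
  twice: with \<open>Kp\<close> on the noise, and with the gain of the decision on the channel
  outputs.\<close>

primrec kalman :: "real^'d^'d \<Rightarrow> real^'d^'p \<Rightarrow> (nat \<Rightarrow> real^'p^'d) \<Rightarrow> (nat \<Rightarrow> real^'p) \<Rightarrow> nat \<Rightarrow> real^'d" where
  "kalman F H K y 0 = 0"
| "kalman F H K y (Suc t) = F *v kalman F H K y t + K t *v (y t - H *v kalman F H K y t)"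

lemma kalman_cong: "(\<And>j. j < t \<Longrightarrow> y j = y' j) \<Longrightarrow> kalman F H K y t = kalman F H K y' t"
  by (induction t) auto

text \<open>Functions with a common value type turn \<open>indep_pair\<close> into
  \<open>indep_var\<close>, to which the product rule for characteristic functions applies.\<close>

lemma (in prob_space) indep_pair_compose:
  assumes "indep_pair M A X B Y" and f: "f \<in> A \<rightarrow>\<^sub>M N" and g: "g \<in> B \<rightarrow>\<^sub>M N'"
  shows "indep_var N (\<lambda>\<omega>. f (X \<omega>)) N' (\<lambda>\<omega>. g (Y \<omega>))"
proof -
  have X: "X \<in> M \<rightarrow>\<^sub>M A" and Y: "Y \<in> M \<rightarrow>\<^sub>M B"
    and ind: "indep_set (sets (vimage_algebra (space M) X A)) (sets (vimage_algebra (space M) Y B))"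
    using assms(1) by (auto simp: indep_pair_def)
  have sub: "sigma_sets (space M) {(\<lambda>\<omega>. h (Z \<omega>)) -` C \<inter> space M |C. C \<in> sets R} \<subseteq> sets (vimage_algebra (space M) Z T)"
    if "Z \<in> M \<rightarrow>\<^sub>M T" "h \<in> T \<rightarrow>\<^sub>M R" for Z :: "'a \<Rightarrow> 'x" and T and h :: "'x \<Rightarrow> 'y" and R
    unfolding sets_vimage_algebra
  proof (rule sigma_sets_mono, safe)
    fix C assume "C \<in> sets R"
    with that(2) have "h -` C \<inter> space T \<in> sets T" by (rule measurable_sets)
    moreover have "(\<lambda>\<omega>. h (Z \<omega>)) -` C \<inter> space M = Z -` (h -` C \<inter> space T) \<inter> space M"
      using measurable_space[OF that(1)] by auto
    ultimately show "(\<lambda>\<omega>. h (Z \<omega>)) -` C \<inter> space M \<in> sigma_sets (space M) {Z -` A \<inter> space M |A. A \<in> sets T}"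
      by (intro sigma_sets.Basic) blast
  qed
  have "indep_set (sigma_sets (space M) {(\<lambda>\<omega>. f (X \<omega>)) -` C \<inter> space M |C. C \<in> sets N})
      (sigma_sets (space M) {(\<lambda>\<omega>. g (Y \<omega>)) -` C \<inter> space M |C. C \<in> sets N'})"
    using ind sub[OF X f] sub[OF Y g] unfolding indep_set_def
    by (elim indep_sets_mono_sets) (auto split: bool.split)
  then show ?thesis using X Y f g by (auto simp: indep_var_eq)
qed

locale state_space_noise = prob_space M
  for M :: "'w measure"
    and F :: "real^'d^'d" and G :: "real^'q^'d" and H :: "real^'d^'p"
    and W :: "real^'q^'q" and V :: "real^'p^'p" and L :: "real^'p^'q"
    and s :: "nat \<Rightarrow> 'w \<Rightarrow> real^'d" and w :: "nat \<Rightarrow> 'w \<Rightarrow> real^'q"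
    and v z :: "nat \<Rightarrow> 'w \<Rightarrow> real^'p"
    and \<Sigma> :: "nat \<Rightarrow> real^'d^'d" and Kp :: "nat \<Rightarrow> real^'p^'d" and \<Psi> :: "nat \<Rightarrow> real^'p^'p" +
  assumes state: "\<And>i \<omega>. s (Suc i) \<omega> = F *v s i \<omega> + G *v w i \<omega>"
    and noise: "\<And>i \<omega>. z i \<omega> = H *v s i \<omega> + v i \<omega>"
    and initial: "gaussian_vector M (s 0)" "(LINT \<omega>|M. s 0 \<omega>) = 0" "cov_matrix M (s 0) = \<Sigma> 0"
    and gaussian: "\<And>i. gaussian_vector M (\<lambda>\<omega>. (w i \<omega>, v i \<omega>))"
    and zero_mean: "\<And>i. (LINT \<omega>|M. w i \<omega>) = 0" "\<And>i. (LINT \<omega>|M. v i \<omega>) = 0"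
    and covariances: "\<And>i. cov_matrix M (w i) = W" "\<And>i. cov_matrix M (v i) = V"
      "\<And>i. cross_moment M (w i) (v i) = L"
    and independent: "indep_vars (\<lambda>_. borel) (\<lambda>i \<omega>. (w i \<omega>, v i \<omega>)) UNIV"
    and independent_of_initial:
      "indep_pair M borel (s 0) (\<Pi>\<^sub>M i\<in>UNIV. borel) (\<lambda>\<omega> i. (w i \<omega>, v i \<omega>))"
    and riccati:
      "\<And>i. \<Sigma> (Suc i) = F ** \<Sigma> i ** transpose F + G ** W ** transpose G
                        - Kp i ** \<Psi> i ** transpose (Kp i)"
      "\<And>i. Kp i = (F ** \<Sigma> i ** transpose H + G ** L) ** matrix_inv (\<Psi> i)"
      "\<And>i. \<Psi> i = H ** \<Sigma> i ** transpose H + V"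
    and innovations: "\<And>i. pos_def (\<Psi> i)"
begin

section \<open>Joint characteristic function of the primitive noises\<close>

lemma sq_integrable_noise: "sq_integrable M (s 0)" "sq_integrable M (w i)" "sq_integrable M (v i)"
proof -
  show "sq_integrable M (s 0)"
    unfolding sq_integrable_iff_nth using gaussian_vector_inner(1)[OF initial(1), of "axis _ 1"] by (simp add: inner_axis')
  show "sq_integrable M (w i)"
    unfolding sq_integrable_iff_nth using gaussian_vector_inner(1)[OF gaussian[of i], of "(axis _ 1, 0)"] by (simp add: inner_axis')
  show "sq_integrable M (v i)"
    unfolding sq_integrable_iff_nth using gaussian_vector_inner(1)[OF gaussian[of i], of "(0, axis _ 1)"] by (simp add: inner_axis')
qed

lemma noise_measurable [measurable]: "s i \<in> borel_measurable M" "w i \<in> borel_measurable M" "v i \<in> borel_measurable M" "z i \<in> borel_measurable M"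
proof -
  show [measurable]: "w i \<in> borel_measurable M" "v i \<in> borel_measurable M" for i
    using sq_integrable_noise by auto
  show [measurable]: "s i \<in> borel_measurable M" for i
  proof (induction i)
    case 0 then show ?case using sq_integrable_noise by auto
  next
    case (Suc i)
    note [measurable] = Suc
    have "(\<lambda>\<omega>. F *v s i \<omega> + G *v w i \<omega>) \<in> borel_measurable M" by measurable
    then show ?case by (simp add: state[abs_def] fun_eq_iff[symmetric] cong: measurable_cong)
  qed
  have "(\<lambda>\<omega>. H *v s i \<omega> + v i \<omega>) \<in> borel_measurable M" by measurable
  then show "z i \<in> borel_measurable M" by (simp add: noise cong: measurable_cong)
qed

text \<open>The variance of \<open>c \<bullet> w i + d \<bullet> v i\<close>, the same for every
  \<open>i\<close>.\<close>

definition wv_form :: "real^'q \<Rightarrow> real^'p \<Rightarrow> real" where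
  "wv_form c d = c \<bullet> (W *v c) + 2 * (c \<bullet> (L *v d)) + d \<bullet> (V *v d)"

lemma iexp_integral_wv:
  "(CLINT \<omega>|M. iexp (c \<bullet> w i \<omega> + d \<bullet> v i \<omega>)) = exp (- wv_form c d / 2)"
proof -
  note sq = sq_integrable_noise
  have int: "integrable M (w i)" "integrable M (v i)" using sq by (auto intro: integrable_sq_integrable)
  have "(LINT \<omega>|M. (c, d) \<bullet> (w i \<omega>, v i \<omega>)) = 0"
    using int zero_mean[of i] by (simp add: integral_inner_right)
  from gaussian_vector_inner(2)[OF gaussian this]
  have "(CLINT \<omega>|M. iexp (c \<bullet> w i \<omega> + d \<bullet> v i \<omega>)) = exp (- (LINT \<omega>|M. (c \<bullet> w i \<omega> + d \<bullet> v i \<omega>)\<^sup>2) / 2)"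
    by simp
  also have "(LINT \<omega>|M. (c \<bullet> w i \<omega> + d \<bullet> v i \<omega>)\<^sup>2)
      = (LINT \<omega>|M. (c \<bullet> w i \<omega>) * (c \<bullet> w i \<omega>) + 2 * ((c \<bullet> w i \<omega>) * (d \<bullet> v i \<omega>)) + (d \<bullet> v i \<omega>) * (d \<bullet> v i \<omega>))"
    by (intro Bochner_Integration.integral_cong) (simp_all add: power2_eq_square algebra_simps)
  also have "\<dots> = (LINT \<omega>|M. (c \<bullet> w i \<omega>) * (c \<bullet> w i \<omega>)) + 2 * (LINT \<omega>|M. (c \<bullet> w i \<omega>) * (d \<bullet> v i \<omega>)) + (LINT \<omega>|M. (d \<bullet> v i \<omega>) * (d \<bullet> v i \<omega>))"
    using sq by (simp add: integrable_mult_sq_integrable sq_integrable_inner_left)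
  also have "\<dots> = wv_form c d"
    using covariances[of i] zero_mean[of i] sq by (simp add: cross_moment_form cov_matrix_centred wv_form_def)
  finally show ?thesis .
qed

lemma iexp_integral_initial: "(CLINT \<omega>|M. iexp (b \<bullet> s 0 \<omega>)) = exp (- (b \<bullet> (\<Sigma> 0 *v b)) / 2)"
proof -
  note sq = sq_integrable_noise(1)
  have "(LINT \<omega>|M. b \<bullet> s 0 \<omega>) = 0"
    using integrable_sq_integrable[OF sq] initial(2) by (simp add: integral_inner_right)
  from gaussian_vector_inner(2)[OF initial(1) this]
  have "(CLINT \<omega>|M. iexp (b \<bullet> s 0 \<omega>)) = exp (- (LINT \<omega>|M. (b \<bullet> s 0 \<omega>) * (b \<bullet> s 0 \<omega>)) / 2)"
    by (simp add: power2_eq_square)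
  also have "(LINT \<omega>|M. (b \<bullet> s 0 \<omega>) * (b \<bullet> s 0 \<omega>)) = b \<bullet> (\<Sigma> 0 *v b)"
    using initial(2,3) sq by (simp add: cross_moment_form cov_matrix_centred)
  finally show ?thesis .
qed

text \<open>The initial state splits off because it is independent of the whole noise sequence; the
  remaining sum factors over time because the pairs are independent. No density is involved, so
  singular covariances do no harm.\<close>

lemma iexp_integral_primitive:
  "(CLINT \<omega>|M. iexp (b \<bullet> s 0 \<omega> + (\<Sum>j<N. c j \<bullet> w j \<omega> + d j \<bullet> v j \<omega>)))
    = exp (- (b \<bullet> (\<Sigma> 0 *v b) + (\<Sum>j<N. wv_form (c j) (d j))) / 2)"
proof -
  have chr: "char (distr M borel X) 1 = (CLINT \<omega>|M. iexp (X \<omega>))" if "X \<in> borel_measurable M" for X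
    using that by (simp add: char_def integral_distr)
  define T where "T j \<omega> = c j \<bullet> w j \<omega> + d j \<bullet> v j \<omega>" for j \<omega>
  have [measurable]: "T j \<in> borel_measurable M" for j unfolding T_def by measurable
  have "indep_var borel (\<lambda>\<omega>. b \<bullet> s 0 \<omega>) borel (\<lambda>\<omega>. (\<lambda>f. \<Sum>j<N. c j \<bullet> fst (f j) + d j \<bullet> snd (f j)) (\<lambda>i. (w i \<omega>, v i \<omega>)))"
  proof (rule indep_pair_compose[OF independent_of_initial])
    have "(\<lambda>f. c j \<bullet> fst (f j) + d j \<bullet> snd (f j)) \<in> borel_measurable (\<Pi>\<^sub>M i\<in>UNIV. borel :: ((real^'q) \<times> (real^'p)) measure)" for j
    proof -
      have 1: "(\<lambda>f. f j) \<in> (\<Pi>\<^sub>M i\<in>UNIV. borel :: ((real^'q) \<times> (real^'p)) measure) \<rightarrow>\<^sub>M borel" by simp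
      have 2: "(\<lambda>x :: (real^'q) \<times> (real^'p). c j \<bullet> fst x + d j \<bullet> snd x) \<in> borel_measurable borel"
        by (intro borel_measurable_continuous_onI continuous_intros)
      show ?thesis using measurable_compose[OF 1 2] .
    qed
    then show "(\<lambda>f. \<Sum>j<N. c j \<bullet> fst (f j) + d j \<bullet> snd (f j)) \<in> borel_measurable (\<Pi>\<^sub>M i\<in>UNIV. borel :: ((real^'q) \<times> (real^'p)) measure)"
      by (intro borel_measurable_sum)
  qed simp
  then have "indep_var borel (\<lambda>\<omega>. b \<bullet> s 0 \<omega>) borel (\<lambda>\<omega>. \<Sum>j<N. T j \<omega>)" by (simp add: T_def)
  from char_distr_add[OF this, of 1]
  have "(CLINT \<omega>|M. iexp (b \<bullet> s 0 \<omega> + (\<Sum>j<N. T j \<omega>)))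
      = (CLINT \<omega>|M. iexp (b \<bullet> s 0 \<omega>)) * char (distr M borel (\<lambda>\<omega>. \<Sum>j<N. T j \<omega>)) 1"
    by (simp only: chr[of "\<lambda>\<omega>. b \<bullet> s 0 \<omega>"] chr[of "\<lambda>\<omega>. b \<bullet> s 0 \<omega> + (\<Sum>j<N. T j \<omega>)"]
      borel_measurable_add borel_measurable_inner borel_measurable_const borel_measurable_sum noise_measurable \<open>\<And>j. T j \<in> borel_measurable M\<close>)
  also have "char (distr M borel (\<lambda>\<omega>. \<Sum>j<N. T j \<omega>)) 1 = (\<Prod>j<N. char (distr M borel (T j)) 1)"
  proof (rule char_distr_sum)
    have "indep_vars (\<lambda>_. borel) (\<lambda>j \<omega>. (\<lambda>x. c j \<bullet> fst x + d j \<bullet> snd x) (w j \<omega>, v j \<omega>)) {..<N}"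
      by (rule indep_vars_compose2[OF indep_vars_subset[OF independent]])
         (auto intro!: borel_measurable_continuous_onI continuous_intros)
    then show "indep_vars (\<lambda>i. borel) T {..<N}" by (simp add: T_def[abs_def])
  qed
  also have "\<dots> = (\<Prod>j<N. complex_of_real (exp (- wv_form (c j) (d j) / 2)))"
    by (simp only: chr \<open>\<And>j. T j \<in> borel_measurable M\<close> T_def iexp_integral_wv)
  finally show ?thesis
    unfolding iexp_integral_initial T_def
    by (simp add: exp_add[symmetric] exp_sum[symmetric] sum_negf sum_divide_distrib add_divide_distrib
        flip: of_real_prod of_real_mult)
       (simp add: sum_distrib_right)
qed

section \<open>Innovation representation of the noise\<close>

definition innov :: "nat \<Rightarrow> 'w \<Rightarrow> real^'p" where
  "innov t \<omega> = z t \<omega> - H *v kalman F H Kp (\<lambda>j. z j \<omega>) t"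

definition state_error :: "nat \<Rightarrow> 'w \<Rightarrow> real^'d" where
  "state_error t \<omega> = s t \<omega> - kalman F H Kp (\<lambda>j. z j \<omega>) t"

lemma innov_eq: "innov t \<omega> = H *v state_error t \<omega> + v t \<omega>"
  by (simp add: innov_def state_error_def noise matrix_vector_mult_diff_distrib)

lemma state_error_0: "state_error 0 \<omega> = s 0 \<omega>"
  by (simp add: state_error_def)

lemma state_error_Suc: "state_error (Suc t) \<omega> = F *v state_error t \<omega> + G *v w t \<omega> - Kp t *v innov t \<omega>"
  by (simp add: state_error_def innov_def state matrix_vector_mult_diff_distrib)

lemma symmetric_matrices:
  "transpose W = W" "transpose (\<Sigma> t) = \<Sigma> t" "transpose (\<Psi> t) = \<Psi> t"
proof -
  show W: "transpose W = W"
    using covariances(1)[of 0] zero_mean(1)[of 0] cross_moment_transpose by (metis cov_matrix_centred)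
  show \<Psi>: "transpose (\<Psi> t) = \<Psi> t" for t using innovations by (simp add: pos_def_def)
  show "transpose (\<Sigma> t) = \<Sigma> t"
  proof (induction t)
    case 0 show ?case using initial cross_moment_transpose by (metis cov_matrix_centred)
  next
    case (Suc t) then show ?case
      by (simp add: riccati(1) transpose_add transpose_diff matrix_transpose_mul W \<Psi> matrix_mul_assoc)
  qed
qed

lemma gain_mult: "Kp t ** \<Psi> t = F ** \<Sigma> t ** transpose H + G ** L"
  using matrix_inv_left_right(2)[OF pos_def_invertible[OF innovations[of t]]]
  by (simp add: riccati(2)[of t] flip: matrix_mul_assoc[of _ "matrix_inv _"])

text \<open>The vectors \<open>b'\<close> and \<open>d\<close> are the coefficients that arise when \<open>a \<bullet> \<psi>\<^sub>t + b \<bullet> \<epsilon>\<^sub>t\<^sub>+\<^sub>1\<close>, with \<open>\<epsilon>\<close> the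
  state error, is rewritten in terms of \<open>\<epsilon>\<^sub>t\<close>, \<open>w\<^sub>t\<close> and \<open>v\<^sub>t\<close>.\<close>

lemma riccati_form:
  fixes a :: "real^'p" and b :: "real^'d" and t :: nat
  defines "d \<equiv> a - transpose (Kp t) *v b"
  defines "b' \<equiv> transpose H *v d + transpose F *v b"
  shows "b' \<bullet> (\<Sigma> t *v b') + wv_form (transpose G *v b) d = a \<bullet> (\<Psi> t *v a) + b \<bullet> (\<Sigma> (Suc t) *v b)"
proof -
  let ?k = "transpose (Kp t) *v b"
  have a: "a = ?k + d" by (simp add: d_def)
  have 1: "b' \<bullet> (\<Sigma> t *v b') = d \<bullet> ((H ** \<Sigma> t ** transpose H) *v d) + 2 * (b \<bullet> ((F ** \<Sigma> t ** transpose H) *v d)) + b \<bullet> ((F ** \<Sigma> t ** transpose F) *v b)"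
    unfolding b'_def symmetric_form_add[OF symmetric_matrices(2)]
    using inner_matrix_vector_adjoint[of "transpose H *v d" "\<Sigma> t" "transpose F *v b"] symmetric_matrices(2)[of t]
    by (simp add: inner_sandwich inner_commute)
  have 2: "wv_form (transpose G *v b) d = b \<bullet> ((G ** W ** transpose G) *v b) + 2 * (b \<bullet> ((G ** L) *v d)) + d \<bullet> (V *v d)"
    using inner_matrix_vector_adjoint[of b G] unfolding wv_form_def inner_sandwich
    by (simp add: matrix_vector_mul_assoc[symmetric])
  have 3: "a \<bullet> (\<Psi> t *v a) = ?k \<bullet> (\<Psi> t *v ?k) + 2 * (?k \<bullet> (\<Psi> t *v d)) + d \<bullet> (\<Psi> t *v d)"
    unfolding a by (rule symmetric_form_add[OF symmetric_matrices(3)])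
  \<comment> \<open>The gain in product form supplies exactly the cross terms between
    \<open>b\<close> and \<open>d\<close>; this is what decorrelates the innovation from the next
    state error.\<close>
  have 4: "?k \<bullet> (\<Psi> t *v d) = b \<bullet> ((F ** \<Sigma> t ** transpose H) *v d) + b \<bullet> ((G ** L) *v d)"
    using inner_matrix_vector_adjoint[of b "Kp t" "\<Psi> t *v d"] 
    by (simp add: matrix_vector_mul_assoc gain_mult matrix_vector_mult_add_rdistrib inner_add_right)
  have 5: "b \<bullet> (\<Sigma> (Suc t) *v b) = b \<bullet> ((F ** \<Sigma> t ** transpose F) *v b) + b \<bullet> ((G ** W ** transpose G) *v b) - ?k \<bullet> (\<Psi> t *v ?k)"
    unfolding riccati(1) matrix_vector_mult_diff_rdistrib matrix_vector_mult_add_rdistrib inner_diff_right inner_add_right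
    by (simp only: inner_sandwich[of b "Kp t"])
  have 6: "d \<bullet> (\<Psi> t *v d) = d \<bullet> ((H ** \<Sigma> t ** transpose H) *v d) + d \<bullet> (V *v d)"
    unfolding riccati(3)[of t] by (simp add: matrix_vector_mult_add_rdistrib inner_add_right)
  show ?thesis unfolding 1 2 3 4 5 6 by simp
qed

text \<open>Induction on the number of innovations: each step trades the last innovation and the
  state error after it for the state error before it and one more noise pair, and
  \<open>riccati_form\<close> says that the exponent is preserved. Noises not yet consumed stay in
  the sum, so the recursion ends at the primitive formula. Independence results from the absence of
  cross terms in the exponent.\<close>

lemma iexp_integral_innov:
  "n \<le> N \<Longrightarrow>
    (CLINT \<omega>|M. iexp ((\<Sum>j<n. a j \<bullet> innov j \<omega>) + b \<bullet> state_error n \<omega> + (\<Sum>j\<in>{n..<N}. c j \<bullet> w j \<omega> + d j \<bullet> v j \<omega>)))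
    = exp (- ((\<Sum>j<n. a j \<bullet> (\<Psi> j *v a j)) + b \<bullet> (\<Sigma> n *v b) + (\<Sum>j\<in>{n..<N}. wv_form (c j) (d j))) / 2)"
proof (induction n arbitrary: b c d)
  case 0
  show ?case using iexp_integral_primitive[of b c d N] by (simp add: state_error_0 atLeast0LessThan)
next
  case (Suc n)
  define dn where "dn = a n - transpose (Kp n) *v b"
  define b' where "b' = transpose H *v dn + transpose F *v b"
  define c' where "c' = c(n := transpose G *v b)"
  define d' where "d' = d(n := dn)"
  have split: "{n..<N} = insert n {Suc n..<N}" using Suc.prems by auto
  have rest: "(\<Sum>j\<in>{Suc n..<N}. f (c' j) (d' j) j) = (\<Sum>j\<in>{Suc n..<N}. f (c j) (d j) j)" for f :: "_ \<Rightarrow> _ \<Rightarrow> _ \<Rightarrow> real"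
    by (intro sum.cong) (auto simp: c'_def d'_def)
  have lin: "a n \<bullet> innov n \<omega> + b \<bullet> state_error (Suc n) \<omega>
     = b' \<bullet> state_error n \<omega> + ((transpose G *v b) \<bullet> w n \<omega> + dn \<bullet> v n \<omega>)" for \<omega>
  proof -
    have "a n \<bullet> innov n \<omega> + b \<bullet> state_error (Suc n) \<omega> = dn \<bullet> innov n \<omega> + b \<bullet> (F *v state_error n \<omega>) + b \<bullet> (G *v w n \<omega>)"
      using inner_matrix_vector_adjoint[of b "Kp n" "innov n \<omega>"]
      by (simp add: state_error_Suc dn_def inner_diff_left inner_diff_right inner_add_right)
    also have "\<dots> = b' \<bullet> state_error n \<omega> + ((transpose G *v b) \<bullet> w n \<omega> + dn \<bullet> v n \<omega>)"
      using inner_matrix_vector_adjoint[of b F] inner_matrix_vector_adjoint[of b G] inner_matrix_vector_adjoint[of dn H]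
      by (simp add: innov_eq b'_def inner_add_left inner_add_right)
    finally show ?thesis .
  qed
  have e1: "(\<Sum>j<Suc n. a j \<bullet> innov j \<omega>) + b \<bullet> state_error (Suc n) \<omega> + (\<Sum>j\<in>{Suc n..<N}. c j \<bullet> w j \<omega> + d j \<bullet> v j \<omega>)
     = (\<Sum>j<n. a j \<bullet> innov j \<omega>) + b' \<bullet> state_error n \<omega> + (\<Sum>j\<in>{n..<N}. c' j \<bullet> w j \<omega> + d' j \<bullet> v j \<omega>)" for \<omega>
    unfolding split using lin[of \<omega>] rest[of "\<lambda>c d j. c \<bullet> w j \<omega> + d \<bullet> v j \<omega>"] by (simp add: c'_def d'_def)
  have e2: "(\<Sum>j<Suc n. a j \<bullet> (\<Psi> j *v a j)) + b \<bullet> (\<Sigma> (Suc n) *v b) + (\<Sum>j\<in>{Suc n..<N}. wv_form (c j) (d j))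
     = (\<Sum>j<n. a j \<bullet> (\<Psi> j *v a j)) + b' \<bullet> (\<Sigma> n *v b') + (\<Sum>j\<in>{n..<N}. wv_form (c' j) (d' j))"
    unfolding split using riccati_form[where a="a n" and b=b and t=n] rest[of "\<lambda>c d j. wv_form c d"]
    by (simp add: c'_def d'_def b'_def dn_def)
  show ?case unfolding e1 e2 using Suc.prems by (intro Suc.IH) simp
qed

lemma innov_measurable [measurable]: "innov t \<in> borel_measurable M"
proof -
  have [measurable]: "state_error t \<in> borel_measurable M" for t
  proof (induction t)
    case 0 then show ?case by (simp add: state_error_0 cong: measurable_cong)
  next
    case (Suc t)
    note [measurable] = Suc
    have "(\<lambda>\<omega>. F *v state_error t \<omega> + G *v w t \<omega> - Kp t *v (H *v state_error t \<omega> + v t \<omega>)) \<in> borel_measurable M" by measurable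
    then show ?case by (simp add: state_error_Suc innov_eq cong: measurable_cong)
  qed
  have "(\<lambda>\<omega>. H *v state_error t \<omega> + v t \<omega>) \<in> borel_measurable M" by measurable
  then show ?thesis by (simp add: innov_eq cong: measurable_cong)
qed

abbreviation innov_law :: "nat \<Rightarrow> (real^'p) measure" where
  "innov_law i \<equiv> density lborel (gauss (\<Psi> i))"

text \<open>The joint characteristic function factors into those of centred normal laws with
  covariances \<open>\<Psi> i\<close>, hence the innovations are independent with these
  laws.\<close>

theorem distr_innov:
  "distr M (\<Pi>\<^sub>M i\<in>{..<n}. borel) (\<lambda>\<omega>. \<lambda>i\<in>{..<n}. innov i \<omega>) = (\<Pi>\<^sub>M i\<in>{..<n}. innov_law i)"
proof (rule PiM_finite_measure_eqI_iexp)
  interpret N: product_prob_space innov_law "{..<n}"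
    by (intro product_prob_space.intro product_sigma_finite.intro product_prob_space_axioms.intro prob_space_imp_sigma_finite prob_space_gauss innovations)
  have "prob_space (\<Pi>\<^sub>M i\<in>{..<n}. innov_law i)" by (intro prob_space_PiM prob_space_gauss innovations)
  then show "finite_measure (\<Pi>\<^sub>M i\<in>{..<n}. innov_law i)" by (rule prob_space.finite_measure)
  show "finite_measure (distr M (\<Pi>\<^sub>M i\<in>{..<n}. borel) (\<lambda>\<omega>. \<lambda>i\<in>{..<n}. innov i \<omega>))"
    by (rule finite_measure_distr) measurable
  show "sets (\<Pi>\<^sub>M i\<in>{..<n}. innov_law i) = sets (\<Pi>\<^sub>M i\<in>{..<n}. borel)" by (intro sets_PiM_cong) auto
  fix t :: "nat \<Rightarrow> real^'p"
  have "(CLINT x|distr M (\<Pi>\<^sub>M i\<in>{..<n}. borel) (\<lambda>\<omega>. \<lambda>i\<in>{..<n}. innov i \<omega>). iexp (\<Sum>i<n. t i \<bullet> x i))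
      = (CLINT \<omega>|M. iexp (\<Sum>i<n. t i \<bullet> innov i \<omega>))"
    by (subst integral_distr) (auto simp del: of_real_sum)
  \<comment> \<open>Taking \<open>N = n\<close> and \<open>b = 0\<close> leaves neither unconsumed
    noises nor a state error.\<close>
  also have "\<dots> = exp (- (\<Sum>i<n. t i \<bullet> (\<Psi> i *v t i)) / 2)"
    using iexp_integral_innov[where n=n and N=n and a=t and b=0] by simp
  also have "\<dots> = (\<Prod>i<n. complex_of_real (exp (- (t i \<bullet> (\<Psi> i *v t i)) / 2)))"
    by (simp add: exp_sum[symmetric] sum_negf sum_divide_distrib flip: of_real_prod)
  also have "\<dots> = (\<Prod>i<n. CLINT x|innov_law i. iexp (t i \<bullet> x))"
    by (simp add: iexp_integral_gauss[OF innovations])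
  also have "\<dots> = (CLINT x|(\<Pi>\<^sub>M i\<in>{..<n}. innov_law i). (\<Prod>i<n. iexp (t i \<bullet> x i)))"
  proof (rule N.product_integral_prod[symmetric])
    fix i
  
    show "integrable (innov_law i) (\<lambda>x. iexp (t i \<bullet> x))" by (rule prob_space.integrable_iexp[OF prob_space_gauss[OF innovations]]) auto
  qed simp
  also have "\<dots> = (CLINT x|(\<Pi>\<^sub>M i\<in>{..<n}. innov_law i). iexp (\<Sum>i<n. t i \<bullet> x i))"
    by (simp add: exp_sum sum_distrib_left)
  finally show "(CLINT x|distr M (\<Pi>\<^sub>M i\<in>{..<n}. borel) (\<lambda>\<omega>. \<lambda>i\<in>{..<n}. innov i \<omega>). iexp (\<Sum>i<n. t i \<bullet> x i))
    = (CLINT x|(\<Pi>\<^sub>M i\<in>{..<n}. innov_law i). iexp (\<Sum>i<n. t i \<bullet> x i))" .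
qed (simp_all)

end

section \<open>Densities of sequences with Gaussian innovations\<close>

lemma kalman_measurable:
  assumes "\<And>j. j < t \<Longrightarrow> (\<lambda>\<omega>. y \<omega> j) \<in> borel_measurable N"
  shows "(\<lambda>\<omega>. kalman F H K (y \<omega>) t) \<in> borel_measurable N"
  using assms
proof (induction t)
  case (Suc t)
  from Suc.IH Suc.prems have [measurable]: "(\<lambda>\<omega>. kalman F H K (y \<omega>) t) \<in> borel_measurable N" by simp
  from Suc.prems have [measurable]: "(\<lambda>\<omega>. y \<omega> t) \<in> borel_measurable N" by simp
  show ?case by simp measurable
qed simp

lemma nn_integral_lborel_translate:
  fixes f :: "'a::euclidean_space \<Rightarrow> ennreal"
  assumes [measurable]: "f \<in> borel_measurable borel"
  shows "(\<integral>\<^sup>+x. f (c + x) \<partial>lborel) = (\<integral>\<^sup>+x. f x \<partial>lborel)"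
proof -
  have "(\<integral>\<^sup>+x. f x \<partial>lborel) = (\<integral>\<^sup>+x. f x \<partial>distr lborel borel ((+) c))"
    by (simp only: lborel_distr_plus)
  also have "\<dots> = (\<integral>\<^sup>+x. f (c + x) \<partial>lborel)" by (subst nn_integral_distr) auto
  finally show ?thesis ..
qed

lemma nn_integral_gauss_shift:
  assumes [measurable]: "f \<in> borel_measurable borel"
  shows "(\<integral>\<^sup>+q. f (c + q) \<partial>density lborel (gauss A)) = (\<integral>\<^sup>+u. f u * ennreal (gauss A (u - c)) \<partial>lborel)"
proof -
  have "(\<integral>\<^sup>+q. f (c + q) \<partial>density lborel (gauss A)) = (\<integral>\<^sup>+q. (\<lambda>u. ennreal (gauss A (u - c)) * f u) (c + q) \<partial>lborel)"
    by (subst nn_integral_density) auto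
  also have "\<dots> = (\<integral>\<^sup>+u. ennreal (gauss A (u - c)) * f u \<partial>lborel)"
    by (rule nn_integral_lborel_translate) measurable
  finally show ?thesis by (simp add: mult.commute)
qed

text \<open>The density of a sequence whose prediction errors under the filter are independent
  centred normal with covariances \<open>\<Omega> j\<close>. It serves as the true density of the
  noise and as the comparison density for the outputs.\<close>

definition seq_gauss ::
  "real^'d^'d \<Rightarrow> real^'d^'p \<Rightarrow> (nat \<Rightarrow> real^'p^'d) \<Rightarrow> (nat \<Rightarrow> real^'p^'p) \<Rightarrow> nat \<Rightarrow> (nat \<Rightarrow> real^'p) \<Rightarrow> real" where
  "seq_gauss F H K \<Omega> n y = (\<Prod>j<n. gauss (\<Omega> j) (y j - H *v kalman F H K y j))"

lemma seq_gauss_measurable [measurable]: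
  "seq_gauss F H K \<Omega> n \<in> borel_measurable (\<Pi>\<^sub>M i\<in>{..<n}. borel)"
  unfolding seq_gauss_def
proof (intro borel_measurable_prod)
  fix j assume j: "j \<in> {..<n}"
  have [measurable]: "(\<lambda>y. y j) \<in> borel_measurable (\<Pi>\<^sub>M i\<in>{..<n}. borel)"
    using j by (rule measurable_component_singleton)
  have [measurable]: "(\<lambda>y. kalman F H K y j) \<in> borel_measurable (\<Pi>\<^sub>M i\<in>{..<n}. borel)"
    using j by (intro kalman_measurable measurable_component_singleton) auto
  show "(\<lambda>y. gauss (\<Omega> j) (y j - H *v kalman F H K y j)) \<in> borel_measurable (\<Pi>\<^sub>M i\<in>{..<n}. borel)"
    by measurable
qed

lemma seq_gauss_pos: "(\<And>j. j < n \<Longrightarrow> pos_def (\<Omega> j)) \<Longrightarrow> 0 < seq_gauss F H K \<Omega> n y"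
  unfolding seq_gauss_def by (intro prod_pos) (auto simp: gauss_pos)

lemma sets_PiM_lborel: "sets (\<Pi>\<^sub>M i\<in>I. lborel) = sets (\<Pi>\<^sub>M i\<in>I. borel)"
  by (intro sets_PiM_cong) auto

lemma PiM_lborel_borel_measurable:
  "borel_measurable (\<Pi>\<^sub>M i\<in>I. lborel) = borel_measurable (\<Pi>\<^sub>M i\<in>I. borel)"
  by (intro measurable_cong_sets sets_PiM_lborel refl)

lemma seq_gauss_Suc:
  "seq_gauss F H K \<Omega> (Suc n) (y(n := u)) = seq_gauss F H K \<Omega> n y * gauss (\<Omega> n) (u - H *v kalman F H K y n)"
proof -
  have "kalman F H K (y(n := u)) j = kalman F H K y j" if "j \<le> n" for j
    using that by (intro kalman_cong) auto
  then show ?thesis by (simp add: seq_gauss_def)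
qed

lemma nn_integral_seq_gauss:
  fixes H :: "real^'d^'p"
  assumes "\<And>j. j < n \<Longrightarrow> pos_def (\<Omega> j)"
  shows "(\<integral>\<^sup>+y. ennreal (seq_gauss F H K \<Omega> n y) \<partial>(\<Pi>\<^sub>M i\<in>{..<n}. lborel)) = 1"
  using assms
proof (induction n)
  case 0
  show ?case by (simp add: seq_gauss_def PiM_empty nn_integral_return nn_integral_count_space_finite)
next
  case (Suc n)
  interpret L: product_sigma_finite "\<lambda>_::nat. lborel :: (real^'p) measure" by standard
  have pd: "pos_def (\<Omega> n)" using Suc.prems by simp
  have one: "(\<integral>\<^sup>+u. ennreal (gauss (\<Omega> n) (u - c)) \<partial>lborel) = 1" for c
    using prob_space.emeasure_space_1[OF prob_space_gauss[OF pd]] nn_integral_gauss_shift[where f="\<lambda>_. 1" and c=c and A="\<Omega> n"] by simp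
  have "(\<integral>\<^sup>+y. ennreal (seq_gauss F H K \<Omega> (Suc n) y) \<partial>(\<Pi>\<^sub>M i\<in>{..<Suc n}. lborel))
      = (\<integral>\<^sup>+y. (\<integral>\<^sup>+u. ennreal (seq_gauss F H K \<Omega> (Suc n) (y(n := u))) \<partial>lborel) \<partial>(\<Pi>\<^sub>M i\<in>{..<n}. lborel))"
    unfolding lessThan_Suc by (rule L.product_nn_integral_insert)
      (auto simp: PiM_lborel_borel_measurable simp flip: lessThan_Suc intro!: measurable_compose[OF seq_gauss_measurable])
  also have "\<dots> = (\<integral>\<^sup>+y. ennreal (seq_gauss F H K \<Omega> n y) \<partial>(\<Pi>\<^sub>M i\<in>{..<n}. lborel))"
  proof (rule nn_integral_cong)
    fix y :: "nat \<Rightarrow> real^'p"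
    have "0 \<le> seq_gauss F H K \<Omega> n y" using Suc.prems by (intro less_imp_le seq_gauss_pos) auto
    then show "(\<integral>\<^sup>+u. ennreal (seq_gauss F H K \<Omega> (Suc n) (y(n := u))) \<partial>lborel) = ennreal (seq_gauss F H K \<Omega> n y)"
      unfolding seq_gauss_Suc using gauss_pos[OF pd]
      by (simp add: ennreal_mult less_imp_le nn_integral_cmult one)
  qed
  finally show ?case using Suc by simp
qed

text \<open>The same filter driven by its innovations instead of the observations; it expresses the
  noise as a function of the innovations.\<close>

primrec unroll :: "real^'d^'d \<Rightarrow> (nat \<Rightarrow> real^'p^'d) \<Rightarrow> (nat \<Rightarrow> real^'p) \<Rightarrow> nat \<Rightarrow> real^'d" where
  "unroll F K p 0 = 0"
| "unroll F K p (Suc t) = F *v unroll F K p t + K t *v p t"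

lemma unroll_cong: "(\<And>j. j < t \<Longrightarrow> p j = p' j) \<Longrightarrow> unroll F K p t = unroll F K p' t"
  by (induction t) auto

lemma unroll_measurable:
  assumes "\<And>j. j < t \<Longrightarrow> (\<lambda>\<omega>. p \<omega> j) \<in> borel_measurable N"
  shows "(\<lambda>\<omega>. unroll F K (p \<omega>) t) \<in> borel_measurable N"
  using assms
proof (induction t)
  case (Suc t)
  from Suc.IH Suc.prems have [measurable]: "(\<lambda>\<omega>. unroll F K (p \<omega>) t) \<in> borel_measurable N" by simp
  from Suc.prems have [measurable]: "(\<lambda>\<omega>. p \<omega> t) \<in> borel_measurable N" by simp
  show ?case by simp measurable
qed simp

section \<open>Law of the noise sequence\<close>

context state_space_noise
begin

lemma kalman_eq_unroll: "kalman F H Kp (\<lambda>j. z j \<omega>) t = unroll F Kp (\<lambda>j. innov j \<omega>) t"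
  by (induction t) (auto simp: innov_def)

lemma noise_eq: "z t \<omega> = H *v kalman F H Kp (\<lambda>j. z j \<omega>) t + innov t \<omega>"
  by (simp add: innov_def)

lemma sigma_finite_innov_law: "product_sigma_finite innov_law"
  by (intro product_sigma_finite.intro prob_space_imp_sigma_finite prob_space_gauss innovations)

text \<open>Independence in integral form: under the product law, the last innovation may be
  replaced by a fresh variable \<open>q\<close> that is integrated on its own.\<close>

lemma innov_indep:
  assumes \<Phi>[measurable]: "case_prod \<Phi> \<in> borel_measurable ((\<Pi>\<^sub>M j\<in>{..<i}. borel) \<Otimes>\<^sub>M borel)"
  shows "(\<integral>\<^sup>+\<omega>. \<Phi> (\<lambda>j\<in>{..<i}. innov j \<omega>) (innov i \<omega>) \<partial>M)
    = (\<integral>\<^sup>+\<omega>. \<integral>\<^sup>+q. \<Phi> (\<lambda>j\<in>{..<i}. innov j \<omega>) q \<partial>innov_law i \<partial>M)"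
proof -
  interpret N: product_sigma_finite innov_law by (rule sigma_finite_innov_law)
  let ?B = "\<lambda>k. (\<Pi>\<^sub>M j\<in>{..<k}. borel) :: (nat \<Rightarrow> real^'p) measure"
  have sets: "sets (\<Pi>\<^sub>M j\<in>I. innov_law j) = sets (\<Pi>\<^sub>M j\<in>I. borel)" for I by (intro sets_PiM_cong) auto
  define f where "f P = \<Phi> (restrict P {..<i}) (P i)" for P :: "nat \<Rightarrow> real^'p"
  have 1: "(\<lambda>P. restrict P {..<i}) \<in> ?B (Suc i) \<rightarrow>\<^sub>M ?B i" by (rule measurable_restrict_subset) auto
  have 2: "(\<lambda>P. P i) \<in> ?B (Suc i) \<rightarrow>\<^sub>M borel" by (rule measurable_component_singleton) auto
  have fm: "f \<in> borel_measurable (?B (Suc i))"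
    unfolding f_def using measurable_compose[OF measurable_Pair[OF 1 2] \<Phi>] by simp
  have pm[measurable]: "(\<lambda>\<omega>. \<lambda>j\<in>{..<k}. innov j \<omega>) \<in> M \<rightarrow>\<^sub>M ?B k" for k by measurable
  have "(\<integral>\<^sup>+\<omega>. \<Phi> (\<lambda>j\<in>{..<i}. innov j \<omega>) (innov i \<omega>) \<partial>M) = (\<integral>\<^sup>+\<omega>. f (\<lambda>j\<in>{..<Suc i}. innov j \<omega>) \<partial>M)"
    by (simp add: f_def cong: restrict_cong)
  also have "\<dots> = (\<integral>\<^sup>+P. f P \<partial>distr M (?B (Suc i)) (\<lambda>\<omega>. \<lambda>j\<in>{..<Suc i}. innov j \<omega>))"
    using fm by (intro nn_integral_distr[symmetric] pm) simp
  also have "\<dots> = (\<integral>\<^sup>+P. f P \<partial>(\<Pi>\<^sub>M j\<in>insert i {..<i}. innov_law j))"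
    by (simp only: distr_innov lessThan_Suc[symmetric])
  also have "\<dots> = (\<integral>\<^sup>+p. \<integral>\<^sup>+q. f (p(i := q)) \<partial>innov_law i \<partial>(\<Pi>\<^sub>M j\<in>{..<i}. innov_law j))"
    using fm by (intro N.product_nn_integral_insert) (auto simp: measurable_cong_sets[OF sets refl] simp flip: lessThan_Suc)
  also have "\<dots> = (\<integral>\<^sup>+p. \<integral>\<^sup>+q. \<Phi> p q \<partial>innov_law i \<partial>(\<Pi>\<^sub>M j\<in>{..<i}. innov_law j))"
  proof (intro nn_integral_cong)
    fix p :: "nat \<Rightarrow> real^'p" and q assume "p \<in> space (\<Pi>\<^sub>M j\<in>{..<i}. innov_law j)"
    then have "restrict (p(i := q)) {..<i} = p" by (auto simp: space_PiM PiE_def extensional_def fun_eq_iff)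
    then show "f (p(i := q)) = \<Phi> p q" by (simp add: f_def)
  qed
  also have "\<dots> = (\<integral>\<^sup>+\<omega>. \<integral>\<^sup>+q. \<Phi> (\<lambda>j\<in>{..<i}. innov j \<omega>) q \<partial>innov_law i \<partial>M)"
    unfolding distr_innov[symmetric] by (subst nn_integral_distr) (auto intro!: N.M.borel_measurable_nn_integral)
  finally show ?thesis .
qed

lemma noise_indep:
  assumes \<Phi>[measurable]: "case_prod \<Phi> \<in> borel_measurable ((\<Pi>\<^sub>M j\<in>{..<i}. borel) \<Otimes>\<^sub>M borel)"
  shows "(\<integral>\<^sup>+\<omega>. \<Phi> (\<lambda>j\<in>{..<i}. z j \<omega>) (innov i \<omega>) \<partial>M)
    = (\<integral>\<^sup>+\<omega>. \<integral>\<^sup>+q. \<Phi> (\<lambda>j\<in>{..<i}. z j \<omega>) q \<partial>innov_law i \<partial>M)"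
proof -
  let ?B = "(\<Pi>\<^sub>M j\<in>{..<i}. borel) :: (nat \<Rightarrow> real^'p) measure"
  \<comment> \<open>The triangular map from past innovations to past noise. It transports the
    independence statement from the former to the latter.\<close>
  define T where "T p = (\<lambda>j\<in>{..<i}. H *v unroll F Kp p j + p j)" for p :: "nat \<Rightarrow> real^'p"
  have T: "T \<in> ?B \<rightarrow>\<^sub>M ?B"
    unfolding T_def
  proof (rule measurable_restrict)
    fix j assume j: "j \<in> {..<i}"
    have [measurable]: "(\<lambda>p. p j) \<in> borel_measurable ?B" using j by (rule measurable_component_singleton)
    have [measurable]: "(\<lambda>p. unroll F Kp p j) \<in> borel_measurable ?B"
      using j by (intro unroll_measurable measurable_component_singleton) auto
    show "(\<lambda>p. H *v unroll F Kp p j + p j) \<in> borel_measurable ?B" by measurable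
  qed
  have Tz: "T (\<lambda>j\<in>{..<i}. innov j \<omega>) = (\<lambda>j\<in>{..<i}. z j \<omega>)" for \<omega>
    unfolding T_def
  proof (rule restrict_ext)
    fix j assume j: "j \<in> {..<i}"
    have "unroll F Kp (\<lambda>j\<in>{..<i}. innov j \<omega>) j = unroll F Kp (\<lambda>j. innov j \<omega>) j"
      using j by (intro unroll_cong) auto
    then show "H *v unroll F Kp (\<lambda>j\<in>{..<i}. innov j \<omega>) j + (\<lambda>j\<in>{..<i}. innov j \<omega>) j = z j \<omega>"
      using j noise_eq[of j \<omega>] by (simp add: kalman_eq_unroll)
  qed
  have "(\<lambda>(p, q). \<Phi> (T p) q) \<in> borel_measurable (?B \<Otimes>\<^sub>M borel)"
    using measurable_compose[OF measurable_Pair[OF measurable_compose[OF measurable_fst T] measurable_snd] \<Phi>]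
    by (simp only: case_prod_unfold fst_conv snd_conv)
  from innov_indep[OF this] show ?thesis unfolding Tz .
qed

text \<open>Induction on the length: the next noise is its prediction from the past plus a fresh
  innovation, so it contributes one translated normal factor.\<close>

lemma nn_integral_noise:
  assumes "f \<in> borel_measurable (\<Pi>\<^sub>M j\<in>{..<i}. borel)"
  shows "(\<integral>\<^sup>+\<omega>. f (\<lambda>j\<in>{..<i}. z j \<omega>) \<partial>M) = (\<integral>\<^sup>+y. f y * ennreal (seq_gauss F H Kp \<Psi> i y) \<partial>(\<Pi>\<^sub>M j\<in>{..<i}. lborel))"
  using assms
proof (induction i arbitrary: f)
  case 0
  have "(\<lambda>j\<in>{}. z j \<omega>) = (\<lambda>_. undefined)" for \<omega> by auto
  then show ?case by (simp add: PiM_empty seq_gauss_def nn_integral_count_space_finite emeasure_space_1)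
next
  case (Suc i)
  interpret L: product_sigma_finite "\<lambda>_::nat. lborel :: (real^'p) measure" by standard
  note f = Suc.prems
  let ?B = "\<lambda>k. (\<Pi>\<^sub>M j\<in>{..<k}. borel) :: (nat \<Rightarrow> real^'p) measure"
  let ?k = "\<lambda>y. H *v kalman F H Kp y i"
  have km[measurable]: "(\<lambda>y. kalman F H Kp y i) \<in> borel_measurable (?B i)"
    by (intro kalman_measurable measurable_component_singleton) auto
  have upd: "(\<lambda>(y, u). y(i := u)) \<in> ?B i \<Otimes>\<^sub>M borel \<rightarrow>\<^sub>M ?B (Suc i)"
    unfolding lessThan_Suc by (rule measurable_add_dim)
  have fu: "(\<lambda>(y, u). f (y(i := u))) \<in> borel_measurable (?B i \<Otimes>\<^sub>M borel)"
    using measurable_compose[OF upd f] by (simp only: case_prod_unfold fst_conv snd_conv)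
  have sh: "(\<lambda>(y, q). (y, ?k y + q)) \<in> ?B i \<Otimes>\<^sub>M borel \<rightarrow>\<^sub>M ?B i \<Otimes>\<^sub>M borel" by measurable
  have fs: "(\<lambda>(y, q). f (y(i := ?k y + q))) \<in> borel_measurable (?B i \<Otimes>\<^sub>M borel)"
    using measurable_compose[OF sh fu] by (simp only: case_prod_unfold fst_conv snd_conv)
  have "(\<integral>\<^sup>+\<omega>. f (\<lambda>j\<in>{..<Suc i}. z j \<omega>) \<partial>M)
      = (\<integral>\<^sup>+\<omega>. (\<lambda>y q. f (y(i := ?k y + q))) (\<lambda>j\<in>{..<i}. z j \<omega>) (innov i \<omega>) \<partial>M)"
  proof (intro nn_integral_cong arg_cong[where f=f])
    fix \<omega>
    have "kalman F H Kp (\<lambda>j\<in>{..<i}. z j \<omega>) i = kalman F H Kp (\<lambda>j. z j \<omega>) i" by (intro kalman_cong) auto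
    then show "(\<lambda>j\<in>{..<Suc i}. z j \<omega>) = (\<lambda>j\<in>{..<i}. z j \<omega>)(i := ?k (\<lambda>j\<in>{..<i}. z j \<omega>) + innov i \<omega>)"
      using noise_eq[of i \<omega>] by (auto simp: fun_eq_iff restrict_def)
  qed
  also have "\<dots> = (\<integral>\<^sup>+\<omega>. (\<lambda>y. \<integral>\<^sup>+q. f (y(i := ?k y + q)) \<partial>innov_law i) (\<lambda>j\<in>{..<i}. z j \<omega>) \<partial>M)"
    by (rule noise_indep[OF fs])
  also have "\<dots> = (\<integral>\<^sup>+y. (\<integral>\<^sup>+q. f (y(i := ?k y + q)) \<partial>innov_law i) * ennreal (seq_gauss F H Kp \<Psi> i y) \<partial>(\<Pi>\<^sub>M j\<in>{..<i}. lborel))"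
  proof (rule Suc.IH)
    interpret Ni: prob_space "innov_law i" by (rule prob_space_gauss[OF innovations])
    show "(\<lambda>y. \<integral>\<^sup>+q. f (y(i := ?k y + q)) \<partial>innov_law i) \<in> borel_measurable (?B i)"
      using fs by (intro Ni.borel_measurable_nn_integral) (simp cong: measurable_cong_sets)
  qed
  also have "\<dots> = (\<integral>\<^sup>+y. \<integral>\<^sup>+u. f (y(i := u)) * ennreal (seq_gauss F H Kp \<Psi> (Suc i) (y(i := u))) \<partial>lborel \<partial>(\<Pi>\<^sub>M j\<in>{..<i}. lborel))"
  proof (rule nn_integral_cong)
    fix y :: "nat \<Rightarrow> real^'p" assume "y \<in> space (\<Pi>\<^sub>M j\<in>{..<i}. lborel)"
    then have "y \<in> space (?B i)" by (simp add: space_PiM)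
    then have fy[measurable]: "(\<lambda>u. f (y(i := u))) \<in> borel_measurable borel"
      using measurable_compose[OF measurable_Pair1' fu] by simp
    have "0 \<le> seq_gauss F H Kp \<Psi> i y" using innovations by (intro less_imp_le seq_gauss_pos)
    moreover have "0 \<le> gauss (\<Psi> i) x" for x using gauss_pos[OF innovations] by (rule less_imp_le)
    ultimately show "(\<integral>\<^sup>+q. f (y(i := ?k y + q)) \<partial>innov_law i) * ennreal (seq_gauss F H Kp \<Psi> i y)
       = (\<integral>\<^sup>+u. f (y(i := u)) * ennreal (seq_gauss F H Kp \<Psi> (Suc i) (y(i := u))) \<partial>lborel)"
      unfolding seq_gauss_Suc nn_integral_gauss_shift[OF fy]
      by (subst nn_integral_multc[symmetric]) (auto simp: ennreal_mult mult_ac intro!: nn_integral_cong)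
  qed
  also have "\<dots> = (\<integral>\<^sup>+y. f y * ennreal (seq_gauss F H Kp \<Psi> (Suc i) y) \<partial>(\<Pi>\<^sub>M j\<in>{..<Suc i}. lborel))"
    unfolding lessThan_Suc using f seq_gauss_measurable[of F H Kp \<Psi> "Suc i"]
    by (intro L.product_nn_integral_insert[symmetric])
       (auto simp: PiM_lborel_borel_measurable simp flip: lessThan_Suc)
  finally show ?case .
qed

end

section \<open>Histories under a policy\<close>

text \<open>One step with the noise value \<open>u\<close> as an argument, so that joint
  measurability in history and noise can be stated.\<close>

definition history_step ::
  "real^'m^'p \<Rightarrow> ('m::finite, 'p::finite) policy \<Rightarrow> nat \<Rightarrow> (nat \<Rightarrow> (real^'m) \<times> (real^'p)) \<Rightarrow> real^'p
    \<Rightarrow> (nat \<Rightarrow> (real^'m) \<times> (real^'p)) measure" where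
  "history_step \<Lambda> \<kappa> i h u = \<kappa> i h \<bind> (\<lambda>x. return (history_space (Suc i)) (h(i := (x, \<Lambda> *v x + u))))"

lemma history_law_Suc_step:
  "history_law \<Lambda> \<kappa> z (Suc i) = history_law \<Lambda> \<kappa> z i \<bind> (\<lambda>h. history_step \<Lambda> \<kappa> i h (z i))"
  by (simp add: history_step_def)

lemma history_law_cong: "(\<And>j. j < i \<Longrightarrow> z j = z' j) \<Longrightarrow> history_law \<Lambda> \<kappa> z i = history_law \<Lambda> \<kappa> z' i"
  by (induction i) auto

lemma policy_measurable: "policy n \<kappa> \<Longrightarrow> i < n \<Longrightarrow> \<kappa> i \<in> history_space i \<rightarrow>\<^sub>M prob_algebra borel"
  by (simp add: policy_def)

lemma policy_sets:
  assumes "policy n \<kappa>" "i < n" "h \<in> space (history_space i)"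
  shows "sets (\<kappa> i h) = sets borel" "prob_space (\<kappa> i h)"
  using measurable_space[OF policy_measurable[OF assms(1,2)] assms(3)] by (auto simp: space_prob_algebra)

lemma history_upd_measurable:
  fixes \<Lambda> :: "real^'m^'p"
  shows "(\<lambda>((h, u), x). h(i := (x, \<Lambda> *v x + u))) \<in> (history_space i \<Otimes>\<^sub>M borel) \<Otimes>\<^sub>M borel \<rightarrow>\<^sub>M history_space (Suc i)"
  unfolding case_prod_unfold
  by (rule measurable_fun_upd[where J="{..<i}"]) (auto simp: lessThan_Suc, measurable)

lemma history_step_measurable:
  assumes "policy n \<kappa>" "i < n"
  shows "(\<lambda>(h, u). history_step \<Lambda> \<kappa> i h u) \<in> history_space i \<Otimes>\<^sub>M borel \<rightarrow>\<^sub>M prob_algebra (history_space (Suc i))"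
  unfolding history_step_def case_prod_unfold
proof (rule measurable_bind_prob_space2)
  show "(\<lambda>p. \<kappa> i (fst p)) \<in> history_space i \<Otimes>\<^sub>M borel \<rightarrow>\<^sub>M prob_algebra borel"
    by (rule measurable_compose[OF measurable_fst policy_measurable[OF assms]])
  show "(\<lambda>(p, x). return (history_space (Suc i)) ((fst p)(i := (x, \<Lambda> *v x + snd p))))
      \<in> (history_space i \<Otimes>\<^sub>M borel) \<Otimes>\<^sub>M borel \<rightarrow>\<^sub>M prob_algebra (history_space (Suc i))"
    using measurable_compose[OF history_upd_measurable measurable_return_prob_space]
    by (simp only: case_prod_unfold fst_conv snd_conv)
qed

lemma history_law_measurable:
  assumes "policy n \<kappa>" "i \<le> n" "\<And>j. j < i \<Longrightarrow> (\<lambda>\<omega>. z \<omega> j) \<in> borel_measurable N"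
  shows "(\<lambda>\<omega>. history_law \<Lambda> \<kappa> (z \<omega>) i) \<in> N \<rightarrow>\<^sub>M prob_algebra (history_space i)"
  using assms(2,3)
proof (induction i)
  case 0
  have "return (history_space 0) (\<lambda>_. undefined) \<in> space (prob_algebra (history_space 0))"
    by (auto simp: space_prob_algebra space_PiM intro!: prob_space_return)
  then show ?case by simp
next
  case (Suc i)
  have [measurable]: "(\<lambda>\<omega>. z \<omega> i) \<in> borel_measurable N" using Suc.prems by simp
  have "(\<lambda>(\<omega>, h). (h, z \<omega> i)) \<in> N \<Otimes>\<^sub>M history_space i \<rightarrow>\<^sub>M history_space i \<Otimes>\<^sub>M borel" by measurable
  from measurable_compose[OF this history_step_measurable[OF assms(1), of i \<Lambda>]] Suc.prems
  have "(\<lambda>(\<omega>, h). history_step \<Lambda> \<kappa> i h (z \<omega> i)) \<in> N \<Otimes>\<^sub>M history_space i \<rightarrow>\<^sub>M prob_algebra (history_space (Suc i))"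
    by (simp add: case_prod_unfold)
  then show ?case unfolding history_law_Suc_step
    using Suc by (intro measurable_bind_prob_space2) auto
qed

text \<open>Measurability of a map on a one-point space says that its single value lies in the
  target, here the space of probability measures on histories.\<close>

lemma history_law_prob:
  assumes "policy n \<kappa>" "i \<le> n"
  shows "sets (history_law \<Lambda> \<kappa> z i) = sets (history_space i)" "prob_space (history_law \<Lambda> \<kappa> z i)"
  using measurable_space[OF history_law_measurable[OF assms, of "\<lambda>_::unit. z" "count_space UNIV"], of "()"]
  by (auto simp: space_prob_algebra)

lemma nn_integral_history_step:
  assumes "policy n \<kappa>" "i < n" "h \<in> space (history_space i)" "f \<in> borel_measurable (history_space (Suc i))"
  shows "(\<integral>\<^sup>+h'. f h' \<partial>history_step \<Lambda> \<kappa> i h u) = (\<integral>\<^sup>+x. f (h(i := (x, \<Lambda> *v x + u))) \<partial>\<kappa> i h)"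
proof -
  have m: "(\<lambda>x. h(i := (x, \<Lambda> *v x + u))) \<in> \<kappa> i h \<rightarrow>\<^sub>M history_space (Suc i)"
  proof -
    have "(\<lambda>x. ((h, u), x)) \<in> borel \<rightarrow>\<^sub>M (history_space i \<Otimes>\<^sub>M borel) \<Otimes>\<^sub>M borel"
      using assms(3) by (intro measurable_Pair1') (simp add: space_pair_measure)
    from measurable_compose[OF this history_upd_measurable[of i \<Lambda>]]
    show ?thesis by (simp cong: measurable_cong_sets add: policy_sets(1)[OF assms(1-3)])
  qed
  have k: "(\<lambda>x. return (history_space (Suc i)) (h(i := (x, \<Lambda> *v x + u)))) \<in> \<kappa> i h \<rightarrow>\<^sub>M subprob_algebra (history_space (Suc i))"
    by (rule measurable_compose[OF m return_measurable])
  show ?thesis unfolding history_step_def nn_integral_bind[OF assms(4) k]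
    using measurable_space[OF m] assms(4) by (intro nn_integral_cong) (simp add: nn_integral_return)
qed

lemma AE_history_law_noise:
  fixes \<Lambda> :: "real^'m^'p" and \<kappa> :: "('m, 'p) policy"
  assumes "policy n \<kappa>" "i \<le> n"
  shows "AE h in history_law \<Lambda> \<kappa> z i. \<forall>j<i. snd (h j) - \<Lambda> *v fst (h j) = z j"
  using assms(2)
proof (induction i)
  case (Suc i)
  define P where "P i h \<longleftrightarrow> (\<forall>j<i. snd (h j) - \<Lambda> *v fst (h j) = z j)" for i and h :: "nat \<Rightarrow> (real^'m) \<times> (real^'p)"
  have Pm[measurable]: "Measurable.pred (history_space i) (P i)" for i
  proof -
    have "Measurable.pred (history_space i) (\<lambda>h. snd (h j) - \<Lambda> *v fst (h j) = z j)" if "j < i" for j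
    proof -
      have [measurable]: "(\<lambda>h. h j) \<in> history_space i \<rightarrow>\<^sub>M borel \<Otimes>\<^sub>M borel"
        using that by (intro measurable_component_singleton) simp
      show ?thesis by measurable
    qed
    then have "Measurable.pred (history_space i) (\<lambda>h. \<forall>j\<in>{..<i}. snd (h j) - \<Lambda> *v fst (h j) = z j)"
      by (intro pred_intros_finite) auto
    then show ?thesis by (simp add: P_def[abs_def] Ball_def)
  qed
  have i: "i < n" using Suc.prems by simp
  have sets: "sets (history_law \<Lambda> \<kappa> z i) = sets (history_space i)" using history_law_prob[OF assms(1)] i by simp
  have k: "(\<lambda>h. history_step \<Lambda> \<kappa> i h (z i)) \<in> history_law \<Lambda> \<kappa> z i \<rightarrow>\<^sub>M subprob_algebra (history_space (Suc i))"
  proof -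
    have "(\<lambda>h. (h, z i)) \<in> history_space i \<rightarrow>\<^sub>M history_space i \<Otimes>\<^sub>M borel" by measurable
    from measurable_compose[OF this measurable_prob_algebraD[OF history_step_measurable[OF assms(1) i, of \<Lambda>]]]
    show ?thesis by (simp cong: measurable_cong_sets add: sets)
  qed
  have "AE h' in history_step \<Lambda> \<kappa> i h (z i). P (Suc i) h'" if "P i h" and h: "h \<in> space (history_space i)" for h
  proof -
    have m: "(\<lambda>h'. indicator {h. \<not> P (Suc i) h} h' :: ennreal) \<in> borel_measurable (history_space (Suc i))" by measurable
    have "P (Suc i) (h(i := (x, \<Lambda> *v x + z i)))" for x
      using that by (auto simp: P_def less_Suc_eq)
    then have "(\<integral>\<^sup>+h'. indicator {h. \<not> P (Suc i) h} h' \<partial>history_step \<Lambda> \<kappa> i h (z i)) = 0"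
      unfolding nn_integral_history_step[OF assms(1) i h m] by simp
    moreover have "sets (history_step \<Lambda> \<kappa> i h (z i)) = sets (history_space (Suc i))"
      using measurable_space[OF history_step_measurable[OF assms(1) i], of "(h, z i)"] h
      by (auto simp: space_prob_algebra space_pair_measure)
    then have "(\<lambda>h'. indicator {h. \<not> P (Suc i) h} h' :: ennreal) \<in> borel_measurable (history_step \<Lambda> \<kappa> i h (z i))"
      using m by (simp cong: measurable_cong_sets)
    ultimately have "AE h' in history_step \<Lambda> \<kappa> i h (z i). (indicator {h. \<not> P (Suc i) h} h' :: ennreal) = 0"
      by (simp add: nn_integral_0_iff_AE)
    then show ?thesis by (auto simp: indicator_def split: if_splits)
  qed
  note step = this
  have "AE h in history_law \<Lambda> \<kappa> z i. P i h" using Suc by (simp add: P_def)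
  moreover have "space (history_law \<Lambda> \<kappa> z i) = space (history_space i)" by (rule sets_eq_imp_space_eq[OF sets])
  ultimately have "AE h in history_law \<Lambda> \<kappa> z i. AE h' in history_step \<Lambda> \<kappa> i h (z i). P (Suc i) h'"
    using step by (elim AE_mp) (rule AE_I2, simp)
  then have "AE h in history_law \<Lambda> \<kappa> z (Suc i). P (Suc i) h"
    unfolding history_law_Suc_step by (subst AE_bind[OF k Pm]) 
  then show ?case by (simp add: P_def)
qed simp

section \<open>Conditional law of one channel use under feedback\<close>

locale feedback_channel = state_space_noise M F G H W V L s w v z \<Sigma> Kp \<Psi>
  for M :: "'w measure"
    and F :: "real^'d^'d" and G :: "real^'q^'d" and H :: "real^'d^'p"
    and W :: "real^'q^'q" and V :: "real^'p^'p" and L :: "real^'p^'q"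
    and s :: "nat \<Rightarrow> 'w \<Rightarrow> real^'d" and w :: "nat \<Rightarrow> 'w \<Rightarrow> real^'q"
    and v z :: "nat \<Rightarrow> 'w \<Rightarrow> real^'p"
    and \<Sigma> :: "nat \<Rightarrow> real^'d^'d" and Kp :: "nat \<Rightarrow> real^'p^'d" and \<Psi> :: "nat \<Rightarrow> real^'p^'p" +
  fixes \<Lambda> :: "real^'m^'p" and \<kappa> :: "('m, 'p) policy" and n :: nat
  assumes policy: "policy n \<kappa>"
begin

abbreviation J :: "nat \<Rightarrow> (nat \<Rightarrow> (real^'m) \<times> (real^'p)) measure" where
  "J i \<equiv> joint_law M z \<Lambda> i \<kappa>"

definition noise_of :: "(nat \<Rightarrow> (real^'m) \<times> (real^'p)) \<Rightarrow> nat \<Rightarrow> real^'p" where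
  "noise_of h j = snd (h j) - \<Lambda> *v fst (h j)"

definition predicted_state :: "nat \<Rightarrow> (nat \<Rightarrow> (real^'m) \<times> (real^'p)) \<Rightarrow> real^'d" where
  "predicted_state i h = kalman F H Kp (noise_of h) i"

lemma noise_kernel: "i \<le> n \<Longrightarrow> (\<lambda>\<omega>. history_law \<Lambda> \<kappa> (\<lambda>j. z j \<omega>) i) \<in> M \<rightarrow>\<^sub>M prob_algebra (history_space i)"
  by (rule history_law_measurable[OF policy]) auto

lemma joint_law_prob:
  assumes "i \<le> n" shows "sets (J i) = sets (history_space i)" "prob_space (J i)"
proof -
  have "J i \<in> space (prob_algebra (history_space i))"
    unfolding joint_law_def
    using measurable_space[OF measurable_bind_prob_space[OF _ noise_kernel[OF assms], of "\<lambda>_::unit. M" "count_space UNIV"], of "()"]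
    by (simp add: space_prob_algebra prob_space_axioms)
  then show "sets (J i) = sets (history_space i)" "prob_space (J i)" by (auto simp: space_prob_algebra)
qed

lemma nn_integral_joint_law:
  assumes "i \<le> n" "f \<in> borel_measurable (history_space i)"
  shows "(\<integral>\<^sup>+h. f h \<partial>J i) = (\<integral>\<^sup>+\<omega>. \<integral>\<^sup>+h. f h \<partial>history_law \<Lambda> \<kappa> (\<lambda>j. z j \<omega>) i \<partial>M)"
  unfolding joint_law_def
  by (rule nn_integral_bind[OF assms(2) measurable_prob_algebraD[OF noise_kernel[OF assms(1)]]])

lemma predicted_state_measurable:
  assumes "i \<le> k"
  shows "predicted_state i \<in> borel_measurable (history_space k)"
  unfolding predicted_state_def
proof (rule kalman_measurable)
  fix j assume "j < i"
  then have [measurable]: "(\<lambda>h. h j) \<in> history_space k \<rightarrow>\<^sub>M borel \<Otimes>\<^sub>M borel"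
    using assms by (intro measurable_component_singleton) simp
  show "(\<lambda>h. noise_of h j) \<in> borel_measurable (history_space k)"
    unfolding noise_of_def by measurable
qed

lemma predicted_state_cong: "(\<And>j. j < i \<Longrightarrow> h j = h' j) \<Longrightarrow> predicted_state i h = predicted_state i h'"
  unfolding predicted_state_def by (intro kalman_cong) (simp add: noise_of_def)

lemma nn_integral_joint_law_Suc:
  assumes i: "i < n" and f: "f \<in> borel_measurable (history_space (Suc i))"
  shows "(\<integral>\<^sup>+h. f h \<partial>J (Suc i)) =
    (\<integral>\<^sup>+h. \<integral>\<^sup>+x. \<integral>\<^sup>+q. f (h(i := (x, \<Lambda> *v x + (H *v predicted_state i h + q)))) \<partial>innov_law i \<partial>\<kappa> i h \<partial>J i)"
proof -
  interpret Ni: prob_space "innov_law i" by (rule prob_space_gauss[OF innovations])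
  note [measurable_cong] = sets_density
  define g where "g h q = (\<integral>\<^sup>+x. f (h(i := (x, \<Lambda> *v x + (H *v predicted_state i h + q)))) \<partial>\<kappa> i h)" for h q
  note pm[measurable] = predicted_state_measurable[OF order_refl, of i]
  have f1: "(\<lambda>((h, q), x). f (h(i := (x, \<Lambda> *v x + (H *v predicted_state i h + q)))))
      \<in> borel_measurable ((history_space i \<Otimes>\<^sub>M borel) \<Otimes>\<^sub>M borel)"
  proof -
    have "(\<lambda>((h, q), x). ((h, H *v predicted_state i h + q), x))
      \<in> (history_space i \<Otimes>\<^sub>M borel) \<Otimes>\<^sub>M borel \<rightarrow>\<^sub>M (history_space i \<Otimes>\<^sub>M borel) \<Otimes>\<^sub>M (borel :: (real^'m) measure)"
      unfolding case_prod_unfold by measurable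
    from measurable_compose[OF measurable_compose[OF this history_upd_measurable[of i \<Lambda>]] f]
    show ?thesis by (simp add: case_prod_unfold)
  qed
  have gm: "(\<lambda>(h, q). g h q) \<in> borel_measurable (history_space i \<Otimes>\<^sub>M borel)"
    unfolding g_def case_prod_unfold
  proof (rule nn_integral_measurable_subprob_algebra2[where N=borel])
    show "(\<lambda>p. \<kappa> i (fst p)) \<in> history_space i \<Otimes>\<^sub>M borel \<rightarrow>\<^sub>M subprob_algebra borel"
      by (rule measurable_compose[OF measurable_fst measurable_prob_algebraD[OF policy_measurable[OF policy i]]])
  qed (use f1 in \<open>simp add: case_prod_unfold\<close>)
  let ?B = "(\<Pi>\<^sub>M j\<in>{..<i}. borel) :: (nat \<Rightarrow> real^'p) measure"
  \<comment> \<open>With the history integrated out, only the past noise \<open>zz\<close> and the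
    innovation \<open>q\<close> remain, as required by \<open>noise_indep\<close>.\<close>
  define \<Phi> where "\<Phi> zz q = (\<integral>\<^sup>+h. g h q \<partial>history_law \<Lambda> \<kappa> zz i)" for zz q
  have HL: "(\<lambda>zz. history_law \<Lambda> \<kappa> zz i) \<in> ?B \<rightarrow>\<^sub>M prob_algebra (history_space i)"
    using i by (intro history_law_measurable[OF policy]) (auto intro: measurable_component_singleton)
  have \<Phi>m: "(\<lambda>(zz, q). \<Phi> zz q) \<in> borel_measurable (?B \<Otimes>\<^sub>M borel)"
    unfolding \<Phi>_def case_prod_unfold
  proof (rule nn_integral_measurable_subprob_algebra2[where N="history_space i"])
    show "(\<lambda>p. history_law \<Lambda> \<kappa> (fst p) i) \<in> ?B \<Otimes>\<^sub>M borel \<rightarrow>\<^sub>M subprob_algebra (history_space i)"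
      by (rule measurable_compose[OF measurable_fst measurable_prob_algebraD[OF HL]])
    have "(\<lambda>(p, h). (h, snd p)) \<in> (?B \<Otimes>\<^sub>M borel) \<Otimes>\<^sub>M history_space i \<rightarrow>\<^sub>M history_space i \<Otimes>\<^sub>M (borel :: (real^'p) measure)"
      by measurable
    from measurable_compose[OF this gm]
    show "(\<lambda>(p, h). g h (snd p)) \<in> borel_measurable ((?B \<Otimes>\<^sub>M borel) \<Otimes>\<^sub>M history_space i)"
      by (simp add: case_prod_unfold)
  qed
  have HLr: "history_law \<Lambda> \<kappa> (\<lambda>j\<in>{..<i}. z j \<omega>) i = history_law \<Lambda> \<kappa> (\<lambda>j. z j \<omega>) i" for \<omega>
    by (intro history_law_cong) auto
  have sp: "space (history_law \<Lambda> \<kappa> zz i) = space (history_space i)" "sets (history_law \<Lambda> \<kappa> zz i) = sets (history_space i)" for zz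
    using history_law_prob[OF policy, of i \<Lambda> zz] i sets_eq_imp_space_eq by auto
  have "(\<integral>\<^sup>+h. f h \<partial>J (Suc i)) = (\<integral>\<^sup>+\<omega>. \<integral>\<^sup>+h. \<integral>\<^sup>+h'. f h' \<partial>history_step \<Lambda> \<kappa> i h (z i \<omega>) \<partial>history_law \<Lambda> \<kappa> (\<lambda>j. z j \<omega>) i \<partial>M)"
  proof -
    have "(\<integral>\<^sup>+h. f h \<partial>history_law \<Lambda> \<kappa> zz (Suc i)) = (\<integral>\<^sup>+h. \<integral>\<^sup>+h'. f h' \<partial>history_step \<Lambda> \<kappa> i h (zz i) \<partial>history_law \<Lambda> \<kappa> zz i)" for zz
      unfolding history_law_Suc_step
    proof (rule nn_integral_bind[OF f])
      have "(\<lambda>h. (h, zz i)) \<in> history_space i \<rightarrow>\<^sub>M history_space i \<Otimes>\<^sub>M borel" by measurable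
      from measurable_compose[OF this measurable_prob_algebraD[OF history_step_measurable[OF policy i, of \<Lambda>]]]
      show "(\<lambda>h. history_step \<Lambda> \<kappa> i h (zz i)) \<in> history_law \<Lambda> \<kappa> zz i \<rightarrow>\<^sub>M subprob_algebra (history_space (Suc i))"
        by (simp cong: measurable_cong_sets add: sp)
    qed
    then show ?thesis unfolding nn_integral_joint_law[OF Suc_leI[OF i] f] by (simp only:)
  qed
  also have "\<dots> = (\<integral>\<^sup>+\<omega>. \<Phi> (\<lambda>j\<in>{..<i}. z j \<omega>) (innov i \<omega>) \<partial>M)"
    unfolding \<Phi>_def HLr
  proof (rule nn_integral_cong, rule nn_integral_cong_AE)
    fix \<omega>
    have "AE h in history_law \<Lambda> \<kappa> (\<lambda>j. z j \<omega>) i. \<forall>j<i. snd (h j) - \<Lambda> *v fst (h j) = z j \<omega>"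
      using i by (intro AE_history_law_noise[OF policy]) simp
    then show "AE h in history_law \<Lambda> \<kappa> (\<lambda>j. z j \<omega>) i. (\<integral>\<^sup>+h'. f h' \<partial>history_step \<Lambda> \<kappa> i h (z i \<omega>)) = g h (innov i \<omega>)"
    proof (rule AE_mp, intro AE_I2 impI)
      fix h assume "h \<in> space (history_law \<Lambda> \<kappa> (\<lambda>j. z j \<omega>) i)" and h: "\<forall>j<i. snd (h j) - \<Lambda> *v fst (h j) = z j \<omega>"
      then have hs: "h \<in> space (history_space i)" by (simp add: sp)
      have "predicted_state i h = kalman F H Kp (\<lambda>j. z j \<omega>) i"
        unfolding predicted_state_def using h by (intro kalman_cong) (simp add: noise_of_def)
      then have "z i \<omega> = H *v predicted_state i h + innov i \<omega>" using noise_eq[of i \<omega>] by simp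
      then show "(\<integral>\<^sup>+h'. f h' \<partial>history_step \<Lambda> \<kappa> i h (z i \<omega>)) = g h (innov i \<omega>)"
        by (simp add: nn_integral_history_step[OF policy i hs f] g_def)
    qed
  qed
  also have "\<dots> = (\<integral>\<^sup>+\<omega>. \<integral>\<^sup>+q. \<Phi> (\<lambda>j\<in>{..<i}. z j \<omega>) q \<partial>innov_law i \<partial>M)"
    by (rule noise_indep[OF \<Phi>m])
  also have "\<dots> = (\<integral>\<^sup>+\<omega>. \<integral>\<^sup>+h. \<integral>\<^sup>+q. g h q \<partial>innov_law i \<partial>history_law \<Lambda> \<kappa> (\<lambda>j. z j \<omega>) i \<partial>M)"
    unfolding \<Phi>_def HLr
  proof (rule nn_integral_cong)
    fix \<omega>
    let ?L = "history_law \<Lambda> \<kappa> (\<lambda>j. z j \<omega>) i"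
    interpret L: prob_space ?L using history_law_prob[OF policy] i by simp
    interpret P: pair_sigma_finite ?L "innov_law i" ..
    have "case_prod g \<in> borel_measurable (?L \<Otimes>\<^sub>M innov_law i)"
      using gm by (simp cong: measurable_cong_sets add: sp sets_pair_measure_cong[OF sp(2) refl])
    then show "(\<integral>\<^sup>+q. \<integral>\<^sup>+h. g h q \<partial>?L \<partial>innov_law i) = (\<integral>\<^sup>+h. \<integral>\<^sup>+q. g h q \<partial>innov_law i \<partial>?L)"
      by (rule P.Fubini')
  qed
  also have "\<dots> = (\<integral>\<^sup>+h. \<integral>\<^sup>+q. g h q \<partial>innov_law i \<partial>J i)"
  proof (rule nn_integral_joint_law[symmetric])
    show "(\<lambda>h. \<integral>\<^sup>+q. g h q \<partial>innov_law i) \<in> borel_measurable (history_space i)"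
      using gm by (intro Ni.borel_measurable_nn_integral) (simp cong: measurable_cong_sets)
  qed (use i in simp)
  also have "\<dots> = (\<integral>\<^sup>+h. \<integral>\<^sup>+x. \<integral>\<^sup>+q. f (h(i := (x, \<Lambda> *v x + (H *v predicted_state i h + q)))) \<partial>innov_law i \<partial>\<kappa> i h \<partial>J i)"
    unfolding g_def
  proof (rule nn_integral_cong)
    fix h assume "h \<in> space (J i)"
    then have h: "h \<in> space (history_space i)" using sets_eq_imp_space_eq[OF joint_law_prob(1)[of i]] i by simp
    interpret K: prob_space "\<kappa> i h" by (rule policy_sets[OF policy i h])
    interpret P: pair_sigma_finite "\<kappa> i h" "innov_law i" ..
    have "(\<lambda>(x, q). ((h, q), x)) \<in> borel \<Otimes>\<^sub>M borel \<rightarrow>\<^sub>M (history_space i \<Otimes>\<^sub>M borel) \<Otimes>\<^sub>M borel"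
      using h by measurable
    from measurable_compose[OF this f1]
    have "case_prod (\<lambda>x q. f (h(i := (x, \<Lambda> *v x + (H *v predicted_state i h + q))))) \<in> borel_measurable (\<kappa> i h \<Otimes>\<^sub>M innov_law i)"
      by (simp cong: measurable_cong_sets add: case_prod_unfold sets_pair_measure_cong[OF policy_sets(1)[OF policy i h] refl])
    then show "(\<integral>\<^sup>+q. \<integral>\<^sup>+x. f (h(i := (x, \<Lambda> *v x + (H *v predicted_state i h + q)))) \<partial>\<kappa> i h \<partial>innov_law i)
      = (\<integral>\<^sup>+x. \<integral>\<^sup>+q. f (h(i := (x, \<Lambda> *v x + (H *v predicted_state i h + q)))) \<partial>innov_law i \<partial>\<kappa> i h)"
      by (rule P.Fubini')
  qed
  finally show ?thesis .
qed

end

section \<open>Independence of the fresh innovation from the past\<close>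

context feedback_channel
begin

definition obs_innov :: "nat \<Rightarrow> (nat \<Rightarrow> (real^'m) \<times> (real^'p)) \<Rightarrow> real^'p" where
  "obs_innov i h = noise_of h i - H *v predicted_state i h"

text \<open>All that is known just before innovation \<open>i\<close> acts: the history and also the
  current input.\<close>

definition past :: "nat \<Rightarrow> (nat \<Rightarrow> (real^'m) \<times> (real^'p)) \<Rightarrow> (nat \<Rightarrow> (real^'m) \<times> (real^'p)) \<times> (real^'m)" where
  "past i h = (restrict h {..<i}, fst (h i))"

lemma joint_measurable: "measurable (J i) N = measurable (history_space i) N" if "i \<le> n"
  using joint_law_prob(1)[OF that] by (intro measurable_cong_sets) auto

lemma component_measurable: "j < k \<Longrightarrow> (\<lambda>h. h j) \<in> history_space k \<rightarrow>\<^sub>M borel \<Otimes>\<^sub>M borel"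
  by (intro measurable_component_singleton) simp

lemma obs_innov_measurable:
  assumes "i < k" shows "obs_innov i \<in> borel_measurable (history_space k)"
proof -
  have [measurable]: "(\<lambda>h. h i) \<in> history_space k \<rightarrow>\<^sub>M borel \<Otimes>\<^sub>M borel" by (rule component_measurable[OF assms])
  have [measurable]: "predicted_state i \<in> borel_measurable (history_space k)"
    using assms by (intro predicted_state_measurable) simp
  show ?thesis unfolding obs_innov_def noise_of_def by measurable
qed

lemma past_measurable:
  assumes "i < k" shows "past i \<in> history_space k \<rightarrow>\<^sub>M history_space i \<Otimes>\<^sub>M borel"
proof -
  have [measurable]: "(\<lambda>h. h i) \<in> history_space k \<rightarrow>\<^sub>M borel \<Otimes>\<^sub>M borel" by (rule component_measurable[OF assms])
  have [measurable]: "(\<lambda>h. restrict h {..<i}) \<in> history_space k \<rightarrow>\<^sub>M history_space i"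
    using assms by (intro measurable_restrict_subset) auto
  show ?thesis unfolding past_def by measurable
qed

text \<open>Later inputs and innovations have probability laws and integrate to one, so the joint
  laws of different lengths are consistent.\<close>

lemma nn_integral_joint_law_restrict:
  assumes "i \<le> k" "k \<le> n" and f: "f \<in> borel_measurable (history_space i)"
  shows "(\<integral>\<^sup>+h. f (restrict h {..<i}) \<partial>J k) = (\<integral>\<^sup>+h. f h \<partial>J i)"
  using assms(1,2)
proof (induction k rule: dec_induct)
  case base
  show ?case
  proof (rule nn_integral_cong)
    fix h assume "h \<in> space (J i)"
    then have "h \<in> space (history_space i)" using sets_eq_imp_space_eq[OF joint_law_prob(1)[of i]] base by simp
    then have "restrict h {..<i} = h" by (auto simp: space_PiM PiE_def extensional_def fun_eq_iff)
    then show "f (restrict h {..<i}) = f h" by simp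
  qed
next
  case (step k)
  then have k: "k < n" by simp
  have "(\<lambda>h. restrict h {..<i}) \<in> history_space (Suc k) \<rightarrow>\<^sub>M history_space i"
    using step by (intro measurable_restrict_subset) auto
  then have fm: "(\<lambda>h. f (restrict h {..<i})) \<in> borel_measurable (history_space (Suc k))"
    using f by (rule measurable_compose)
  have eq: "restrict (h(k := c)) {..<i} = restrict h {..<i}" for h :: "nat \<Rightarrow> (real^'m) \<times> (real^'p)" and c
    using step by (auto simp: restrict_def fun_eq_iff)
  interpret Ni: prob_space "innov_law k" by (rule prob_space_gauss[OF innovations])
  have "(\<integral>\<^sup>+h. f (restrict h {..<i}) \<partial>J (Suc k)) = (\<integral>\<^sup>+h. \<integral>\<^sup>+x. f (restrict h {..<i}) \<partial>\<kappa> k h \<partial>J k)"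
    unfolding nn_integral_joint_law_Suc[OF k fm] eq using Ni.emeasure_space_1 by simp
  also have "\<dots> = (\<integral>\<^sup>+h. f (restrict h {..<i}) \<partial>J k)"
  proof (rule nn_integral_cong)
    fix h assume "h \<in> space (J k)"
    then have "h \<in> space (history_space k)" using sets_eq_imp_space_eq[OF joint_law_prob(1)[of k]] k by simp
    then interpret K: prob_space "\<kappa> k h" by (rule policy_sets(2)[OF policy k])
    show "(\<integral>\<^sup>+x. f (restrict h {..<i}) \<partial>\<kappa> k h) = f (restrict h {..<i})" using K.emeasure_space_1 by simp
  qed
  also have "\<dots> = (\<integral>\<^sup>+h. f h \<partial>J i)" using k by (intro step.IH) simp
  finally show ?case .
qed

lemma nn_integral_past_innov:
  assumes i: "i < n" and f: "f \<in> borel_measurable ((history_space i \<Otimes>\<^sub>M borel) \<Otimes>\<^sub>M borel)"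
  shows "(\<integral>\<^sup>+h. f (past i h, obs_innov i h) \<partial>J n) = (\<integral>\<^sup>+h. \<integral>\<^sup>+x. \<integral>\<^sup>+q. f ((h, x), q) \<partial>innov_law i \<partial>\<kappa> i h \<partial>J i)"
proof -
  have m: "(\<lambda>h. f (past i h, obs_innov i h)) \<in> borel_measurable (history_space (Suc i))"
    using measurable_compose[OF measurable_Pair[OF past_measurable[of i "Suc i"] obs_innov_measurable[of i "Suc i"]] f] by simp
  have cong: "past i (restrict h {..<Suc i}) = past i h" "obs_innov i (restrict h {..<Suc i}) = obs_innov i h" for h
  proof -
    show "past i (restrict h {..<Suc i}) = past i h" by (auto simp: past_def restrict_def fun_eq_iff)
    have "predicted_state i (restrict h {..<Suc i}) = predicted_state i h" by (intro predicted_state_cong) auto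
    then show "obs_innov i (restrict h {..<Suc i}) = obs_innov i h" by (simp add: obs_innov_def noise_of_def)
  qed
  have "(\<integral>\<^sup>+h. f (past i h, obs_innov i h) \<partial>J n) = (\<integral>\<^sup>+h. f (past i h, obs_innov i h) \<partial>J (Suc i))"
    using nn_integral_joint_law_restrict[OF Suc_leI[OF i] order_refl m] unfolding cong .
  also have "\<dots> = (\<integral>\<^sup>+h. \<integral>\<^sup>+x. \<integral>\<^sup>+q. f ((h, x), q) \<partial>innov_law i \<partial>\<kappa> i h \<partial>J i)"
    unfolding nn_integral_joint_law_Suc[OF i m]
  proof (intro nn_integral_cong)
    fix h x q assume "h \<in> space (J i)"
    then have h: "h \<in> space (history_space i)" using sets_eq_imp_space_eq[OF joint_law_prob(1)[of i]] i by simp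
    let ?h = "h(i := (x, \<Lambda> *v x + (H *v predicted_state i h + q)))"
    have "past i ?h = (h, x)"
      using h by (auto simp: past_def space_PiM PiE_def extensional_def restrict_def fun_eq_iff)
    moreover have "predicted_state i ?h = predicted_state i h" by (intro predicted_state_cong) auto
    then have "obs_innov i ?h = q" by (simp add: obs_innov_def noise_of_def)
    ultimately show "f (past i ?h, obs_innov i ?h) = f ((h, x), q)" by simp
  qed
  finally show ?thesis .
qed

text \<open>Testing the one-step formula on indicators gives a product law; functions that ignore
  the innovation identify its first factor as the law of the past.\<close>

lemma distr_past_innov:
  assumes i: "i < n"
  shows "distr (J n) ((history_space i \<Otimes>\<^sub>M borel) \<Otimes>\<^sub>M borel) (\<lambda>h. (past i h, obs_innov i h))
    = distr (J n) (history_space i \<Otimes>\<^sub>M borel) (past i) \<Otimes>\<^sub>M innov_law i"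
    (is "?D = ?P \<Otimes>\<^sub>M _")
proof (rule measure_eqI)
  interpret Ni: prob_space "innov_law i" by (rule prob_space_gauss[OF innovations])
  interpret Jn: prob_space "J n" by (rule joint_law_prob(2)) simp
  have pm: "past i \<in> J n \<rightarrow>\<^sub>M history_space i \<Otimes>\<^sub>M borel" and om: "obs_innov i \<in> borel_measurable (J n)"
    using past_measurable[OF i] obs_innov_measurable[OF i] by (simp_all add: joint_measurable)
  interpret P: prob_space ?P by (rule Jn.prob_space_distr[OF pm])
  interpret PN: pair_sigma_finite ?P "innov_law i" ..
  have s: "sets (?P \<Otimes>\<^sub>M innov_law i) = sets ((history_space i \<Otimes>\<^sub>M borel) \<Otimes>\<^sub>M borel)"
    by (rule sets_pair_measure_cong) simp_all
  show "sets ?D = sets (?P \<Otimes>\<^sub>M innov_law i)" using s by simp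
  fix A assume "A \<in> sets ?D"
  then have A: "A \<in> sets ((history_space i \<Otimes>\<^sub>M borel) \<Otimes>\<^sub>M borel)" by simp
  define f :: "_ \<Rightarrow> ennreal" where "f = indicator A"
  have f: "f \<in> borel_measurable ((history_space i \<Otimes>\<^sub>M borel) \<Otimes>\<^sub>M borel)" using A by (simp add: f_def)
  then have f': "f \<in> borel_measurable (?P \<Otimes>\<^sub>M innov_law i)" using s by (simp cong: measurable_cong_sets)
  define g where "g a = (\<integral>\<^sup>+q. f (a, q) \<partial>innov_law i)" for a
  have g: "g \<in> borel_measurable (history_space i \<Otimes>\<^sub>M borel)"
    unfolding g_def using f by (intro Ni.borel_measurable_nn_integral) (simp cong: measurable_cong_sets)
  have "emeasure ?D A = (\<integral>\<^sup>+h. f (past i h, obs_innov i h) \<partial>J n)"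
    using A measurable_Pair[OF pm om] by (simp add: f_def nn_integral_distr flip: nn_integral_indicator)
  also have "\<dots> = (\<integral>\<^sup>+h. \<integral>\<^sup>+x. g (h, x) \<partial>\<kappa> i h \<partial>J i)"
    unfolding nn_integral_past_innov[OF i f] g_def ..
  also have "\<dots> = (\<integral>\<^sup>+h. g (past i h) \<partial>J n)"
  proof -
    have "(\<lambda>p. g (fst p)) \<in> borel_measurable ((history_space i \<Otimes>\<^sub>M borel) \<Otimes>\<^sub>M (borel :: (real^'p) measure))"
      by (rule measurable_compose[OF measurable_fst g])
    from nn_integral_past_innov[OF i this] show ?thesis using Ni.emeasure_space_1 by simp
  qed
  also have "\<dots> = (\<integral>\<^sup>+a. g a \<partial>?P)" by (rule nn_integral_distr[OF pm, symmetric]) (use g in simp)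
  also have "\<dots> = emeasure (?P \<Otimes>\<^sub>M innov_law i) A"
    unfolding g_def using Ni.nn_integral_fst[OF f'] A s by (simp add: f_def)
  finally show "emeasure ?D A = emeasure (?P \<Otimes>\<^sub>M innov_law i) A" .
qed

lemma distr_obs_innov:
  assumes i: "i < n" shows "distr (J n) borel (obs_innov i) = innov_law i"
proof (rule measure_eqI)
  interpret Ni: prob_space "innov_law i" by (rule prob_space_gauss[OF innovations])
  interpret Jn: prob_space "J n" by (rule joint_law_prob(2)) simp
  have pm: "past i \<in> J n \<rightarrow>\<^sub>M history_space i \<Otimes>\<^sub>M borel" and om: "obs_innov i \<in> borel_measurable (J n)"
    using past_measurable[OF i] obs_innov_measurable[OF i] by (simp_all add: joint_measurable)
  interpret P: prob_space "distr (J n) (history_space i \<Otimes>\<^sub>M borel) (past i)" by (rule Jn.prob_space_distr[OF pm])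
  fix A assume "A \<in> sets (distr (J n) borel (obs_innov i))"
  then have A: "A \<in> sets borel" by simp
  let ?S = "space (history_space i \<Otimes>\<^sub>M (borel :: (real^'m) measure))"
  have "emeasure (distr (J n) borel (obs_innov i)) A
      = emeasure (distr (J n) ((history_space i \<Otimes>\<^sub>M borel) \<Otimes>\<^sub>M borel) (\<lambda>h. (past i h, obs_innov i h))) (?S \<times> A)"
    using A om measurable_Pair[OF pm om] measurable_space[OF pm]
    by (subst (1 2) emeasure_distr) (auto intro!: arg_cong2[where f=emeasure])
  also have "\<dots> = emeasure (innov_law i) A"
    unfolding distr_past_innov[OF i] using A P.emeasure_space_1
    by (subst Ni.emeasure_pair_measure_Times) auto
  finally show "emeasure (distr (J n) borel (obs_innov i)) A = emeasure (innov_law i) A" .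
qed simp

lemma obs_innov_moments:
  assumes i: "i < n"
  shows "sq_integrable (J n) (obs_innov i)"
    and "(LINT h|J n. (a \<bullet> obs_innov i h) * (b \<bullet> obs_innov i h)) = a \<bullet> (\<Psi> i *v b)"
proof -
  have om: "obs_innov i \<in> borel_measurable (J n)"
    using obs_innov_measurable[OF i] by (simp add: joint_measurable)
  note gm = gauss_moments[OF innovations[of i], folded distr_obs_innov[OF i]]
  show "sq_integrable (J n) (obs_innov i)"
    using gm(1) om unfolding sq_integrable_def by (subst (asm) integrable_distr_eq) auto
  show "(LINT h|J n. (a \<bullet> obs_innov i h) * (b \<bullet> obs_innov i h)) = a \<bullet> (\<Psi> i *v b)"
    using gm(3)[of a b] om by (subst (asm) integral_distr) auto
qed

text \<open>Fubini under the product law: the inner integral is the mean of the innovation, which is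
  zero. Square integrability of \<open>g\<close> makes the product integrable.\<close>

lemma innov_uncorrelated:
  assumes i: "i < n" and g: "g \<in> borel_measurable (history_space i \<Otimes>\<^sub>M borel)"
    and sq: "sq_integrable (J n) (\<lambda>h. g (past i h) :: real)"
  shows "(LINT h|J n. g (past i h) * (b \<bullet> obs_innov i h)) = 0"
proof -
  interpret Ni: prob_space "innov_law i" by (rule prob_space_gauss[OF innovations])
  interpret Jn: prob_space "J n" by (rule joint_law_prob(2)) simp
  have pm: "past i \<in> J n \<rightarrow>\<^sub>M history_space i \<Otimes>\<^sub>M borel" and om: "obs_innov i \<in> borel_measurable (J n)"
    using past_measurable[OF i] obs_innov_measurable[OF i] by (simp_all add: joint_measurable)
  let ?P = "distr (J n) (history_space i \<Otimes>\<^sub>M borel) (past i)"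
  interpret P: prob_space ?P by (rule Jn.prob_space_distr[OF pm])
  interpret PN: pair_sigma_finite ?P "innov_law i" ..
  let ?D = "distr (J n) ((history_space i \<Otimes>\<^sub>M borel) \<Otimes>\<^sub>M borel) (\<lambda>h. (past i h, obs_innov i h))"
  have fm: "(\<lambda>(a, q). g a * (b \<bullet> q)) \<in> borel_measurable ((history_space i \<Otimes>\<^sub>M borel) \<Otimes>\<^sub>M borel)"
  proof -
    have [measurable]: "(\<lambda>p. g (fst p)) \<in> borel_measurable ((history_space i \<Otimes>\<^sub>M borel) \<Otimes>\<^sub>M (borel :: (real^'p) measure))"
      by (rule measurable_compose[OF measurable_fst g])
    show ?thesis unfolding case_prod_unfold by measurable
  qed
  have "integrable (J n) (\<lambda>h. g (past i h) * (b \<bullet> obs_innov i h))"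
    by (intro integrable_mult_sq_integrable sq sq_integrable_inner_left obs_innov_moments(1) i)
  then have "integrable ?D (\<lambda>(a, q). g a * (b \<bullet> q))"
    by (subst integrable_distr_eq[OF measurable_Pair[OF pm om] fm]) (simp add: case_prod_unfold)
  then have int: "integrable (?P \<Otimes>\<^sub>M innov_law i) (\<lambda>(a, q). g a * (b \<bullet> q))"
    by (simp only: distr_past_innov[OF i])
  have "(LINT h|J n. g (past i h) * (b \<bullet> obs_innov i h)) = (LINT p|?D. (\<lambda>(a, q). g a * (b \<bullet> q)) p)"
    by (subst integral_distr[OF measurable_Pair[OF pm om] fm]) (simp add: case_prod_unfold)
  also have "\<dots> = (LINT a|?P. LINT q|innov_law i. g a * (b \<bullet> q))"
    unfolding distr_past_innov[OF i] using PN.integral_fst'[OF int] by (simp add: case_prod_unfold)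
  also have "\<dots> = 0" using gauss_moments(2)[OF innovations[of i]] by simp
  finally show ?thesis .
qed

text \<open>Given the past, the output is a translate of the innovation, whose density is bounded; this is
  why no regularity of the policy is needed.\<close>

lemma nn_integral_output_le:
  assumes "i \<le> n" "f \<in> borel_measurable (\<Pi>\<^sub>M j\<in>{..<i}. borel)"
  shows "(\<integral>\<^sup>+h. f (\<lambda>j\<in>{..<i}. snd (h j)) \<partial>J i)
    \<le> ennreal (\<Prod>j<i. gauss (\<Psi> j) 0) * (\<integral>\<^sup>+y. f y \<partial>(\<Pi>\<^sub>M j\<in>{..<i}. lborel))"
  using assms
proof (induction i arbitrary: f)
  case 0
  interpret J0: prob_space "J 0" by (rule joint_law_prob(2)) simp
  have "(\<lambda>j\<in>{}. snd (h j)) = (\<lambda>_. undefined)" for h :: "nat \<Rightarrow> (real^'m) \<times> (real^'p)" by auto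
  then show ?case using J0.emeasure_space_1 by (simp add: PiM_empty nn_integral_count_space_finite)
next
  case (Suc i)
  interpret L: product_sigma_finite "\<lambda>_::nat. lborel :: (real^'p) measure" by standard
  have i: "i < n" using Suc.prems by simp
  let ?B = "\<lambda>k. (\<Pi>\<^sub>M j\<in>{..<k}. borel) :: (nat \<Rightarrow> real^'p) measure"
  let ?c = "gauss (\<Psi> i) 0"
  let ?y = "\<lambda>i h. \<lambda>j\<in>{..<i}. snd (h j) :: real^'p"
  have ym: "?y k \<in> history_space k \<rightarrow>\<^sub>M ?B k" for k
    by (intro measurable_restrict measurable_compose[OF component_measurable measurable_snd]) auto
  have upd: "(\<lambda>(y, u). y(i := u)) \<in> ?B i \<Otimes>\<^sub>M borel \<rightarrow>\<^sub>M ?B (Suc i)"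
    unfolding lessThan_Suc by (rule measurable_add_dim)
  have fu: "(\<lambda>(y, u). f (y(i := u))) \<in> borel_measurable (?B i \<Otimes>\<^sub>M borel)"
    using measurable_compose[OF upd Suc.prems(2)] by (simp only: case_prod_unfold)
  define g where "g y = (\<integral>\<^sup>+u. f (y(i := u)) \<partial>lborel)" for y
  have g: "g \<in> borel_measurable (?B i)"
    unfolding g_def using fu by (intro lborel.borel_measurable_nn_integral) (simp cong: measurable_cong_sets)
  have "(\<integral>\<^sup>+h. f (?y (Suc i) h) \<partial>J (Suc i)) =
     (\<integral>\<^sup>+h. \<integral>\<^sup>+x. \<integral>\<^sup>+q. f (?y (Suc i) (h(i := (x, \<Lambda> *v x + (H *v predicted_state i h + q))))) \<partial>innov_law i \<partial>\<kappa> i h \<partial>J i)"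
    using measurable_compose[OF ym Suc.prems(2)] by (rule nn_integral_joint_law_Suc[OF i])
  also have "\<dots> \<le> (\<integral>\<^sup>+h. ennreal ?c * g (?y i h) \<partial>J i)"
  proof (rule nn_integral_mono)
    fix h assume "h \<in> space (J i)"
    then have h: "h \<in> space (history_space i)" using sets_eq_imp_space_eq[OF joint_law_prob(1)[of i]] i by simp
    interpret K: prob_space "\<kappa> i h" by (rule policy_sets(2)[OF policy i h])
    have "?y i h \<in> space (?B i)" using measurable_space[OF ym h] .
    from measurable_compose[OF measurable_Pair1'[OF this] fu]
    have fy: "(\<lambda>u. f ((?y i h)(i := u))) \<in> borel_measurable borel" by (simp only: prod.case)
    have "(\<integral>\<^sup>+q. f (?y (Suc i) (h(i := (x, \<Lambda> *v x + (H *v predicted_state i h + q))))) \<partial>innov_law i) \<le> ennreal ?c * g (?y i h)" for x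
    proof -
      let ?m = "\<Lambda> *v x + H *v predicted_state i h"
      have "?y (Suc i) (h(i := (x, \<Lambda> *v x + (H *v predicted_state i h + q)))) = (?y i h)(i := ?m + q)" for q
        by (auto simp: fun_eq_iff restrict_def add.assoc)
      then have "(\<integral>\<^sup>+q. f (?y (Suc i) (h(i := (x, \<Lambda> *v x + (H *v predicted_state i h + q))))) \<partial>innov_law i)
          = (\<integral>\<^sup>+u. f ((?y i h)(i := u)) * ennreal (gauss (\<Psi> i) (u - ?m)) \<partial>lborel)"
        using nn_integral_gauss_shift[OF fy, where c="?m" and A="\<Psi> i"] by simp
      also have "\<dots> \<le> (\<integral>\<^sup>+u. ennreal ?c * f ((?y i h)(i := u)) \<partial>lborel)"
        by (intro nn_integral_mono) (subst mult.commute, intro mult_right_mono ennreal_leI gauss_le innovations, simp)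
      also have "\<dots> = ennreal ?c * g (?y i h)" unfolding g_def using fy by (intro nn_integral_cmult) simp
      finally show ?thesis .
    qed
    then have "(\<integral>\<^sup>+x. \<integral>\<^sup>+q. f (?y (Suc i) (h(i := (x, \<Lambda> *v x + (H *v predicted_state i h + q))))) \<partial>innov_law i \<partial>\<kappa> i h)
        \<le> (\<integral>\<^sup>+x. ennreal ?c * g (?y i h) \<partial>\<kappa> i h)" by (intro nn_integral_mono)
    then show "(\<integral>\<^sup>+x. \<integral>\<^sup>+q. f (?y (Suc i) (h(i := (x, \<Lambda> *v x + (H *v predicted_state i h + q))))) \<partial>innov_law i \<partial>\<kappa> i h)
        \<le> ennreal ?c * g (?y i h)" using K.emeasure_space_1 by simp
  qed
  also have "\<dots> = ennreal ?c * (\<integral>\<^sup>+h. g (?y i h) \<partial>J i)"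
    using measurable_compose[OF ym g] i by (intro nn_integral_cmult) (simp add: joint_measurable)
  also have "\<dots> \<le> ennreal ?c * (ennreal (\<Prod>j<i. gauss (\<Psi> j) 0) * (\<integral>\<^sup>+y. g y \<partial>(\<Pi>\<^sub>M j\<in>{..<i}. lborel)))"
    by (rule mult_left_mono[OF Suc.IH[OF less_imp_le[OF i] g]]) simp
  also have "\<dots> = ennreal (\<Prod>j<Suc i. gauss (\<Psi> j) 0) * (\<integral>\<^sup>+y. g y \<partial>(\<Pi>\<^sub>M j\<in>{..<i}. lborel))"
    using gauss_pos[OF innovations] by (simp add: ennreal_mult less_imp_le prod_nonneg mult_ac)
  also have "(\<integral>\<^sup>+y. g y \<partial>(\<Pi>\<^sub>M j\<in>{..<i}. lborel)) = (\<integral>\<^sup>+y. f y \<partial>(\<Pi>\<^sub>M j\<in>{..<Suc i}. lborel))"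
    unfolding lessThan_Suc g_def using Suc.prems(2)
    by (intro L.product_nn_integral_insert[symmetric])
       (auto simp: PiM_lborel_borel_measurable simp flip: lessThan_Suc)
  finally show ?case .
qed

end

section \<open>Entropy\<close>

text \<open>Domination of \<open>N\<close> by a multiple of \<open>M\<close> makes the density \<open>N\<close>-integrable,
  which excludes that the entropy integral diverges and is assigned the junk value \<open>0\<close>.\<close>

lemma (in sigma_finite_measure) KL_divergence_ge:
  assumes N: "prob_space N" "sets N = sets M"
    and dom: "\<And>f. f \<in> borel_measurable M \<Longrightarrow> (\<integral>\<^sup>+x. f x \<partial>N) \<le> ennreal C * (\<integral>\<^sup>+x. f x \<partial>M)"
    and g[measurable]: "g \<in> borel_measurable M" and gpos: "\<And>x. 0 < g x"
    and gint: "(\<integral>\<^sup>+x. ennreal (g x) \<partial>M) \<le> 1"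
    and int: "integrable N (\<lambda>x. ln (g x))"
  shows "(LINT x|N. ln (g x)) \<le> KL_divergence (exp 1) M N"
proof -
  interpret N: prob_space N by fact
  \<comment> \<open>The domination hypothesis applied to indicators of null sets.\<close>
  have ac: "absolutely_continuous M N"
    unfolding absolutely_continuous_def
  proof (rule subsetI)
    fix A assume A: "A \<in> null_sets M"
    then have [measurable]: "A \<in> sets M" and "emeasure M A = 0" by auto
    then have "emeasure N A \<le> 0" using dom[of "indicator A"] N(2) by simp
    then show "A \<in> null_sets N" using N(2) by (auto simp: null_sets_def)
  qed
  define D where "D = RN_deriv M N"
  have [measurable]: "D \<in> borel_measurable M" by (simp add: D_def)
  have dens: "density M D = N" unfolding D_def by (rule density_RN_deriv[OF ac N(2)])
  have Nint: "(\<integral>\<^sup>+x. f x \<partial>N) = (\<integral>\<^sup>+x. D x * f x \<partial>M)" if "f \<in> borel_measurable M" for f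
    unfolding D_def by (rule RN_deriv_nn_integral[OF ac N(2) that])
  have mN: "f \<in> borel_measurable N" if "f \<in> borel_measurable M" for f :: "'a \<Rightarrow> real"
    using that by (simp only: measurable_cong_sets[OF N(2) refl])
  define f :: "'a \<Rightarrow> real" where "f x = enn2real (D x)" for x
  have fm[measurable]: "f \<in> borel_measurable M" unfolding f_def[abs_def] by measurable
  have "AE x in M. D x \<noteq> \<infinity>"
    unfolding D_def using N.sigma_finite_measure_axioms ac N(2) by (rule RN_deriv_finite)
  then have fin: "AE x in M. D x = ennreal (f x)" by (auto simp: f_def less_top)
  have pos: "AE x in N. 0 < f x"
  proof -
    have "AE x in M. 0 < D x \<longrightarrow> 0 < f x"
      using fin by eventually_elim (simp add: ennreal_less_zero_iff)
    then show ?thesis unfolding dens[symmetric] by (subst AE_density) auto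
  qed
  \<comment> \<open>The mean of the density \<open>f\<close> under \<open>N\<close> is at most
    \<open>C\<close> times its integral under \<open>M\<close>, and the latter is one.\<close>
  have f_int: "integrable N f"
  proof (rule integrableI_nonneg)
    have "(\<integral>\<^sup>+x. ennreal (f x) \<partial>N) \<le> ennreal C * (\<integral>\<^sup>+x. ennreal (f x) \<partial>M)" by (rule dom) measurable
    also have "(\<integral>\<^sup>+x. ennreal (f x) \<partial>M) = (\<integral>\<^sup>+x. D x * 1 \<partial>M)"
      using fin by (intro nn_integral_cong_AE) auto
    also have "\<dots> = 1" using Nint[of "\<lambda>_. 1"] N.emeasure_space_1 by simp
    finally show "(\<integral>\<^sup>+x. ennreal (f x) \<partial>N) < \<infinity>" by (simp add: order_le_less_trans)
  qed (auto simp: f_def intro: mN)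
  \<comment> \<open>Since division by zero gives zero, points with \<open>f x = 0\<close> contribute
    nothing, and elsewhere the density cancels.\<close>
  have ratio: "(\<integral>\<^sup>+x. ennreal (g x / f x) \<partial>N) \<le> 1"
  proof -
    have "(\<integral>\<^sup>+x. ennreal (g x / f x) \<partial>N) = (\<integral>\<^sup>+x. D x * ennreal (g x / f x) \<partial>M)" by (rule Nint) measurable
    also have "\<dots> \<le> (\<integral>\<^sup>+x. ennreal (g x) \<partial>M)"
    proof (rule nn_integral_mono_AE, rule AE_mp[OF fin], rule AE_I2, rule impI)
      fix x assume "D x = ennreal (f x)"
      moreover have "f x * (g x / f x) \<le> g x" using gpos[of x] by (cases "f x = 0") auto
      moreover have "0 \<le> f x" by (simp add: f_def)
      ultimately show "D x * ennreal (g x / f x) \<le> ennreal (g x)"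
        using gpos[of x] by (simp add: ennreal_mult[symmetric] less_imp_le ennreal_leI)
    qed
    finally show ?thesis using gint by simp
  qed
  have q_int: "integrable N (\<lambda>x. g x / f x)"
    by (rule integrableI_nonneg) (use ratio gpos in \<open>auto simp: f_def less_imp_le order_le_less_trans intro!: mN\<close>)
  have q_le: "(LINT x|N. g x / f x) \<le> 1"
    using ratio gpos q_int by (simp add: nn_integral_eq_integral f_def less_imp_le)
  \<comment> \<open>Gibbs' inequality pointwise, from \<open>ln q \<le> q - 1\<close> at
    \<open>q = g x / f x\<close>.\<close>
  have lower: "AE x in N. ln (g x) + 1 - g x / f x \<le> ln (f x)"
  proof (rule AE_mp[OF pos], rule AE_I2, rule impI)
    fix x assume "0 < f x"
    then show "ln (g x) + 1 - g x / f x \<le> ln (f x)"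
      using ln_le_minus_one[of "g x / f x"] gpos[of x] by (simp add: ln_div)
  qed
  \<comment> \<open>The logarithm lies between the bound \<open>lower\<close> and
    \<open>f - 1\<close>, both integrable; without this the integral of \<open>ln (f x)\<close>
    could be the default \<open>0\<close>.\<close>
  have ln_int: "integrable N (\<lambda>x. ln (f x))"
  proof (rule Bochner_Integration.integrable_bound)
    show "integrable N (\<lambda>x. \<bar>ln (g x)\<bar> + 1 + g x / f x + f x)"
      using int q_int f_int by (intro Bochner_Integration.integrable_add) auto
    show "(\<lambda>x. ln (f x)) \<in> borel_measurable N" by (intro mN) measurable
    show "AE x in N. norm (ln (f x)) \<le> norm (\<bar>ln (g x)\<bar> + 1 + g x / f x + f x)"
      using pos lower
    proof eventually_elim
      fix x assume x: "0 < f x" "ln (g x) + 1 - g x / f x \<le> ln (f x)"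
      have "ln (f x) \<le> f x - 1" using x(1) by (rule ln_le_minus_one)
      moreover have "0 \<le> g x / f x" using x(1) gpos[of x] by simp
      ultimately show "norm (ln (f x)) \<le> norm (\<bar>ln (g x)\<bar> + 1 + g x / f x + f x)"
        using x by (simp add: abs_le_iff) linarith
    qed
  qed
  have "(LINT x|N. ln (g x)) \<le> (LINT x|N. ln (g x)) + 1 - (LINT x|N. g x / f x)" using q_le by simp
  also have "\<dots> = (LINT x|N. ln (g x) + 1 - g x / f x)"
    using int q_int N.prob_space by simp
  also have "\<dots> \<le> (LINT x|N. ln (f x))"
    using int q_int ln_int lower by (intro integral_mono_AE) auto
  also have "\<dots> = KL_divergence (exp 1) M N"
    unfolding KL_divergence_def entropy_density_def by (simp add: f_def D_def o_def log_ln)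
  finally show ?thesis .
qed

text \<open>The log density is quadratic, so only second moments of \<open>X\<close> enter: the mean
  of \<open>X \<bullet> (matrix_inv A *v X)\<close> is the trace of the identity. \<open>X\<close>
  may be neither Gaussian nor centred.\<close>

lemma gauss_cross_entropy:
  fixes A :: "real^'n^'n"
  assumes A: "pos_def A" and X: "sq_integrable M X"
    and cov: "\<And>a b. (LINT \<omega>|M. (a \<bullet> X \<omega>) * (b \<bullet> X \<omega>)) = a \<bullet> (A *v b)" and "prob_space M"
  shows "integrable M (\<lambda>\<omega>. ln (gauss A (X \<omega>)))"
    and "(LINT \<omega>|M. ln (gauss A (X \<omega>))) = - ((real CARD('n) * (1 + ln (2 * pi)) + ln (det A)) / 2)"
proof -
  interpret prob_space M by fact
  let ?B = "matrix_inv A"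
  let ?r = "\<lambda>i. transpose ?B *v axis i 1"
  \<comment> \<open>A sum of products of projections, the shape in which \<open>cov\<close> provides
    the means.\<close>
  have quad: "x \<bullet> (?B *v x) = (\<Sum>i\<in>UNIV. (axis i 1 \<bullet> x) * (?r i \<bullet> x))" for x
    by (simp add: inner_vec_def[of x] inner_axis' inner_matrix_vector_adjoint[symmetric] del: transpose_matrix_vector)
  have i: "integrable M (\<lambda>\<omega>. (a \<bullet> X \<omega>) * (b \<bullet> X \<omega>))" for a b
    by (intro integrable_mult_sq_integrable sq_integrable_inner_left X)
  have int: "integrable M (\<lambda>\<omega>. X \<omega> \<bullet> (?B *v X \<omega>))" unfolding quad using i by auto
  have sym: "transpose ?B = ?B" using pos_def_matrix_inv[OF A] by (simp add: pos_def_def)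
  have "(LINT \<omega>|M. X \<omega> \<bullet> (?B *v X \<omega>)) = (\<Sum>i\<in>UNIV. axis i 1 \<bullet> (A *v ?r i))"
    unfolding quad using i by (simp add: cov)
  also have "\<dots> = (\<Sum>i\<in>(UNIV :: 'n set). axis i 1 \<bullet> (axis i 1 :: real^'n))"
    unfolding sym matrix_vector_mul_assoc matrix_inv_left_right(1)[OF pos_def_invertible[OF A]] by simp
  also have "\<dots> = real CARD('n)" by (simp add: inner_axis)
  finally have E: "(LINT \<omega>|M. X \<omega> \<bullet> (?B *v X \<omega>)) = real CARD('n)" .
  show "integrable M (\<lambda>\<omega>. ln (gauss A (X \<omega>)))" unfolding ln_gauss[OF A] using int by auto
  show "(LINT \<omega>|M. ln (gauss A (X \<omega>))) = - ((real CARD('n) * (1 + ln (2 * pi)) + ln (det A)) / 2)"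
    unfolding ln_gauss[OF A] using int E prob_space by (simp add: field_simps)
qed

lemma symmetric_eq_if_forms_eq:
  fixes A B :: "real^'n^'n"
  assumes "transpose A = A" "transpose B = B" "\<And>x. x \<bullet> (A *v x) = x \<bullet> (B *v x)"
  shows "A = B"
proof -
  have "A $ i $ j = B $ i $ j" for i j
    using assms(3)[of "axis i 1 + axis j 1"] assms(3)[of "axis i 1"] assms(3)[of "axis j 1"]
    unfolding symmetric_form_add[OF assms(1)] symmetric_form_add[OF assms(2)]
    by (simp add: inner_axis_matrix_axis)
  then show ?thesis by (simp add: vec_eq_iff)
qed

lemma ln_seq_gauss:
  assumes "\<And>j. j < n \<Longrightarrow> pos_def (\<Omega> j)"
  shows "ln (seq_gauss F H K \<Omega> n y) = (\<Sum>j<n. ln (gauss (\<Omega> j) (y j - H *v kalman F H K y j)))"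
  unfolding seq_gauss_def using gauss_pos[OF assms] by (intro ln_prod) (auto simp: less_imp_neq[THEN not_sym])

lemma sigma_finite_PiM_lborel: "sigma_finite_measure (\<Pi>\<^sub>M i\<in>{..<n::nat}. lborel :: ('a::euclidean_space) measure)"
proof -
  interpret L: product_sigma_finite "\<lambda>_::nat. lborel :: 'a measure" by standard
  show ?thesis by (rule L.sigma_finite) simp
qed

section \<open>Entropy of the noise block\<close>

context state_space_noise
begin

lemma innov_moments:
  shows "sq_integrable M (innov i)"
    and "(LINT \<omega>|M. (a \<bullet> innov i \<omega>) * (b \<bullet> innov i \<omega>)) = a \<bullet> (\<Psi> i *v b)"
proof -
  have "innov_law i = distr (\<Pi>\<^sub>M j\<in>{..<Suc i}. innov_law j) (innov_law i) (\<lambda>p. p i)"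
    by (rule distr_PiM_component[symmetric]) (auto intro: prob_space_gauss innovations)
  also have "\<dots> = distr (distr M (\<Pi>\<^sub>M j\<in>{..<Suc i}. borel) (\<lambda>\<omega>. \<lambda>j\<in>{..<Suc i}. innov j \<omega>)) borel (\<lambda>p. p i)"
    unfolding distr_innov by (intro distr_cong) auto
  also have "\<dots> = distr M borel (\<lambda>\<omega>. (\<lambda>j\<in>{..<Suc i}. innov j \<omega>) i)"
    by (subst distr_distr) (auto simp: o_def intro!: measurable_component_singleton)
  finally have law: "innov_law i = distr M borel (innov i)" by simp
  note gm = gauss_moments[OF innovations[of i], unfolded law]
  show "sq_integrable M (innov i)"
    using gm(1) unfolding sq_integrable_def by (subst (asm) integrable_distr_eq) auto
  show "(LINT \<omega>|M. (a \<bullet> innov i \<omega>) * (b \<bullet> innov i \<omega>)) = a \<bullet> (\<Psi> i *v b)"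
    using gm(3)[of a b] by (subst (asm) integral_distr) auto
qed

text \<open>Evaluated along the noise, the logarithm of the sequential density is a sum of log
  densities of innovations, and each mean is a Gaussian cross entropy with matching
  covariance.\<close>

theorem block_entropy_noise:
  "block_entropy M n z = (\<Sum>j<n. (real CARD('p) * (1 + ln (2 * pi)) + ln (det (\<Psi> j))) / 2)"
proof -
  let ?L = "\<Pi>\<^sub>M i\<in>{..<n}. lborel :: (real^'p) measure"
  let ?Z = "\<lambda>\<omega>. \<lambda>i\<in>{..<n}. z i \<omega>"
  let ?f = "seq_gauss F H Kp \<Psi> n"
  interpret L: sigma_finite_measure ?L by (rule sigma_finite_PiM_lborel)
  have fm: "?f \<in> borel_measurable ?L" by (simp add: PiM_lborel_borel_measurable)
  have pos: "0 < ?f y" for y by (intro seq_gauss_pos innovations)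
  have Z: "?Z \<in> M \<rightarrow>\<^sub>M ?L" by (intro measurable_restrict) simp
  have law: "distr M ?L ?Z = density ?L ?f"
  proof (rule measure_eqI)
    fix A assume "A \<in> sets (distr M ?L ?Z)"
    then have A: "A \<in> sets ?L" by simp
    then have iA: "indicator A \<in> borel_measurable (\<Pi>\<^sub>M j\<in>{..<n}. borel :: (real^'p) measure)"
      by (simp add: PiM_lborel_borel_measurable[symmetric])
    have "emeasure (distr M ?L ?Z) A = (\<integral>\<^sup>+\<omega>. indicator A (?Z \<omega>) \<partial>M)"
      using A Z by (simp add: nn_integral_distr flip: nn_integral_indicator)
    also have "\<dots> = emeasure (density ?L ?f) A"
      unfolding nn_integral_noise[OF iA] using A fm by (subst emeasure_density) (auto simp: mult.commute)
    finally show "emeasure (distr M ?L ?Z) A = emeasure (density ?L ?f) A" .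
  qed simp
  have "KL_divergence (exp 1) ?L (distr M ?L ?Z) = (LINT y|?L. ?f y * ln (?f y))"
    unfolding law log_ln by (rule L.KL_density) (use fm pos in \<open>auto simp: less_imp_le\<close>)
  also have "\<dots> = (LINT y|density ?L ?f. ln (?f y))"
    using fm pos by (subst integral_density) (auto simp: less_imp_le)
  also have "\<dots> = (LINT \<omega>|M. ln (?f (?Z \<omega>)))"
    unfolding law[symmetric] using fm by (intro integral_distr[OF Z]) measurable
  also have "\<dots> = (LINT \<omega>|M. (\<Sum>j<n. ln (gauss (\<Psi> j) (innov j \<omega>))))"
  proof (rule Bochner_Integration.integral_cong[OF refl])
    fix \<omega>
    have "kalman F H Kp (?Z \<omega>) j = kalman F H Kp (\<lambda>j. z j \<omega>) j" if "j < n" for j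
      using that by (intro kalman_cong) auto
    then show "ln (?f (?Z \<omega>)) = (\<Sum>j<n. ln (gauss (\<Psi> j) (innov j \<omega>)))"
      by (simp add: ln_seq_gauss innovations innov_def)
  qed
  also have "\<dots> = (\<Sum>j<n. - ((real CARD('p) * (1 + ln (2 * pi)) + ln (det (\<Psi> j))) / 2))"
    by (simp only: Bochner_Integration.integral_sum
        gauss_cross_entropy[OF innovations innov_moments prob_space_axioms])
  finally show ?thesis
    unfolding block_entropy_def entropy_def sum_negf by (simp only: minus_minus)
qed

end

section \<open>The decision induced by a policy\<close>

lemma integral_product_of_sums:
  fixes X Y X' Y' :: "'w \<Rightarrow> real"
  assumes "sq_integrable M X" "sq_integrable M Y" "sq_integrable M X'" "sq_integrable M Y'"
  shows "(LINT \<omega>|M. (X \<omega> + Y \<omega>) * (X' \<omega> + Y' \<omega>))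
    = (LINT \<omega>|M. X \<omega> * X' \<omega>) + (LINT \<omega>|M. X \<omega> * Y' \<omega>) + (LINT \<omega>|M. Y \<omega> * X' \<omega>) + (LINT \<omega>|M. Y \<omega> * Y' \<omega>)"
proof -
  have "(LINT \<omega>|M. (X \<omega> + Y \<omega>) * (X' \<omega> + Y' \<omega>))
    = (LINT \<omega>|M. X \<omega> * X' \<omega> + X \<omega> * Y' \<omega> + Y \<omega> * X' \<omega> + Y \<omega> * Y' \<omega>)"
    by (intro Bochner_Integration.integral_cong) (simp_all add: algebra_simps)
  then show ?thesis using assms by (simp add: integrable_mult_sq_integrable)
qed

locale power_limited_channel = feedback_channel M F G H W V L s w v z \<Sigma> Kp \<Psi> \<Lambda> \<kappa> n
  for M :: "'w measure"
    and F :: "real^'d^'d" and G :: "real^'q^'d" and H :: "real^'d^'p"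
    and W :: "real^'q^'q" and V :: "real^'p^'p" and L :: "real^'p^'q"
    and s :: "nat \<Rightarrow> 'w \<Rightarrow> real^'d" and w :: "nat \<Rightarrow> 'w \<Rightarrow> real^'q"
    and v z :: "nat \<Rightarrow> 'w \<Rightarrow> real^'p"
    and \<Sigma> :: "nat \<Rightarrow> real^'d^'d" and Kp :: "nat \<Rightarrow> real^'p^'d" and \<Psi> :: "nat \<Rightarrow> real^'p^'p"
    and \<Lambda> :: "real^'m^'p" and \<kappa> :: "('m, 'p) policy" and n :: nat +
  fixes P :: real
  assumes power: "power_constraint (joint_law M z \<Lambda> n \<kappa>) n P"
begin

section \<open>The output-driven filter and its error\<close>

definition input :: "nat \<Rightarrow> (nat \<Rightarrow> (real^'m) \<times> (real^'p)) \<Rightarrow> real^'m" where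
  "input t h = fst (h t)"

text \<open>The gain of the linear output filter depends on the second moments of its own error, so the
  filter is constructed recursively as a function on histories.\<close>

definition step_gain :: "nat \<Rightarrow> ((nat \<Rightarrow> (real^'m) \<times> (real^'p)) \<Rightarrow> real^'d) \<Rightarrow> real^'p^'d" where
  "step_gain t E = output_gain \<Lambda> F H Kp \<Psi> (\<lambda>t. cross_moment (J n) (input t) (input t),
     \<lambda>t. cross_moment (J n) (input t) E, \<lambda>_. cross_moment (J n) E E) t"

primrec estimate :: "nat \<Rightarrow> (nat \<Rightarrow> (real^'m) \<times> (real^'p)) \<Rightarrow> real^'d" where
  "estimate 0 = (\<lambda>_. 0)"
| "estimate (Suc t) = (\<lambda>h. F *v estimate t h
     + step_gain t (\<lambda>h. predicted_state t h - estimate t h) *v (snd (h t) - H *v estimate t h))"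

definition est_error :: "nat \<Rightarrow> (nat \<Rightarrow> (real^'m) \<times> (real^'p)) \<Rightarrow> real^'d" where
  "est_error t h = predicted_state t h - estimate t h"

definition out_innov :: "nat \<Rightarrow> (nat \<Rightarrow> (real^'m) \<times> (real^'p)) \<Rightarrow> real^'p" where
  "out_innov t h = snd (h t) - H *v estimate t h"

definition decision_of_policy :: "('m, 'd) decision" where
  "decision_of_policy = (\<lambda>t. cross_moment (J n) (input t) (input t),
     \<lambda>t. cross_moment (J n) (input t) (est_error t), \<lambda>t. cross_moment (J n) (est_error t) (est_error t))"

abbreviation "KY t \<equiv> output_gain \<Lambda> F H Kp \<Psi> decision_of_policy t"
abbreviation "\<Psi>Y t \<equiv> output_cov \<Lambda> H \<Psi> decision_of_policy t"

text \<open>Closes the recursive construction: the gain at \<open>t\<close> reads moments at time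
  \<open>t\<close> only, so the gain used along the way is that of the finished decision.\<close>

lemma step_gain_eq: "step_gain t (\<lambda>h. predicted_state t h - estimate t h) = KY t"
  by (simp add: step_gain_def decision_of_policy_def output_gain_def output_cov_def est_error_def[abs_def])

lemma estimate_eq_kalman: "estimate t h = kalman F H KY (\<lambda>j. snd (h j)) t"
  by (induction t) (simp_all add: step_gain_eq)

text \<open>The first two terms are determined by the past at time \<open>t\<close> and the last one
  is fresh, the same split as in the formula for the output covariance.\<close>

lemma out_innov_eq: "out_innov t h = \<Lambda> *v input t h + H *v est_error t h + obs_innov t h"
  by (simp add: out_innov_def input_def est_error_def obs_innov_def noise_of_def matrix_vector_mult_diff_distrib)

lemma est_error_0: "est_error 0 h = 0"
  by (simp add: est_error_def predicted_state_def)

lemma est_error_Suc: "est_error (Suc t) h = F *v est_error t h + Kp t *v obs_innov t h - KY t *v out_innov t h"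
  by (simp add: est_error_def out_innov_def predicted_state_def obs_innov_def step_gain_eq[unfolded predicted_state_def]
      matrix_vector_mult_diff_distrib)

lemma est_error_measurable:
  assumes "t \<le> k" shows "est_error t \<in> borel_measurable (history_space k)"
proof -
  have "(\<lambda>h. kalman F H KY (\<lambda>j. snd (h j)) t) \<in> borel_measurable (history_space k)"
  proof (rule kalman_measurable)
    fix j assume "j < t"
    then have "(\<lambda>h. h j) \<in> history_space k \<rightarrow>\<^sub>M borel \<Otimes>\<^sub>M borel" using assms by (intro component_measurable) simp
    then show "(\<lambda>h. snd (h j)) \<in> borel_measurable (history_space k)" by (rule measurable_compose[OF _ measurable_snd])
  qed
  then show ?thesis
    unfolding est_error_def[abs_def] estimate_eq_kalman using predicted_state_measurable[OF assms]
    by (intro borel_measurable_diff)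
qed

text \<open>The error is a function of the history before \<open>t\<close>, so it counts as part of
  \<open>past t\<close>.\<close>

lemma est_error_restrict: "est_error t (restrict h {..<t}) = est_error t h"
proof -
  have "kalman F H KY (\<lambda>j. snd (restrict h {..<t} j)) t = kalman F H KY (\<lambda>j. snd (h j)) t"
    by (intro kalman_cong) auto
  moreover have "predicted_state t (restrict h {..<t}) = predicted_state t h" by (intro predicted_state_cong) auto
  ultimately show ?thesis by (simp add: est_error_def estimate_eq_kalman)
qed

lemma sq_integrable_input: "t < n \<Longrightarrow> sq_integrable (J n) (input t)"
proof -
  assume t: "t < n"
  have "integrable (J n) (\<lambda>h. fst (h t) \<bullet> fst (h t))" using power t by (simp add: power_constraint_def)
  moreover have "(\<lambda>h. fst (h t)) \<in> borel_measurable (J n)"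
    using measurable_compose[OF component_measurable[OF t] measurable_fst] by (simp add: joint_measurable)
  ultimately show ?thesis by (simp add: sq_integrable_def input_def[abs_def] power2_norm_eq_inner)
qed

text \<open>Each new error is linear in the old error, the input and an innovation, so the power
  constraint and induction suffice.\<close>

lemma sq_integrable_errors:
  shows "t \<le> n \<Longrightarrow> sq_integrable (J n) (est_error t)"
    and "t < n \<Longrightarrow> sq_integrable (J n) (out_innov t)"
proof -
  have out: "sq_integrable (J n) (out_innov t)" if "t < n" "sq_integrable (J n) (est_error t)" for t
    unfolding out_innov_eq[abs_def]
    using that by (intro sq_integrable_add sq_integrable_matrix sq_integrable_input obs_innov_moments(1))
  show err: "sq_integrable (J n) (est_error t)" if "t \<le> n" for t
    using that
  proof (induction t)
    case 0 then show ?case by (simp add: est_error_0[abs_def] sq_integrable_def)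
  next
    case (Suc t)
    then show ?case unfolding est_error_Suc[abs_def]
      by (intro sq_integrable_add sq_integrable_diff sq_integrable_matrix out obs_innov_moments(1)) auto
  qed
  show "t < n \<Longrightarrow> sq_integrable (J n) (out_innov t)" using out err by simp
qed

section \<open>Second moments of the filter\<close>

definition mixture :: "nat \<Rightarrow> real^'m \<Rightarrow> real^'d \<Rightarrow> (nat \<Rightarrow> (real^'m) \<times> (real^'p)) \<Rightarrow> real" where
  "mixture t a g h = a \<bullet> input t h + g \<bullet> est_error t h"

lemma sq_integrable_mixture: "t < n \<Longrightarrow> sq_integrable (J n) (mixture t a g)"
  unfolding mixture_def[abs_def]
  by (intro sq_integrable_add sq_integrable_inner_left sq_integrable_input sq_integrable_errors) auto

lemma mixture_moment:
  assumes t: "t < n"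
  shows "(LINT h|J n. mixture t a g h * mixture t b f h)
    = a \<bullet> (fst decision_of_policy t *v b) + a \<bullet> (fst (snd decision_of_policy) t *v f)
      + b \<bullet> (fst (snd decision_of_policy) t *v g) + g \<bullet> (snd (snd decision_of_policy) t *v f)"
proof -
  note sq = sq_integrable_input[OF t] sq_integrable_errors(1)[OF less_imp_le[OF t]]
  note sqi = sq[THEN sq_integrable_inner_left]
  have "(LINT h|J n. (g \<bullet> est_error t h) * (b \<bullet> input t h)) = (LINT h|J n. (b \<bullet> input t h) * (g \<bullet> est_error t h))"
    by (simp only: mult.commute)
  then show ?thesis
    unfolding mixture_def decision_of_policy_def
    by (simp add: integral_product_of_sums sqi cross_moment_form sq)
qed

text \<open>This links moments to the optimization problem: the form of the first block is a mean
  square, hence nonnegative.\<close>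

lemma mixture_form:
  assumes "t < n"
  shows "(LINT h|J n. mixture t a g h * mixture t a g h) = joint_form decision_of_policy t a g"
  unfolding mixture_moment[OF assms] joint_form_def by (simp add: case_prod_unfold)

lemma mixture_innov_uncorrelated:
  assumes t: "t < n"
  shows "(LINT h|J n. mixture t a g h * (b \<bullet> obs_innov t h)) = 0"
proof -
  have eq: "mixture t a g h = (\<lambda>p. a \<bullet> snd p + g \<bullet> est_error t (fst p)) (past t h)" for h
    by (simp add: mixture_def past_def est_error_restrict input_def)
  have [measurable]: "est_error t \<in> borel_measurable (history_space t)" by (rule est_error_measurable) simp
  have "(\<lambda>p. a \<bullet> snd p + g \<bullet> est_error t (fst p)) \<in> borel_measurable (history_space t \<Otimes>\<^sub>M borel)" by measurable
  from innov_uncorrelated[OF t this, of b] sq_integrable_mixture[OF t, of a g] show ?thesis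
    unfolding eq by blast
qed

lemma innov_combination_moment:
  assumes t: "t < n"
  shows "(LINT h|J n. (mixture t a g h + k \<bullet> obs_innov t h) * (mixture t b f h + l \<bullet> obs_innov t h))
    = (LINT h|J n. mixture t a g h * mixture t b f h) + k \<bullet> (\<Psi> t *v l)"
proof -
  have "(LINT h|J n. (k \<bullet> obs_innov t h) * mixture t b f h) = 0"
    using mixture_innov_uncorrelated[OF t, of b f k] by (simp only: mult.commute)
  then show ?thesis
    using mixture_innov_uncorrelated[OF t, of a g l] obs_innov_moments[OF t]
    by (subst integral_product_of_sums) (auto intro: sq_integrable_mixture t sq_integrable_inner_left)
qed

lemma inner_out_innov:
  "y \<bullet> out_innov t h = mixture t (transpose \<Lambda> *v y) (transpose H *v y) h + y \<bullet> obs_innov t h"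
  using inner_matrix_vector_adjoint[of y \<Lambda> "input t h"] inner_matrix_vector_adjoint[of y H "est_error t h"]
  by (simp add: out_innov_eq mixture_def inner_add_right)

lemma decision_of_policy_symmetric:
  "transpose (fst decision_of_policy t) = fst decision_of_policy t"
  "transpose (snd (snd decision_of_policy) t) = snd (snd decision_of_policy) t"
  by (simp_all add: decision_of_policy_def cross_moment_transpose)

lemma joint_form_nonneg: "t < n \<Longrightarrow> 0 \<le> joint_form decision_of_policy t a g"
  unfolding mixture_form[symmetric] by (intro Bochner_Integration.integral_nonneg) simp

lemma pos_def_\<Psi>Y: "t < n \<Longrightarrow> pos_def (\<Psi>Y t)"
  using pos_def_output_cov[of "fst decision_of_policy" t "snd (snd decision_of_policy)" \<Psi> "fst (snd decision_of_policy)" \<Lambda> H]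
    decision_of_policy_symmetric joint_form_nonneg innovations by simp

text \<open>Both matrices are symmetric, so agreement of their quadratic forms suffices; the
  diagonal case is the mean square of a mixture plus a fresh innovation.\<close>

lemma out_innov_moment:
  assumes t: "t < n"
  shows "(LINT h|J n. (a \<bullet> out_innov t h) * (b \<bullet> out_innov t h)) = a \<bullet> (\<Psi>Y t *v b)"
proof -
  note cm = cross_moment_form[OF sq_integrable_errors(2)[OF t] sq_integrable_errors(2)[OF t]]
  have "cross_moment (J n) (out_innov t) (out_innov t) = \<Psi>Y t"
  proof (rule symmetric_eq_if_forms_eq)
    show "transpose (cross_moment (J n) (out_innov t) (out_innov t)) = cross_moment (J n) (out_innov t) (out_innov t)"
      by (rule cross_moment_transpose)
    show "transpose (\<Psi>Y t) = \<Psi>Y t" using pos_def_\<Psi>Y[OF t] by (simp add: pos_def_def)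
    show "x \<bullet> (cross_moment (J n) (out_innov t) (out_innov t) *v x) = x \<bullet> (\<Psi>Y t *v x)" for x
      unfolding cm[symmetric] inner_out_innov innov_combination_moment[OF t] mixture_form[OF t] output_cov_form ..
  qed
  then show ?thesis using cm by simp
qed

lemma gain_mult_\<Psi>Y:
  assumes t: "t < n"
  shows "KY t ** \<Psi>Y t = F ** transpose (fst (snd decision_of_policy) t) ** transpose \<Lambda>
      + F ** snd (snd decision_of_policy) t ** transpose H + Kp t ** \<Psi> t"
  using output_gain_mult[of \<Lambda> H \<Psi> "fst decision_of_policy" "fst (snd decision_of_policy)" "snd (snd decision_of_policy)" t F Kp]
    pos_def_\<Psi>Y[OF t] by simp

lemma inner_prediction:
  "b \<bullet> (F *v est_error t h + Kp t *v obs_innov t h)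
    = mixture t 0 (transpose F *v b) h + (transpose (Kp t) *v b) \<bullet> obs_innov t h"
  using inner_matrix_vector_adjoint[of b F "est_error t h"] inner_matrix_vector_adjoint[of b "Kp t" "obs_innov t h"]
  by (simp add: mixture_def inner_add_right)

text \<open>The gain is chosen for this orthogonality.\<close>

lemma est_error_orthogonal:
  assumes t: "t < n"
  shows "(LINT h|J n. (a \<bullet> out_innov t h) * (b \<bullet> est_error (Suc t) h)) = 0"
proof -
  let ?Pr = "\<lambda>h. F *v est_error t h + Kp t *v obs_innov t h"
  let ?\<Gamma> = "fst (snd decision_of_policy) t" and ?S = "snd (snd decision_of_policy) t"
  note sqo = sq_integrable_errors(2)[OF t]
  have sqp: "sq_integrable (J n) ?Pr"
    using t by (intro sq_integrable_add sq_integrable_matrix sq_integrable_errors obs_innov_moments(1)) auto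
  \<comment> \<open>The added zero gives both factors the two-term shape of
    \<open>integral_product_of_sums\<close>.\<close>
  have "(LINT h|J n. (a \<bullet> out_innov t h) * (b \<bullet> est_error (Suc t) h))
    = (LINT h|J n. (a \<bullet> out_innov t h + 0) * (b \<bullet> ?Pr h + (- (transpose (KY t) *v b)) \<bullet> out_innov t h))"
    by (intro Bochner_Integration.integral_cong)
       (simp_all only: est_error_Suc diff_conv_add_uminus inner_add_right inner_minus_right inner_minus_left
          add_0_right inner_matrix_vector_adjoint[of b "KY t"])
  also have "\<dots> = (LINT h|J n. (a \<bullet> out_innov t h) * (b \<bullet> ?Pr h)) - a \<bullet> (\<Psi>Y t *v (transpose (KY t) *v b))"
    using sqo sqp
    by (subst integral_product_of_sums)
       (auto intro: sq_integrable_inner_left simp: sq_integrable_def[of _ "\<lambda>_. 0"] out_innov_moment[OF t] linear_neg[OF matrix_vector_mul_linear] simp del: transpose_matrix_vector inner_minus_left)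
  also have "(LINT h|J n. (a \<bullet> out_innov t h) * (b \<bullet> ?Pr h))
    = (transpose \<Lambda> *v a) \<bullet> (?\<Gamma> *v (transpose F *v b)) + (transpose H *v a) \<bullet> (?S *v (transpose F *v b)) + a \<bullet> (\<Psi> t *v (transpose (Kp t) *v b))"
    unfolding inner_out_innov inner_prediction innov_combination_moment[OF t] mixture_moment[OF t] by simp
  also have "\<dots> = a \<bullet> (transpose (KY t ** \<Psi>Y t) *v b)"
  proof -
    have "a \<bullet> ((\<Lambda> ** ?\<Gamma> ** transpose F) *v b) = (transpose \<Lambda> *v a) \<bullet> (?\<Gamma> *v (transpose F *v b))"
      "a \<bullet> ((H ** ?S ** transpose F) *v b) = (transpose H *v a) \<bullet> (?S *v (transpose F *v b))"
      by (rule inner_sandwich)+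
    moreover have "transpose (KY t ** \<Psi>Y t) = \<Lambda> ** ?\<Gamma> ** transpose F + H ** ?S ** transpose F + \<Psi> t ** transpose (Kp t)"
      unfolding gain_mult_\<Psi>Y[OF t]
      by (simp add: transpose_add matrix_transpose_mul decision_of_policy_symmetric symmetric_matrices(3) matrix_mul_assoc)
    ultimately show ?thesis
      by (simp only: matrix_vector_mult_add_rdistrib inner_add_right matrix_vector_mul_assoc)
  qed
  also have "transpose (KY t ** \<Psi>Y t) *v b = \<Psi>Y t *v (transpose (KY t) *v b)"
    using pos_def_\<Psi>Y[OF t] by (simp only: matrix_transpose_mul pos_def_def matrix_vector_mul_assoc)
  finally show ?thesis by simp
qed

text \<open>Pythagoras: the combination \<open>?z\<close> is the sum of a multiple of the output
  innovation and the projected next error, which are orthogonal. The right side is the mean square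
  of \<open>?z\<close>, the left side that of the error part.\<close>

lemma error_cov_le:
  assumes t: "t < n"
  shows "x \<bullet> (snd (snd decision_of_policy) (Suc t) *v x)
    \<le> joint_form decision_of_policy t (transpose \<Lambda> *v y) (transpose F *v x + transpose H *v y)
        + (transpose (Kp t) *v x + y) \<bullet> (\<Psi> t *v (transpose (Kp t) *v x + y))"
proof -
  let ?k = "y + transpose (KY t) *v x"
  let ?z = "\<lambda>h. mixture t (transpose \<Lambda> *v y) (transpose F *v x + transpose H *v y) h + (transpose (Kp t) *v x + y) \<bullet> obs_innov t h"
  have sqe: "sq_integrable (J n) (\<lambda>h. x \<bullet> est_error (Suc t) h)" and sqo: "sq_integrable (J n) (\<lambda>h. ?k \<bullet> out_innov t h)"
    using t by (auto intro!: sq_integrable_inner_left sq_integrable_errors)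
  have z: "?z h = ?k \<bullet> out_innov t h + x \<bullet> est_error (Suc t) h" for h
  proof -
    have "?k \<bullet> out_innov t h + x \<bullet> est_error (Suc t) h = y \<bullet> out_innov t h + x \<bullet> (F *v est_error t h + Kp t *v obs_innov t h)"
      using inner_matrix_vector_adjoint[of x "KY t" "out_innov t h"]
      by (simp only: est_error_Suc inner_diff_right inner_add_left)
    also have "\<dots> = ?z h" unfolding inner_out_innov inner_prediction by (simp add: mixture_def inner_add_left)
    finally show ?thesis ..
  qed
  have orth: "(LINT h|J n. (?k \<bullet> out_innov t h) * (x \<bullet> est_error (Suc t) h)) = 0"
    "(LINT h|J n. (x \<bullet> est_error (Suc t) h) * (?k \<bullet> out_innov t h)) = 0"
    using est_error_orthogonal[OF t, of ?k x] by (simp_all only: mult.commute)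
  have "x \<bullet> (snd (snd decision_of_policy) (Suc t) *v x) = (LINT h|J n. (x \<bullet> est_error (Suc t) h) * (x \<bullet> est_error (Suc t) h))"
    using sq_integrable_errors(1)[of "Suc t"] t by (simp add: decision_of_policy_def cross_moment_form)
  also have "\<dots> \<le> (LINT h|J n. (?k \<bullet> out_innov t h) * (?k \<bullet> out_innov t h)) + \<dots>"
    by (simp add: Bochner_Integration.integral_nonneg)
  also have "\<dots> = (LINT h|J n. (?k \<bullet> out_innov t h + x \<bullet> est_error (Suc t) h) * (?k \<bullet> out_innov t h + x \<bullet> est_error (Suc t) h))"
    unfolding integral_product_of_sums[OF sqo sqe sqo sqe] orth by simp
  also have "\<dots> = (LINT h|J n. ?z h * ?z h)" by (simp only: z)
  also have "\<dots> = joint_form decision_of_policy t (transpose \<Lambda> *v y) (transpose F *v x + transpose H *v y)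
        + (transpose (Kp t) *v x + y) \<bullet> (\<Psi> t *v (transpose (Kp t) *v x + y))"
    unfolding innov_combination_moment[OF t] mixture_form[OF t] ..
  finally show ?thesis .
qed

theorem feasible_decision_of_policy: "feasible \<Lambda> F H Kp \<Psi> n P decision_of_policy"
proof -
  obtain Q \<Gamma> S where u: "decision_of_policy = (Q, \<Gamma>, S)" by (cases decision_of_policy)
  \<comment> \<open>Because the moments are not centred, the trace is exactly the power of the
    input.\<close>
  have tr: "trace (Q t) = (LINT h|J n. fst (h t) \<bullet> fst (h t))" if t: "t < n" for t
  proof -
    have "integrable (J n) (\<lambda>h. fst (h t) $ i * fst (h t) $ i)" for i
      using sq_integrable_nth[OF sq_integrable_input[OF t], of i]
      by (intro integrable_mult_sq_integrable) (simp_all add: input_def)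
    moreover have "Q = fst decision_of_policy" by (simp add: u)
    then have "Q t = cross_moment (J n) (input t) (input t)" by (simp add: decision_of_policy_def)
    ultimately show ?thesis by (simp add: trace_def cross_moment_def inner_vec_def input_def)
  qed
  have "1 / real n * (\<Sum>t<n. trace (Q t)) \<le> P" using power tr by (simp add: power_constraint_def)
  moreover have "S 0 = 0" using u by (auto simp: decision_of_policy_def cross_moment_def est_error_0 vec_eq_iff)
  moreover have "pos_semidef (S n)"
  proof -
    have "x \<bullet> (S n *v x) = (LINT h|J n. (x \<bullet> est_error n h) * (x \<bullet> est_error n h))" for x
      using u cross_moment_form[OF sq_integrable_errors(1)[OF order_refl] sq_integrable_errors(1)[OF order_refl], of x x]
      by (auto simp: decision_of_policy_def)
    then show ?thesis using decision_of_policy_symmetric(2)[of n] u by (simp add: pos_semidef_def Bochner_Integration.integral_nonneg)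
  qed
  ultimately show ?thesis
    unfolding u feasible_iff[where \<Psi>=\<Psi>, OF innovations]
    using joint_form_nonneg[unfolded u] error_cov_le[unfolded u] decision_of_policy_symmetric[unfolded u] by simp
qed

text \<open>The cross entropy against the sequential Gaussian density depends only on second moments
  of the output innovations, so the output law itself never has to be known.\<close>

lemma block_entropy_output_le:
  "block_entropy (J n) n (\<lambda>i h. snd (h i)) \<le> (\<Sum>j<n. (real CARD('p) * (1 + ln (2 * pi)) + ln (det (\<Psi>Y j))) / 2)"
proof -
  let ?L = "\<Pi>\<^sub>M i\<in>{..<n}. lborel :: (real^'p) measure"
  let ?Y = "\<lambda>h. \<lambda>i\<in>{..<n}. snd (h i) :: real^'p"
  interpret L: sigma_finite_measure ?L by (rule sigma_finite_PiM_lborel)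
  interpret Jn: prob_space "J n" by (rule joint_law_prob(2)) simp
  have pd: "\<And>j. j < n \<Longrightarrow> pos_def (\<Psi>Y j)" by (rule pos_def_\<Psi>Y)
  let ?g = "seq_gauss F H KY \<Psi>Y n"
  have Y: "?Y \<in> J n \<rightarrow>\<^sub>M ?L"
    unfolding joint_measurable[OF order_refl]
    by (intro measurable_restrict measurable_compose[OF component_measurable]) auto
  have gm: "?g \<in> borel_measurable ?L" by (simp add: PiM_lborel_borel_measurable)
  have lng: "ln (?g (?Y h)) = (\<Sum>j<n. ln (gauss (\<Psi>Y j) (out_innov j h)))" for h
  proof -
    have "kalman F H KY (?Y h) j = estimate j h" if "j < n" for j
      unfolding estimate_eq_kalman using that by (intro kalman_cong) auto
    then show ?thesis by (simp add: ln_seq_gauss pd out_innov_def)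
  qed
  have ce: "integrable (J n) (\<lambda>h. ln (gauss (\<Psi>Y j) (out_innov j h)))"
    "(LINT h|J n. ln (gauss (\<Psi>Y j) (out_innov j h))) = - ((real CARD('p) * (1 + ln (2 * pi)) + ln (det (\<Psi>Y j))) / 2)" if "j < n" for j
    using gauss_cross_entropy[OF pd[OF that] sq_integrable_errors(2)[OF that] out_innov_moment[OF that] Jn.prob_space_axioms] by auto
  have lnm: "(\<lambda>y. ln (?g y)) \<in> borel_measurable ?L" using gm by measurable
  have "(LINT y|distr (J n) ?L ?Y. ln (?g y)) \<le> KL_divergence (exp 1) ?L (distr (J n) ?L ?Y)"
  proof (rule L.KL_divergence_ge)
    show "prob_space (distr (J n) ?L ?Y)" by (rule Jn.prob_space_distr[OF Y])
    \<comment> \<open>The domination constant is the product of the peak values of the innovation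
      densities.\<close>
    show "(\<integral>\<^sup>+y. f y \<partial>distr (J n) ?L ?Y) \<le> ennreal (\<Prod>j<n. gauss (\<Psi> j) 0) * (\<integral>\<^sup>+y. f y \<partial>?L)"
      if "f \<in> borel_measurable ?L" for f
      using nn_integral_output_le[OF order_refl, of f] that Y
      by (simp add: PiM_lborel_borel_measurable nn_integral_distr)
    show "0 < ?g y" for y by (rule seq_gauss_pos[OF pd])
    show "(\<integral>\<^sup>+y. ennreal (?g y) \<partial>?L) \<le> 1" by (simp add: nn_integral_seq_gauss[OF pd])
    have "integrable (J n) (\<lambda>h. ln (?g (?Y h)))" unfolding lng using ce(1) by auto
    then show "integrable (distr (J n) ?L ?Y) (\<lambda>y. ln (?g y))" by (subst integrable_distr_eq[OF Y lnm])
  qed (use gm in simp_all)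
  moreover have "(LINT y|distr (J n) ?L ?Y. ln (?g y)) = (\<Sum>j<n. - ((real CARD('p) * (1 + ln (2 * pi)) + ln (det (\<Psi>Y j))) / 2))"
    unfolding integral_distr[OF Y lnm] lng using ce by simp
  ultimately show ?thesis
    unfolding block_entropy_def Jn.entropy_def sum_negf by linarith
qed

text \<open>The terms with \<open>1 + ln (2 * pi)\<close> agree in both entropies and cancel,
  leaving the log determinants.\<close>

theorem information_le_objective:
  "1 / real n * (block_entropy (J n) n (\<lambda>i h. snd (h i)) - block_entropy M n z) \<le> objective \<Lambda> H \<Psi> n decision_of_policy"
proof -
  have "block_entropy (J n) n (\<lambda>i h. snd (h i)) - block_entropy M n z \<le> (\<Sum>j<n. ln (det (\<Psi>Y j)) - ln (det (\<Psi> j))) / 2"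
    using block_entropy_output_le unfolding block_entropy_noise
    by (simp add: sum_divide_distrib sum_subtractf add_divide_distrib diff_divide_distrib sum.distrib)
  then have "1 / real n * (block_entropy (J n) n (\<lambda>i h. snd (h i)) - block_entropy M n z)
     \<le> 1 / real n * ((\<Sum>j<n. ln (det (\<Psi>Y j)) - ln (det (\<Psi> j))) / 2)" by (rule mult_left_mono) simp
  then show ?thesis by (simp add: objective_def)
qed

end

theorem lemma4:
  fixes M :: "'w measure"
    and \<Lambda> :: "real^'m^'p"
    and F :: "real^'d^'d" and G :: "real^'q^'d" and H :: "real^'d^'p"
    and W :: "real^'q^'q" and V :: "real^'p^'p" and L :: "real^'p^'q"
    and s :: "nat \<Rightarrow> 'w \<Rightarrow> real^'d" and w :: "nat \<Rightarrow> 'w \<Rightarrow> real^'q"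
    and v z :: "nat \<Rightarrow> 'w \<Rightarrow> real^'p"
    and \<Sigma> :: "nat \<Rightarrow> real^'d^'d" and Kp :: "nat \<Rightarrow> real^'p^'d" and \<Psi> :: "nat \<Rightarrow> real^'p^'p"
    and n :: nat and P :: real
  assumes "prob_space M"
    and state: "\<And>i \<omega>. s (Suc i) \<omega> = F *v s i \<omega> + G *v w i \<omega>"
    and noise: "\<And>i \<omega>. z i \<omega> = H *v s i \<omega> + v i \<omega>"
    and initial: "gaussian_vector M (s 0)" "(LINT \<omega>|M. s 0 \<omega>) = 0" "cov_matrix M (s 0) = \<Sigma> 0"
    and gaussian: "\<And>i. gaussian_vector M (\<lambda>\<omega>. (w i \<omega>, v i \<omega>))"
    and zero_mean: "\<And>i. (LINT \<omega>|M. w i \<omega>) = 0" "\<And>i. (LINT \<omega>|M. v i \<omega>) = 0"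
    and covariances: "\<And>i. cov_matrix M (w i) = W" "\<And>i. cov_matrix M (v i) = V"
      "\<And>i. cross_moment M (w i) (v i) = L"
    and independent: "prob_space.indep_vars M (\<lambda>_. borel) (\<lambda>i \<omega>. (w i \<omega>, v i \<omega>)) UNIV"
    and identically_distributed:
      "\<And>i j. distr M borel (\<lambda>\<omega>. (w i \<omega>, v i \<omega>)) = distr M borel (\<lambda>\<omega>. (w j \<omega>, v j \<omega>))"
    and independent_of_initial:
      "indep_pair M borel (s 0) (\<Pi>\<^sub>M i\<in>UNIV. borel) (\<lambda>\<omega> i. (w i \<omega>, v i \<omega>))"
    and riccati:
      "\<And>i. \<Sigma> (Suc i) = F ** \<Sigma> i ** transpose F + G ** W ** transpose G
                        - Kp i ** \<Psi> i ** transpose (Kp i)"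
      "\<And>i. Kp i = (F ** \<Sigma> i ** transpose H + G ** L) ** matrix_inv (\<Psi> i)"
      "\<And>i. \<Psi> i = H ** \<Sigma> i ** transpose H + V"
    and innovations: "\<And>i. pos_def (\<Psi> i)"
    and "1 \<le> n" and "0 \<le> P"
  shows "convex_maximization (objective \<Lambda> H \<Psi> n) (feasible \<Lambda> F H Kp \<Psi> n P) \<and>
    (\<exists>u. is_arg_max (objective \<Lambda> H \<Psi> n) (feasible \<Lambda> F H Kp \<Psi> n P) u \<and>
         n_letter_capacity M z \<Lambda> n P \<le> ereal (objective \<Lambda> H \<Psi> n u))"
proof (rule conjI[OF convex_maximization_objective[where \<Psi>=\<Psi>, OF innovations]])
  \<comment> \<open>Here \<open>0 \<le> P\<close> enters: it makes the zero decision feasible, so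
    that the maximum is taken over a nonempty set.\<close>
  obtain u where u: "is_arg_max (objective \<Lambda> H \<Psi> n) (feasible \<Lambda> F H Kp \<Psi> n P) u"
    using objective_has_maximizer[where \<Psi>=\<Psi>, OF innovations \<open>0 \<le> P\<close>] by blast
  have "state_space_noise M F G H W V L s w v z \<Sigma> Kp \<Psi>"
    using assms by (intro state_space_noise.intro state_space_noise_axioms.intro)
  note noise_locale = this
  have "n_letter_capacity M z \<Lambda> n P \<le> ereal (objective \<Lambda> H \<Psi> n u)"
    unfolding n_letter_capacity_def
  proof (rule SUP_least)
    fix \<kappa> :: "('m, 'p) policy"
    assume "\<kappa> \<in> {\<kappa>. policy n \<kappa> \<and> power_constraint (joint_law M z \<Lambda> n \<kappa>) n P}"
    then interpret power_limited_channel M F G H W V L s w v z \<Sigma> Kp \<Psi> \<Lambda> \<kappa> n P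
      using noise_locale by (intro power_limited_channel.intro feedback_channel.intro
          feedback_channel_axioms.intro power_limited_channel_axioms.intro) auto
    have "objective \<Lambda> H \<Psi> n decision_of_policy \<le> objective \<Lambda> H \<Psi> n u"
      using u feasible_decision_of_policy unfolding is_arg_max_def by (metis linorder_not_less)
    with information_le_objective
    show "ereal (1 / real n * (block_entropy (joint_law M z \<Lambda> n \<kappa>) n (\<lambda>i h. snd (h i)) - block_entropy M n z))
      \<le> ereal (objective \<Lambda> H \<Psi> n u)" by simp
  qed
  with u show "\<exists>u. is_arg_max (objective \<Lambda> H \<Psi> n) (feasible \<Lambda> F H Kp \<Psi> n P) u \<and>
         n_letter_capacity M z \<Lambda> n P \<le> ereal (objective \<Lambda> H \<Psi> n u)" by blast
qed

end
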